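(* Let $g$ be a regularizer with constant $B$, let $T\in[0,\infty]$, and let $\tau_{DP}=\inf\{t\ge 0:\|\mathbf Y-S_n\hat f^{(t)}\|_n^2\le\sigma^2\}\wedge T$. Suppose that: (1) (sub-Gaussian noise) there is a constant $A\ge 1$ such that $q^{-1/2}(\mathbb E(|\epsilon|^q|X))^{1/q}\le A\sigma$ for all $q\ge1$; (2) (bounded kernel) $\|k_X\|_{\mathcal H}\le M$ almost surely; (3) (eigenvalue bound) there is a constant $E>0$ such that for every $0\le k\le n-1$ with $\hat\lambda_kT\ge1$ (the case $k=0$ being always included), $\sum_{j>k}\hat\lambda_j\le E\,(k\vee1)\,\hat\lambda_{k+1}$; (4) there is a constant $b>0$ such that $\lambda g_t(\lambda)\ge b(1\wedge\lambda t)$ for all $(\lambda,t)\in(0,M^2]\times[0,\infty)$. Then there is a constant $C>0$ depending only on $A,b,B,E$ such that for every $u>1$, $$\mathbf P_\epsilon\Big(\|\mathbf f-\hat{\mathbf f}^{(\tau_{DP})}\|_n^2>C\Big(\min_{0\le t\le T}\mathbf E_\epsilon\|\mathbf f-\hat{\mathbf f}^{(t)}\|_n^2+\frac{\sigma^2\sqrt u}{\sqrt n}+\frac{\sigma^2u}{n}\Big)\Big)\le5e^{-u}.$$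
   Context: Setting: $\mathcal X\subseteq\mathbb R^d$; $(X,Y)$ satisfies $Y=f(X)+\epsilon$ with $X\in\mathcal X$, $f:\mathcal X\to\mathbb R$ a (measurable) regression function, $\mathbb E(\epsilon|X)=0$, $\mathbb E(\epsilon^2|X)=\sigma^2$ with known $\sigma^2>0$. $k$ is a continuous positive kernel on $\mathcal X$ with reproducing kernel Hilbert space $\mathcal H$; $k_x=k(x,\cdot)$; $M>0$ is a constant. $(X_1,Y_1),\dots,(X_n,Y_n)$ are independent copies of $(X,Y)$, $\epsilon_i=Y_i-f(X_i)$; $\mathbf Y=(Y_i)_i$, $\boldsymbol\epsilon=(\epsilon_i)_i$, $\mathbf f=(f(X_i))_i$ in $\mathbb R^n$. $\mathbb R^n$ carries $\langle a,b\rangle_n=\frac1n\sum_ia_ib_i$ and the corresponding norm $\|\cdot\|_n$. $S_n:\mathcal H\to\mathbb R^n$, $S_nh=(h(X_i))_i$, has adjoint $S_n^*$ (w.r.t. $\langle\cdot,\cdot\rangle_n$); $K_n=S_nS_n^*=(k(X_i,X_j)/n)_{i,j}$, $\Sigma_n=S_n^*S_n=\frac1n\sum_ik_{X_i}\otimes k_{X_i}$. $\hat\lambda_1\ge\dots\ge\hat\lambda_n\ge0$ are the eigenvalues of $K_n$ (at most $M^2$ a.s.). $\mathbf P_\epsilon,\mathbf E_\epsilon$ denote probability and expectation conditional on $X_1,\dots,X_n$; statements about them hold almost surely, for designs satisfying the stated design conditions. Regularizer: $g:(0,M^2]\times[0,\infty)\to\mathbb R$, $g_t(\lambda)=g(\lambda,t)$,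 such that $(\lambda,t)\mapsto\lambda g_t(\lambda)$ is non-decreasing in $t$ and in $\lambda$, continuous in $t$, $g_0(\lambda)=0$, $\lim_{t\to\infty}\lambda g_t(\lambda)=1$, $0\le\lambda g_t(\lambda)\le1$, and $g_t(\lambda)\le Bt$ for a constant $B>0$. Conventions: functions of operators are defined by functional calculus with $g_t(0):=0$; $g_\infty(\lambda):=1/\lambda$ for $\lambda>0$; if $T=\infty$ the range $0\le t\le T$ includes $t=\infty$; $\infty\cdot0=0$; $\inf\emptyset=\infty$. Spectral filter estimator: $\hat f^{(t)}=g_t(\Sigma_n)S_n^*\mathbf Y\in\mathcal H$, and $\hat{\mathbf f}^{(t)}=S_n\hat f^{(t)}=K_ng_t(K_n)\mathbf Y$. $a\vee b$, $a\wedge b$ are maximum and minimum. *)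

theory Defs
  imports
    "HOL-Probability.Probability"
    "HOL-Computational_Algebra.Fundamental_Theorem_Algebra"
    "Jordan_Normal_Form.Char_Poly"
begin

text \<open>
  The dimension of the covariate space is an ordinary natural number: \<open>\<real>\<^sup>d\<close> is the set of
  sequences vanishing from index \<open>d\<close> on. The product topology and the Borel sets of
  \<open>nat \<Rightarrow> real\<close> restrict on it to the Euclidean ones.
\<close>

definition euclid :: "nat \<Rightarrow> (nat \<Rightarrow> real) set" where
  "euclid d = {x. \<forall>i\<ge>d. x i = 0}"


subsection \<open>Kernels and reproducing kernel Hilbert spaces\<close>

definition positive_kernel :: "'x set \<Rightarrow> ('x \<Rightarrow> 'x \<Rightarrow> real) \<Rightarrow> bool" where
  "positive_kernel X k \<longleftrightarrow>
     (\<forall>x\<in>X. \<forall>y\<in>X. k x y = k y x) \<and>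
     (\<forall>F c. finite F \<and> F \<subseteq> X \<longrightarrow> 0 \<le> (\<Sum>x\<in>F. \<Sum>y\<in>F. c x * c y * k x y))"

text \<open>
  A real function on \<open>X\<close> is represented by its extension by zero to the whole type, so that
  functions on \<open>X\<close> form a vector space under the pointwise operations.
\<close>

definition kernel_section :: "'x set \<Rightarrow> ('x \<Rightarrow> 'x \<Rightarrow> real) \<Rightarrow> 'x \<Rightarrow> ('x \<Rightarrow> real)" where
  "kernel_section X k x = (\<lambda>y. if y \<in> X then k x y else 0)"

definition ip_norm :: "(('x \<Rightarrow> real) \<Rightarrow> ('x \<Rightarrow> real) \<Rightarrow> real) \<Rightarrow> ('x \<Rightarrow> real) \<Rightarrow> real" where
  "ip_norm ip h = sqrt (ip h h)"

definition function_hilbert_space ::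
  "'x set \<Rightarrow> ('x \<Rightarrow> real) set \<Rightarrow> (('x \<Rightarrow> real) \<Rightarrow> ('x \<Rightarrow> real) \<Rightarrow> real) \<Rightarrow> bool" where
  "function_hilbert_space X H ip \<longleftrightarrow>
     (\<forall>h\<in>H. \<forall>x. x \<notin> X \<longrightarrow> h x = 0) \<and>
     (\<lambda>x. 0) \<in> H \<and>
     (\<forall>a b. \<forall>h\<in>H. \<forall>h'\<in>H. (\<lambda>x. a * h x + b * h' x) \<in> H) \<and>
     (\<forall>h\<in>H. \<forall>h'\<in>H. ip h h' = ip h' h) \<and>
     (\<forall>a b. \<forall>h\<in>H. \<forall>h'\<in>H. \<forall>l\<in>H.
        ip (\<lambda>x. a * h x + b * h' x) l = a * ip h l + b * ip h' l) \<and>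
     (\<forall>h\<in>H. 0 \<le> ip h h) \<and>
     (\<forall>h\<in>H. ip h h = 0 \<longrightarrow> h = (\<lambda>x. 0)) \<and>
     (\<forall>s :: nat \<Rightarrow> 'x \<Rightarrow> real.
        (\<forall>m. s m \<in> H) \<and>
        (\<forall>e>0. \<exists>N. \<forall>m\<ge>N. \<forall>m'\<ge>N. ip_norm ip (\<lambda>x. s m x - s m' x) < e) \<longrightarrow>
        (\<exists>h\<in>H. (\<lambda>m. ip_norm ip (\<lambda>x. s m x - h x)) \<longlonglongrightarrow> 0))"

definition is_rkhs ::
  "'x set \<Rightarrow> ('x \<Rightarrow> 'x \<Rightarrow> real) \<Rightarrow> ('x \<Rightarrow> real) set \<Rightarrow>
     (('x \<Rightarrow> real) \<Rightarrow> ('x \<Rightarrow> real) \<Rightarrow> real) \<Rightarrow> bool" where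
  "is_rkhs X k H ip \<longleftrightarrow>
     function_hilbert_space X H ip \<and>
     (\<forall>x\<in>X. kernel_section X k x \<in> H) \<and>
     (\<forall>x\<in>X. \<forall>h\<in>H. ip h (kernel_section X k x) = h x)"


subsection \<open>Functional calculus\<close>

definition eigenspace :: "('x \<Rightarrow> real) set \<Rightarrow> (('x \<Rightarrow> real) \<Rightarrow> ('x \<Rightarrow> real)) \<Rightarrow> real \<Rightarrow> ('x \<Rightarrow> real) set"
  where "eigenspace V A \<mu> = {v \<in> V. A v = (\<lambda>x. \<mu> * v x)}"

definition op_eigenvalues :: "('x \<Rightarrow> real) set \<Rightarrow> (('x \<Rightarrow> real) \<Rightarrow> ('x \<Rightarrow> real)) \<Rightarrow> real set" where
  "op_eigenvalues V A = {\<mu>. \<exists>v\<in>eigenspace V A \<mu>. v \<noteq> (\<lambda>x. 0)}"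

definition orth_proj ::
  "(('x \<Rightarrow> real) \<Rightarrow> ('x \<Rightarrow> real) \<Rightarrow> real) \<Rightarrow> ('x \<Rightarrow> real) set \<Rightarrow> ('x \<Rightarrow> real) \<Rightarrow> ('x \<Rightarrow> real)" where
  "orth_proj ip W v = (THE w. w \<in> W \<and> (\<forall>u\<in>W. ip (\<lambda>x. v x - w x) u = 0))"

text \<open>
  For a self-adjoint operator \<open>A\<close> of finite rank on a Hilbert space \<open>V\<close>, this is
  \<open>\<phi>(A) = \<Sum>\<^sub>\<mu> \<phi>(\<mu>) P\<^sub>\<mu>\<close> with \<open>P\<^sub>\<mu>\<close> the orthogonal projection onto the eigenspace of \<open>\<mu>\<close>;
  such an operator has only finitely many eigenvalues.
\<close>

definition fun_calc ::
  "('x \<Rightarrow> real) set \<Rightarrow> (('x \<Rightarrow> real) \<Rightarrow> ('x \<Rightarrow> real) \<Rightarrow> real) \<Rightarrow> (real \<Rightarrow> real) \<Rightarrow>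
     (('x \<Rightarrow> real) \<Rightarrow> ('x \<Rightarrow> real)) \<Rightarrow> ('x \<Rightarrow> real) \<Rightarrow> ('x \<Rightarrow> real)" where
  "fun_calc V ip \<phi> A v =
     (\<lambda>x. \<Sum>\<mu>\<in>op_eigenvalues V A. \<phi> \<mu> * orth_proj ip (eigenspace V A \<mu>) v x)"


subsection \<open>Empirical quantities\<close>

text \<open>
  A vector in \<open>\<real>\<^sup>n\<close> is a function \<open>nat \<Rightarrow> real\<close> of which only the values at indices
  below \<open>n\<close> matter; a design is a family of points \<open>x 0, \<dots>, x (n - 1)\<close>.
\<close>

definition emp_inner :: "nat \<Rightarrow> (nat \<Rightarrow> real) \<Rightarrow> (nat \<Rightarrow> real) \<Rightarrow> real" where
  "emp_inner n a b = (\<Sum>i<n. a i * b i) / real n"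

definition emp_norm :: "nat \<Rightarrow> (nat \<Rightarrow> real) \<Rightarrow> real" where
  "emp_norm n a = sqrt (emp_inner n a a)"

definition sampling_op :: "nat \<Rightarrow> (nat \<Rightarrow> 'x) \<Rightarrow> ('x \<Rightarrow> real) \<Rightarrow> (nat \<Rightarrow> real)" where
  "sampling_op n x h = (\<lambda>i\<in>{..<n}. h (x i))"

definition sampling_adj ::
  "('x \<Rightarrow> real) set \<Rightarrow> (('x \<Rightarrow> real) \<Rightarrow> ('x \<Rightarrow> real) \<Rightarrow> real) \<Rightarrow> nat \<Rightarrow> (nat \<Rightarrow> 'x) \<Rightarrow>
     (nat \<Rightarrow> real) \<Rightarrow> ('x \<Rightarrow> real)" where
  "sampling_adj H ip n x a =
     (THE h. h \<in> H \<and> (\<forall>h'\<in>H. ip h' h = emp_inner n (sampling_op n x h') a))"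

definition emp_cov_op ::
  "('x \<Rightarrow> real) set \<Rightarrow> (('x \<Rightarrow> real) \<Rightarrow> ('x \<Rightarrow> real) \<Rightarrow> real) \<Rightarrow> nat \<Rightarrow> (nat \<Rightarrow> 'x) \<Rightarrow>
     ('x \<Rightarrow> real) \<Rightarrow> ('x \<Rightarrow> real)" where
  "emp_cov_op H ip n x h = sampling_adj H ip n x (sampling_op n x h)"

definition kernel_matrix :: "('x \<Rightarrow> 'x \<Rightarrow> real) \<Rightarrow> nat \<Rightarrow> (nat \<Rightarrow> 'x) \<Rightarrow> real Matrix.mat" where
  "kernel_matrix k n x = Matrix.mat n n (\<lambda>(i, j). k (x i) (x j) / real n)"

text \<open>The \<open>j\<close>-th largest eigenvalue, for \<open>1 \<le> j \<le> n\<close>, counted with multiplicity.\<close>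

definition kernel_eigenvalue :: "('x \<Rightarrow> 'x \<Rightarrow> real) \<Rightarrow> nat \<Rightarrow> (nat \<Rightarrow> 'x) \<Rightarrow> nat \<Rightarrow> real" where
  "kernel_eigenvalue k n x j =
     rev (sorted_list_of_multiset (proots (char_poly (kernel_matrix k n x)))) ! (j - 1)"

text \<open>The disjunct \<open>j = 0\<close> comes first since there is no eigenvalue with index \<open>0\<close>.\<close>

definition eigenvalue_bound ::
  "('x \<Rightarrow> 'x \<Rightarrow> real) \<Rightarrow> nat \<Rightarrow> real \<Rightarrow> ennreal \<Rightarrow> (nat \<Rightarrow> 'x) \<Rightarrow> bool" where
  "eigenvalue_bound k n E T x \<longleftrightarrow>
     (\<forall>j<n. j = 0 \<or> 1 \<le> ennreal (kernel_eigenvalue k n x j) * T \<longrightarrow>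
        (\<Sum>i\<in>{j+1..n}. kernel_eigenvalue k n x i)
          \<le> E * real (max j 1) * kernel_eigenvalue k n x (j + 1))"


subsection \<open>Regularizers, spectral filter estimators, discrepancy principle\<close>

text \<open>The first argument of \<open>g\<close> is the spectral variable, the second one is the time.\<close>

definition regularizer :: "real \<Rightarrow> real \<Rightarrow> (real \<Rightarrow> real \<Rightarrow> real) \<Rightarrow> bool" where
  "regularizer M B g \<longleftrightarrow>
     0 < B \<and>
     (\<forall>\<mu>\<in>{0<..M\<^sup>2}.
        mono_on {0..} (\<lambda>t. \<mu> * g \<mu> t) \<and>
        continuous_on {0..} (\<lambda>t. \<mu> * g \<mu> t) \<and>
        g \<mu> 0 = 0 \<and>
        ((\<lambda>t. \<mu> * g \<mu> t) \<longlongrightarrow> 1) at_top) \<and>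
     (\<forall>t\<ge>0. mono_on {0<..M\<^sup>2} (\<lambda>\<mu>. \<mu> * g \<mu> t)) \<and>
     (\<forall>\<mu>\<in>{0<..M\<^sup>2}. \<forall>t\<ge>0. 0 \<le> \<mu> * g \<mu> t \<and> \<mu> * g \<mu> t \<le> 1 \<and> g \<mu> t \<le> B * t)"

definition filter_fun :: "(real \<Rightarrow> real \<Rightarrow> real) \<Rightarrow> ennreal \<Rightarrow> real \<Rightarrow> real" where
  "filter_fun g t \<mu> =
     (if \<mu> = 0 then 0 else if t = \<infinity> then 1 / \<mu> else g \<mu> (enn2real t))"

definition filter_estimator ::
  "('x \<Rightarrow> real) set \<Rightarrow> (('x \<Rightarrow> real) \<Rightarrow> ('x \<Rightarrow> real) \<Rightarrow> real) \<Rightarrow> (real \<Rightarrow> real \<Rightarrow> real) \<Rightarrow>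
     nat \<Rightarrow> (nat \<Rightarrow> 'x) \<Rightarrow> (nat \<Rightarrow> real) \<Rightarrow> ennreal \<Rightarrow> ('x \<Rightarrow> real)" where
  "filter_estimator H ip g n x y t =
     fun_calc H ip (filter_fun g t) (emp_cov_op H ip n x) (sampling_adj H ip n x y)"

definition fitted ::
  "('x \<Rightarrow> real) set \<Rightarrow> (('x \<Rightarrow> real) \<Rightarrow> ('x \<Rightarrow> real) \<Rightarrow> real) \<Rightarrow> (real \<Rightarrow> real \<Rightarrow> real) \<Rightarrow>
     nat \<Rightarrow> (nat \<Rightarrow> 'x) \<Rightarrow> (nat \<Rightarrow> real) \<Rightarrow> ennreal \<Rightarrow> (nat \<Rightarrow> real)" where
  "fitted H ip g n x y t = sampling_op n x (filter_estimator H ip g n x y t)"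

definition tau_DP ::
  "('x \<Rightarrow> real) set \<Rightarrow> (('x \<Rightarrow> real) \<Rightarrow> ('x \<Rightarrow> real) \<Rightarrow> real) \<Rightarrow> (real \<Rightarrow> real \<Rightarrow> real) \<Rightarrow>
     nat \<Rightarrow> real \<Rightarrow> ennreal \<Rightarrow> (nat \<Rightarrow> 'x) \<Rightarrow> (nat \<Rightarrow> real) \<Rightarrow> ennreal" where
  "tau_DP H ip g n \<sigma> T x y =
     min (Inf {ennreal t | t. 0 \<le> t \<and>
                 (emp_norm n (\<lambda>i. y i - fitted H ip g n x y (ennreal t) i))\<^sup>2 \<le> \<sigma>\<^sup>2})
         T"

definition sq_loss ::
  "('x \<Rightarrow> real) set \<Rightarrow> (('x \<Rightarrow> real) \<Rightarrow> ('x \<Rightarrow> real) \<Rightarrow> real) \<Rightarrow> (real \<Rightarrow> real \<Rightarrow> real) \<Rightarrow>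
     nat \<Rightarrow> ('x \<Rightarrow> real) \<Rightarrow> (nat \<Rightarrow> 'x) \<Rightarrow> (nat \<Rightarrow> real) \<Rightarrow> ennreal \<Rightarrow> real" where
  "sq_loss H ip g n f x y t = (emp_norm n (\<lambda>i. f (x i) - fitted H ip g n x y t i))\<^sup>2"


subsection \<open>The regression model\<close>

text \<open>
  The law \<open>\<rho>\<close> of \<open>(X, Y)\<close> lives on \<open>\<X> \<times> \<real>\<close>, where \<open>\<X>\<close> carries the trace of the Borel
  sets, so \<open>\<X>\<close> itself need not be Borel. On this space \<open>X\<close> is \<open>fst\<close> and \<open>Y\<close> is \<open>snd\<close>.
\<close>

definition noise :: "('x \<Rightarrow> real) \<Rightarrow> 'x \<times> real \<Rightarrow> real" where
  "noise f z = snd z - f (fst z)"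

definition cond_exp_X ::
  "'x::topological_space set \<Rightarrow> ('x \<times> real) measure \<Rightarrow> ('x \<times> real \<Rightarrow> real) \<Rightarrow> ('x \<times> real \<Rightarrow> real)"
  where
  "cond_exp_X \<X> \<rho> Z =
     real_cond_exp \<rho> (vimage_algebra (space \<rho>) fst (restrict_space borel \<X>)) Z"

definition regression_model ::
  "'x::topological_space set \<Rightarrow> ('x \<Rightarrow> real) \<Rightarrow> real \<Rightarrow> ('x \<times> real) measure \<Rightarrow> bool" where
  "regression_model \<X> f \<sigma> \<rho> \<longleftrightarrow>
     prob_space \<rho> \<and>
     sets \<rho> = sets (restrict_space borel \<X> \<Otimes>\<^sub>M borel) \<and>
     f \<in> borel_measurable (restrict_space borel \<X>) \<and>
     0 < \<sigma> \<and>
     integrable \<rho> (\<lambda>z. (noise f z)\<^sup>2) \<and>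
     (AE z in \<rho>. cond_exp_X \<X> \<rho> (noise f) z = 0) \<and>
     (AE z in \<rho>. cond_exp_X \<X> \<rho> (\<lambda>z. (noise f z)\<^sup>2) z = \<sigma>\<^sup>2)"

definition sub_Gaussian_noise ::
  "'x::topological_space set \<Rightarrow> ('x \<Rightarrow> real) \<Rightarrow> real \<Rightarrow> ('x \<times> real) measure \<Rightarrow> real \<Rightarrow> bool" where
  "sub_Gaussian_noise \<X> f \<sigma> \<rho> A \<longleftrightarrow>
     (\<forall>q\<ge>1.
        integrable \<rho> (\<lambda>z. \<bar>noise f z\<bar> powr q) \<and>
        (AE z in \<rho>. q powr (-1/2) * cond_exp_X \<X> \<rho> (\<lambda>z. \<bar>noise f z\<bar> powr q) z powr (1/q)
           \<le> A * \<sigma>))"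

text \<open>
  The \<open>n\<close> independent copies \<open>(X\<^sub>i, Y\<^sub>i)\<close> are the coordinates of the product space.
\<close>

definition sample_space :: "nat \<Rightarrow> ('x \<times> real) measure \<Rightarrow> (nat \<Rightarrow> 'x \<times> real) measure" where
  "sample_space n \<rho> = Pi\<^sub>M {..<n} (\<lambda>_. \<rho>)"

definition design :: "nat \<Rightarrow> (nat \<Rightarrow> 'x \<times> real) \<Rightarrow> (nat \<Rightarrow> 'x)" where
  "design n \<omega> = (\<lambda>i\<in>{..<n}. fst (\<omega> i))"

definition responses :: "nat \<Rightarrow> (nat \<Rightarrow> 'x \<times> real) \<Rightarrow> (nat \<Rightarrow> real)" where
  "responses n \<omega> = (\<lambda>i\<in>{..<n}. snd (\<omega> i))"

definition regular_cond_distr ::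
  "'a measure \<Rightarrow> 'b measure \<Rightarrow> ('a \<Rightarrow> 'b) \<Rightarrow> 'c measure \<Rightarrow> ('a \<Rightarrow> 'c) \<Rightarrow> ('b \<Rightarrow> 'c measure) \<Rightarrow> bool"
  where
  "regular_cond_distr P N X L Y \<kappa> \<longleftrightarrow>
     X \<in> P \<rightarrow>\<^sub>M N \<and> Y \<in> P \<rightarrow>\<^sub>M L \<and>
     \<kappa> \<in> N \<rightarrow>\<^sub>M prob_algebra L \<and>
     (\<forall>S\<in>sets L. AE \<omega> in P.
        measure (\<kappa> (X \<omega>)) S =
        real_cond_exp P (vimage_algebra (space P) X N) (indicator (Y -` S \<inter> space P)) \<omega>)"

text \<open>
  Given the design \<open>x\<close>, the vector \<open>(Y\<^sub>1, \<dots>, Y\<^sub>n)\<close> has law \<open>\<kappa> x\<close>; probabilities and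
  expectations conditional on the design are taken with respect to \<open>\<kappa> x\<close>. Such a \<open>\<kappa>\<close> exists,
  and is unique up to a null set of designs, because the responses take values in a standard
  Borel space. A fixed kernel is needed for the minimum over uncountably many \<open>t\<close>
  of conditional expectations to be well defined.
\<close>

definition responses_given_design ::
  "nat \<Rightarrow> 'x::topological_space set \<Rightarrow> ('x \<times> real) measure \<Rightarrow>
     ((nat \<Rightarrow> 'x) \<Rightarrow> (nat \<Rightarrow> real) measure) \<Rightarrow> bool" where
  "responses_given_design n \<X> \<rho> \<kappa> \<longleftrightarrow>
     regular_cond_distr (sample_space n \<rho>)
       (Pi\<^sub>M {..<n} (\<lambda>_. restrict_space borel \<X>)) (design n)
       (Pi\<^sub>M {..<n} (\<lambda>_. borel)) (responses n) \<kappa>"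

end

theory Submission
  imports Defs
begin

text \<open>
  In an orthonormal eigenbasis of \<open>K\<^sub>n\<close> the filter multiplies the \<open>j\<close>-th coefficient of \<open>Y\<close> by
  \<open>\<gamma>\<^sub>j(t) = \<lambda>\<^sub>j g\<^sub>t(\<lambda>\<^sub>j)\<close>. The squared residual has mean \<open>\<sigma>\<^sup>2 + bias(t) - gap(t)\<close>, where \<open>bias\<close> is the
  squared bias and \<open>gap(t) = (\<sigma>\<^sup>2/n) \<Sum> (2\<gamma>\<^sub>j - \<gamma>\<^sub>j\<^sup>2)\<close>, so the discrepancy principle stops where
  \<open>bias\<close> and \<open>gap\<close> balance. By the eigenvalue bound \<open>gap\<close> is at most a multiple of the variance
  \<open>var(t) = (\<sigma>\<^sup>2/n) \<Sum> \<gamma>\<^sub>j\<^sup>2\<close> plus \<open>O(\<sigma>\<^sup>2/n)\<close>, so this is as good as balancing \<open>bias\<close> and \<open>var\<close>.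
  There are deterministic times \<open>t\<^sub>2\<close> and \<open>t\<^sub>1\<close> at which \<open>bias\<close> and \<open>gap\<close> are comparable and
  between which \<open>\<tau>\<close> falls unless one of four deviation events for the residual occurs. Since
  the bias decreases and the stochastic error increases in time, the loss at \<open>\<tau>\<close> is controlled by
  the bias at \<open>t\<^sub>2\<close> and the stochastic error at \<open>t\<^sub>1\<close>; the latter costs a fifth event.
  The deviations are bounded by Chernoff's method: the exponential moments of a
  quadratic form follow from decoupling its off-diagonal part and linearising squares
  by Gaussian integration.
\<close>

text \<open>The stopping time depends on the noise, and a deviation bound uniform over all times
  would cost too much. Monotonicity in time replaces it: bounds at the two deterministic times
  suffice, so the exceptional set does not depend on the comparison time t, and the minimum over t
  can be taken at the end. The balance equations carry the factors 3/2 and 1/2 because of the part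
  of the residual that is linear in the noise. Its variance is at most \<sigma>^2 times the bias, so
  its deviations cost half of the bias plus a term of order \<sigma>^2 u. The quadratic part has up
  to n coefficients of order one and fluctuates by \<sigma>^2 (sqrt(n u) + u); divided by n this is
  the rate in the statement. All tail bounds rest on one property of the noise, E exp(\<beta>
  \<epsilon>^2) \<le> 2 with \<beta> = 1/(12 A^2 \<sigma>^2), extracted from the moment condition.
  The conditional law of the responses is specified only up to a null set for each single event. To
  obtain independence at almost every fixed design, events are restricted to a countable generator,
  which leaves countably many null sets.\<close>

section \<open>Spectral decomposition of the kernel matrix\<close>

text \<open>The projection onto the complement of \<open>v\<^sub>0, \<dots>, v\<^bsub>m-1\<^esub>\<close> has trace \<open>n - m > 0\<close>, hence a nonzero column.\<close>

lemma orthonormal_extend: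
  fixes v :: "nat \<Rightarrow> nat \<Rightarrow> real"
  assumes "m < n"
    and on: "\<And>j l. j < m \<Longrightarrow> l < m \<Longrightarrow> (\<Sum>i<n. v j i * v l i) = of_bool (j = l)"
  shows "\<exists>w. (\<exists>i<n. w i \<noteq> 0) \<and> (\<forall>i\<ge>n. w i = 0) \<and> (\<forall>j<m. (\<Sum>i<n. w i * v j i) = 0)"
proof -
  define P where "P p i = of_bool (i < n \<and> i = p) - (if i < n then \<Sum>j<m. v j p * v j i else 0)" for p i
  have "(\<Sum>p<n. P p p) = real n - (\<Sum>p<n. \<Sum>j<m. v j p * v j p)"
    by (simp add: P_def sum_subtractf)
  also have "(\<Sum>p<n. \<Sum>j<m. v j p * v j p) = (\<Sum>j<m. \<Sum>p<n. v j p * v j p)"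
    by (rule sum.swap)
  also have "\<dots> = real m" using on by simp
  finally have "(\<Sum>p<n. P p p) \<noteq> 0" using \<open>m < n\<close> by simp
  then obtain p where p: "p < n" "P p p \<noteq> 0" by (metis (mono_tags, lifting) lessThan_iff sum.neutral)
  have "(\<Sum>i<n. P p i * v l i) = 0" if "l < m" for l
  proof -
    have "(\<Sum>i<n. P p i * v l i) = (\<Sum>i<n. of_bool (i = p) * v l i) - (\<Sum>i<n. \<Sum>j<m. v j p * (v j i * v l i))"
      by (simp add: P_def sum_subtractf algebra_simps sum_distrib_left)
    also have "(\<Sum>i<n. \<Sum>j<m. v j p * (v j i * v l i)) = (\<Sum>j<m. v j p * (\<Sum>i<n. v j i * v l i))"
      by (subst sum.swap) (simp add: sum_distrib_left)
    also have "\<dots> = (\<Sum>j<m. if j = l then v j p else 0)" using on that by (intro sum.cong) auto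
    also have "\<dots> = v l p" using that by simp
    also have "(\<Sum>i<n. of_bool (i = p) * v l i) = v l p"
    proof -
      have "(\<Sum>i<n. of_bool (i = p) * v l i) = (\<Sum>i<n. if i = p then v l i else 0)" by (intro sum.cong) auto
      then show ?thesis using p by simp
    qed
    finally show ?thesis by simp
  qed
  then show ?thesis using p by (intro exI[of _ "P p"]) (auto simp: P_def)
qed

definition bilin :: "nat \<Rightarrow> (nat \<Rightarrow> nat \<Rightarrow> real) \<Rightarrow> (nat \<Rightarrow> real) \<Rightarrow> (nat \<Rightarrow> real) \<Rightarrow> real" where
  "bilin n K x y = (\<Sum>i<n. \<Sum>l<n. x i * K i l * y l)"

lemma bilin_add: "bilin n K (\<lambda>i. a * x i + c * y i) z = a * bilin n K x z + c * bilin n K y z"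
  by (simp add: bilin_def sum.distrib sum_distrib_left algebra_simps)

lemma bilin_add2: "bilin n K z (\<lambda>i. a * x i + c * y i) = a * bilin n K z x + c * bilin n K z y"
  by (simp add: bilin_def sum.distrib sum_distrib_left algebra_simps)

lemma bilin_sym:
  assumes "\<And>i l. i < n \<Longrightarrow> l < n \<Longrightarrow> K i l = K l i"
  shows "bilin n K x y = bilin n K y x"
proof -
  have "bilin n K x y = (\<Sum>l<n. \<Sum>i<n. x i * K i l * y l)" unfolding bilin_def by (rule sum.swap)
  also have "\<dots> = bilin n K y x" unfolding bilin_def using assms
    by (intro sum.cong refl) (auto simp: algebra_simps)
  finally show ?thesis .
qed

text \<open>First-order condition at a maximum, without derivatives: for \<open>t\<close>
  proportional to \<open>a\<close>, the linear term is itself of order t^2, with the coefficient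
  2(|c| + 1), which outweighs \<open>c\<close>.\<close>

lemma quadratic_nonpos_linear_zero:
  fixes a c :: real
  assumes "\<And>t. 2 * t * a + t\<^sup>2 * c \<le> 0"
  shows "a = 0"
proof (rule ccontr)
  assume "a \<noteq> 0"
  define t where "t = a / (\<bar>c\<bar> + 1)"
  have *: "t * (\<bar>c\<bar> + 1) = a" by (simp add: t_def)
  have "t \<noteq> 0" using \<open>a \<noteq> 0\<close> by (simp add: t_def)
  have "2 * t * a + t\<^sup>2 * c = t\<^sup>2 * (2 * (\<bar>c\<bar> + 1) + c)"
    by (subst *[symmetric]) (simp add: power2_eq_square algebra_simps)
  also have "\<dots> > 0" using \<open>t \<noteq> 0\<close> by (intro mult_pos_pos) auto
  finally show False using assms[of t] by simp
qed

text \<open>The new eigenvector maximises the Rayleigh quotient on the orthogonal complement.\<close>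

lemma eigenvector_extend:
  fixes v :: "nat \<Rightarrow> nat \<Rightarrow> real"
  assumes "m < n"
    and K: "\<And>i l. i < n \<Longrightarrow> l < n \<Longrightarrow> K i l = K l i"
    and on: "\<And>j l. j < m \<Longrightarrow> l < m \<Longrightarrow> (\<Sum>i<n. v j i * v l i) = of_bool (j = l)"
    and ev: "\<And>j i. j < m \<Longrightarrow> i < n \<Longrightarrow> (\<Sum>l<n. K i l * v j l) = lam j * v j i"
  shows "\<exists>w mu. (\<Sum>i<n. w i * w i) = 1 \<and> (\<forall>j<m. (\<Sum>i<n. w i * v j i) = 0) \<and>
      (\<forall>i<n. (\<Sum>l<n. K i l * w l) = mu * w i)"
proof -
  \<comment> \<open>Forcing the coordinates from \<open>n\<close> on to be 0 makes \<open>U\<close>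
    a faithful copy of the orthogonal complement inside
    \<open>nat \<Rightarrow> real\<close>.\<close>
  define U where "U = {x :: nat \<Rightarrow> real. (\<forall>i\<ge>n. x i = 0) \<and> (\<forall>j<m. (\<Sum>i<n. x i * v j i) = 0)}"
  define S where "S = U \<inter> {x. (\<Sum>i<n. x i * x i) = 1}"
  have U_lin: "(\<lambda>i. a * x i + c * y i) \<in> U" if "x \<in> U" "y \<in> U" for a c x y
    using that by (auto simp: U_def algebra_simps sum.distrib simp flip: sum_distrib_left)
  have norm_pos: "0 \<le> (\<Sum>i<n. x i * x i)" for x :: "nat \<Rightarrow> real"
    by (intro sum_nonneg) auto
  have normalize: "\<exists>c. c > 0 \<and> (\<lambda>i. x i / c) \<in> S \<and> c\<^sup>2 = (\<Sum>i<n. x i * x i)"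
    if "x \<in> U" "(\<Sum>i<n. x i * x i) > 0" for x
  proof -
    define c where "c = sqrt (\<Sum>i<n. x i * x i)"
    have c: "c > 0" "c\<^sup>2 = (\<Sum>i<n. x i * x i)" using that by (auto simp: c_def)
    have "(\<lambda>i. x i / c) \<in> U" using U_lin[OF that(1) that(1), of "1/c" 0] by simp
    moreover have "(\<Sum>i<n. x i / c * (x i / c)) = 1"
      using c that(2) by (simp add: power2_eq_square flip: sum_divide_distrib)
    ultimately show ?thesis using c by (auto simp: S_def)
  qed
  obtain w0 where w0: "\<exists>i<n. w0 i \<noteq> 0" "w0 \<in> U"
    using orthonormal_extend[OF \<open>m < n\<close> on] by (auto simp: U_def)
  then have "(\<Sum>i<n. w0 i * w0 i) > 0" by (auto intro!: sum_pos2 simp: zero_less_mult_iff linorder_neq_iff)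
  then have "S \<noteq> {}" using normalize[OF w0(2)] by auto
  \<comment> \<open>Compactness of the unit sphere comes from Tychonoff: a unit vector has
    coordinates in [-1, 1], and in the product topology all the functions involved are continuous
    because coordinates are.\<close>
  have box: "compact (PiE UNIV (\<lambda>i::nat. if i < n then {-1..1::real} else {0}))"
  proof -
    have "compact (if i < n then {-1..1::real} else {0})" for i by simp
    then have "compactin (powertop_real UNIV) (PiE UNIV (\<lambda>i::nat. if i < n then {-1..1::real} else {0}))"
      by (simp add: compactin_PiE)
    then show ?thesis by (simp add: euclidean_product_topology)
  qed
  have sub: "S \<subseteq> PiE UNIV (\<lambda>i::nat. if i < n then {-1..1::real} else {0})"
  proof
    fix x assume "x \<in> S"
    have "\<bar>x i\<bar> \<le> 1" if "i < n" for i
    proof -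
      have "x i * x i \<le> (\<Sum>i<n. x i * x i)" using that by (intro member_le_sum) auto
      then have "(x i)\<^sup>2 \<le> 1" using \<open>x \<in> S\<close> by (simp add: S_def power2_eq_square)
      then show ?thesis by (simp add: abs_square_le_1)
    qed
    then show "x \<in> PiE UNIV (\<lambda>i::nat. if i < n then {-1..1::real} else {0})"
      using \<open>x \<in> S\<close> by (auto simp: S_def U_def abs_le_iff)
  qed
  have cont: "continuous_on UNIV (\<lambda>x :: nat \<Rightarrow> real. x i)" for i
    by (rule continuous_on_product_coordinates)
  have "closed S"
  proof -
    have "S = (\<Inter>i\<in>{n..}. {x. x i = 0}) \<inter> (\<Inter>j\<in>{..<m}. {x. (\<Sum>i<n. x i * v j i) = 0}) \<inter> {x. (\<Sum>i<n. x i * x i) = 1}"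
      by (auto simp: S_def U_def)
    also have "closed \<dots>"
      by (intro closed_Int closed_INT ballI closed_Collect_eq continuous_intros cont)
    finally show ?thesis .
  qed
  then have comp: "compact S"
    using closed_Int_compact[OF _ box, of S] sub by (simp only: Int_absorb2)
  have "continuous_on S (\<lambda>x. bilin n K x x)"
    unfolding bilin_def by (intro continuous_intros continuous_on_subset[OF cont]) auto
  from continuous_attains_sup[OF comp \<open>S \<noteq> {}\<close> this]
  obtain w where w: "w \<in> S" "\<And>x. x \<in> S \<Longrightarrow> bilin n K x x \<le> bilin n K w w"
    by blast
  define mu where "mu = bilin n K w w"
  \<comment> \<open>Homogeneity extends maximality of \<open>w\<close> from the unit sphere to all
    of \<open>U\<close>.\<close>
  have le: "bilin n K x x \<le> mu * (\<Sum>i<n. x i * x i)" if xU: "x \<in> U" for x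
  proof (cases "(\<Sum>i<n. x i * x i) > 0")
    case True
    then obtain c where c: "c > 0" "(\<lambda>i. x i / c) \<in> S" "c\<^sup>2 = (\<Sum>i<n. x i * x i)"
      using normalize[OF xU True] by blast
    have "bilin n K (\<lambda>i. x i / c) (\<lambda>i. x i / c) = bilin n K x x / c\<^sup>2"
      by (simp add: bilin_def power2_eq_square sum_divide_distrib)
    with w(2)[OF c(2)] c True show ?thesis by (simp add: mu_def pos_divide_le_eq)
  next
    case False
    then have "(\<Sum>i<n. x i * x i) = 0" using norm_pos[of x] by linarith
    then have "\<forall>i<n. x i = 0" by (subst (asm) sum_nonneg_eq_0_iff) auto
    then show ?thesis by (simp add: bilin_def)
  qed
  have wU: "w \<in> U" and w1: "(\<Sum>i<n. w i * w i) = 1" using w by (auto simp: S_def)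
  \<comment> \<open>Moving from \<open>w\<close> in direction \<open>x\<close> cannot increase the
    quadratic form minus \<open>mu\<close> times the squared norm, which is 0 at \<open>w\<close>;
    hence the linear coefficient vanishes.\<close>
  have crit: "bilin n K w x = mu * (\<Sum>i<n. w i * x i)" if "x \<in> U" for x
  proof -
    have "bilin n K w x - mu * (\<Sum>i<n. w i * x i) = 0"
    proof (rule quadratic_nonpos_linear_zero)
      fix t :: real
      have "bilin n K (\<lambda>i. 1 * w i + t * x i) (\<lambda>i. 1 * w i + t * x i)
          = mu + 2 * t * bilin n K w x + t\<^sup>2 * bilin n K x x"
        unfolding bilin_add bilin_add2 using bilin_sym[OF K, where x=x and y=w]
        by (simp add: mu_def power2_eq_square algebra_simps)
      moreover have "(\<Sum>i<n. (1 * w i + t * x i) * (1 * w i + t * x i))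
          = 1 + 2 * t * (\<Sum>i<n. w i * x i) + t\<^sup>2 * (\<Sum>i<n. x i * x i)"
        using w1 by (simp add: algebra_simps power2_eq_square sum.distrib sum_distrib_left)
      ultimately show "2 * t * (bilin n K w x - mu * (\<Sum>i<n. w i * x i)) +
          t\<^sup>2 * (bilin n K x x - mu * (\<Sum>i<n. x i * x i)) \<le> 0"
        using le[OF U_lin[OF wU that, of 1 t]] by (simp add: algebra_simps)
    qed
    then show ?thesis by simp
  qed
  \<comment> \<open>The residual K w - mu w is orthogonal to all of \<open>U\<close> by
    \<open>crit\<close>, and lies in \<open>U\<close> itself because symmetry moves \<open>K\<close>
    onto the earlier eigenvectors. So it is orthogonal to itself.\<close>
  define r where "r i = (if i < n then (\<Sum>l<n. K i l * w l) - mu * w i else 0)" for i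
  have bil_w: "bilin n K w x = (\<Sum>i<n. (\<Sum>l<n. K i l * w l) * x i)" for x
  proof -
    have "bilin n K w x = bilin n K x w" using K by (rule bilin_sym)
    then show ?thesis by (simp add: bilin_def sum_distrib_left mult_ac)
  qed
  have r_ip: "(\<Sum>i<n. r i * x i) = bilin n K w x - mu * (\<Sum>i<n. w i * x i)" for x
    by (simp add: r_def bil_w left_diff_distrib sum_subtractf sum_distrib_left mult.assoc)
  have "r \<in> U"
  proof -
    have "(\<Sum>i<n. r i * v j i) = 0" if "j < m" for j
    proof -
      have "bilin n K w (v j) = (\<Sum>i<n. w i * (\<Sum>l<n. K i l * v j l))"
        by (simp add: bilin_def sum_distrib_left algebra_simps)
      also have "\<dots> = lam j * (\<Sum>i<n. w i * v j i)"
        using ev[OF that] by (simp add: sum_distrib_left algebra_simps)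
      also have "\<dots> = 0" using wU that by (simp add: U_def)
      finally show ?thesis using r_ip[of "v j"] wU that by (simp add: U_def)
    qed
    then show ?thesis by (auto simp: U_def r_def)
  qed
  then have "(\<Sum>i<n. r i * r i) = 0" using r_ip[of r] crit[of r] by simp
  then have "\<forall>i<n. r i = 0" by (subst (asm) sum_nonneg_eq_0_iff) auto
  then have "\<forall>i<n. (\<Sum>l<n. K i l * w l) = mu * w i" by (auto simp: r_def)
  then show ?thesis using wU w1 by (auto simp: U_def)
qed

lemma orthonormal_eigenbasis:
  fixes n :: nat
  assumes K: "\<And>i l. i < n \<Longrightarrow> l < n \<Longrightarrow> K i l = (K l i :: real)"
  shows "\<exists>v lam. (\<forall>j<n. \<forall>l<n. (\<Sum>i<n. v j i * v l i) = of_bool (j = l)) \<and>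
     (\<forall>j<n. \<forall>i<n. (\<Sum>l<n. K i l * v j l) = lam j * v j i)"
proof -
  have "m \<le> n \<Longrightarrow> \<exists>v lam. (\<forall>j<m. \<forall>l<m. (\<Sum>i<n. v j i * v l i) = of_bool (j = l)) \<and>
     (\<forall>j<m. \<forall>i<n. (\<Sum>l<n. K i l * v j l) = lam j * v j i)" for m
  proof (induction m)
    case 0
    then show ?case by simp
  next
    case (Suc m)
    then obtain v lam where v: "\<forall>j<m. \<forall>l<m. (\<Sum>i<n. v j i * v l i) = of_bool (j = l)"
      "\<forall>j<m. \<forall>i<n. (\<Sum>l<n. K i l * v j l) = lam j * v j i" by auto
    obtain w mu where w: "(\<Sum>i<n. w i * w i) = 1" "\<forall>j<m. (\<Sum>i<n. w i * v j i) = 0"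
      "\<forall>i<n. (\<Sum>l<n. K i l * w l) = mu * w i"
      using eigenvector_extend[of m n K v lam] Suc.prems K v by auto
    have "\<forall>j<m. (\<Sum>i<n. v j i * w i) = 0" using w(2) by (simp add: mult.commute)
    then show ?case
      using v w by (intro exI[of _ "v(m := w)"] exI[of _ "lam(m := mu)"]) (auto simp: less_Suc_eq)
  qed
  then show ?thesis by blast
qed

lemma proots_prod_list_linear:
  "proots (\<Prod>a\<leftarrow>as. [:- a, 1:] :: real poly) = mset as"
proof (induction as)
  case (Cons a as)
  have "(\<Prod>a\<leftarrow>as. [:- a, 1:] :: real poly) \<noteq> 0" by (auto simp: prod_list_zero_iff)
  then show ?case using Cons by (simp add: proots_mult del: mult_pCons_left)
qed simp

text \<open>A one-sided inverse of a square matrix is two-sided, so orthonormality in one index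
  carries over to the other.\<close>

lemma orthonormal_complete:
  fixes v :: "nat \<Rightarrow> nat \<Rightarrow> real"
  assumes on: "\<forall>j<n. \<forall>l<n. (\<Sum>i<n. v j i * v l i) = of_bool (j = l)"
    and "i < n" "l < n"
  shows "(\<Sum>j<n. v j i * v j l) = of_bool (i = l)"
proof -
  define V where "V = mat n n (\<lambda>(i, j). v j i)"
  have V: "V \<in> carrier_mat n n" "transpose_mat V \<in> carrier_mat n n" by (auto simp: V_def)
  have "transpose_mat V * V = 1\<^sub>m n"
    using on by (intro eq_matI) (auto simp: V_def scalar_prod_def atLeast0LessThan)
  then have "V * transpose_mat V = 1\<^sub>m n" using V mat_mult_left_right_inverse by blast
  then have "(V * transpose_mat V) $$ (i, l) = (1\<^sub>m n :: real mat) $$ (i, l)" by simp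
  then show ?thesis using assms(2,3) by (auto simp: V_def scalar_prod_def atLeast0LessThan)
qed

text \<open>Parseval's identity for the vector with coefficients \<open>z\<close>.\<close>

lemma orthonormal_sum_squares:
  fixes u :: "nat \<Rightarrow> nat \<Rightarrow> real"
  assumes on: "\<forall>j<n. \<forall>l<n. (\<Sum>i<n. u j i * u l i) = of_bool (j = l)"
  shows "(\<Sum>i<n. (\<Sum>j<n. z j * u j i)\<^sup>2) = (\<Sum>j<n. (z j)\<^sup>2)"
proof -
  have "(\<Sum>i<n. (\<Sum>j<n. z j * u j i)\<^sup>2) = (\<Sum>i<n. \<Sum>j<n. \<Sum>l<n. z j * z l * (u j i * u l i))"
    by (simp add: power2_eq_square sum_product mult_ac)
  also have "\<dots> = (\<Sum>j<n. \<Sum>i<n. \<Sum>l<n. z j * z l * (u j i * u l i))" by (rule sum.swap)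
  also have "\<dots> = (\<Sum>j<n. \<Sum>l<n. \<Sum>i<n. z j * z l * (u j i * u l i))"
    by (rule sum.cong[OF refl], rule sum.swap)
  also have "\<dots> = (\<Sum>j<n. \<Sum>l<n. if j = l then z j * z l else 0)"
    using on by (intro sum.cong refl) (simp flip: sum_distrib_left)
  also have "\<dots> = (\<Sum>j<n. (z j)\<^sup>2)" by (simp add: power2_eq_square)
  finally show ?thesis .
qed

text \<open>Conjugation by the basis gives a diagonal matrix, and similar matrices share the
  characteristic polynomial. This ties the eigenbasis to \<open>kernel_eigenvalue\<close>, which is
  defined through roots with multiplicity.\<close>

lemma char_poly_orthonormal_eigenbasis:
  fixes K :: "nat \<Rightarrow> nat \<Rightarrow> real"
  assumes on: "\<forall>j<n. \<forall>l<n. (\<Sum>i<n. v j i * v l i) = of_bool (j = l)"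
    and ev: "\<forall>j<n. \<forall>i<n. (\<Sum>l<n. K i l * v j l) = lam j * v j i"
  shows "char_poly (mat n n (\<lambda>(i, j). K i j)) = (\<Prod>a\<leftarrow>map lam [0..<n]. [:- a, 1:])"
proof -
  define A where "A = mat n n (\<lambda>(i, j). K i j)"
  define V where "V = mat n n (\<lambda>(i, j). v j i)"
  define L where "L = mat n n (\<lambda>(i, j). if i = j then lam i else 0)"
  have car: "A \<in> carrier_mat n n" "V \<in> carrier_mat n n" "transpose_mat V \<in> carrier_mat n n"
    "L \<in> carrier_mat n n" by (auto simp: A_def V_def L_def)
  have VtV: "transpose_mat V * V = 1\<^sub>m n"
    using on by (intro eq_matI) (auto simp: V_def scalar_prod_def atLeast0LessThan)
  then have VVt: "V * transpose_mat V = 1\<^sub>m n" using car mat_mult_left_right_inverse by blast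
  have "A * V = V * L"
  proof (intro eq_matI)
    fix i j assume "i < dim_row (V * L)" "j < dim_col (V * L)"
    then have ij: "i < n" "j < n" by (auto simp: V_def L_def)
    have "(\<Sum>l<n. v l i * (if l = j then lam l else 0)) = v j i * lam j"
      using ij by (simp add: if_distrib[where f="\<lambda>x. _ * x"] cong: if_cong)
    then show "(A * V) $$ (i, j) = (V * L) $$ (i, j)"
      using ij ev by (simp add: A_def V_def L_def scalar_prod_def atLeast0LessThan)
  qed (auto simp: A_def V_def L_def)
  then have "A * V * transpose_mat V = V * L * transpose_mat V" by simp
  moreover have "A * V * transpose_mat V = A" using VVt car by (simp add: assoc_mult_mat[of A n n V n _ n])
  ultimately have "A = V * L * transpose_mat V" by simp
  then have "similar_mat_wit A L V (transpose_mat V)"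
    by (intro similar_mat_witI[OF VVt VtV _ car(1,4,2,3)])
  then have "similar_mat A L" by (auto simp: similar_mat_def)
  then have "char_poly A = char_poly L" by (rule char_poly_similar)
  also have "\<dots> = (\<Prod>a\<leftarrow>diag_mat L. [:- a, 1:])"
    using car by (intro char_poly_upper_triangular) (auto simp: L_def)
  also have "diag_mat L = map lam [0..<n]" by (auto simp: diag_mat_def L_def)
  finally show ?thesis by (simp add: A_def)
qed

text \<open>Eigenvalues are numbered from 1 in decreasing order, basis vectors from 0; hence
  \<open>Suc j\<close> and the reordering of the basis.\<close>

lemma kernel_matrix_eigenbasis:
  assumes sym: "\<And>i l. i < n \<Longrightarrow> l < n \<Longrightarrow> k (x i) (x l) = k (x l) (x i)"
  obtains v lam where
    "\<forall>j<n. \<forall>l<n. (\<Sum>i<n. v j i * v l i) = of_bool (j = l)"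
    "\<forall>j<n. \<forall>i<n. (\<Sum>l<n. k (x i) (x l) / real n * v j l) = lam j * v j i"
    "\<forall>j<n. kernel_eigenvalue k n x (Suc j) = lam j"
    "\<forall>i j. i \<le> j \<longrightarrow> j < n \<longrightarrow> lam j \<le> lam i"
proof -
  let ?K = "\<lambda>i l. k (x i) (x l) / real n"
  obtain v lam where v: "\<forall>j<n. \<forall>l<n. (\<Sum>i<n. v j i * v l i) = of_bool (j = l)"
    "\<forall>j<n. \<forall>i<n. (\<Sum>l<n. ?K i l * v j l) = lam j * v j i"
    using orthonormal_eigenbasis[of n ?K] sym by auto
  \<comment> \<open>The sorted list and the list in basis order are the same multiset, so a
    permutation links them; re-indexing the basis by it sorts the eigenvalues.\<close>
  define ls where "ls = rev (sorted_list_of_multiset (mset (map lam [0..<n])))"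
  have mls: "mset ls = mset (map lam [0..<n])" by (simp add: ls_def)
  then obtain p where p: "p permutes {..<length (map lam [0..<n])}" "permute_list p (map lam [0..<n]) = ls"
    by (metis mset_eq_permutation)
  have len: "length ls = n" using mset_eq_length[OF mls] by simp
  have pn: "p j < n" if "j < n" for j using permutes_in_image[OF p(1), of j] that by simp
  have pinj: "p j = p l \<longleftrightarrow> j = l" for j l using permutes_inj[OF p(1)] by (auto simp: inj_eq)
  have nth: "ls ! j = lam (p j)" if "j < n" for j
    using that pn p by (simp add: permute_list_nth flip: p(2))
  have ke: "kernel_eigenvalue k n x (Suc j) = ls ! j" for j
    unfolding kernel_eigenvalue_def kernel_matrix_def
    by (subst char_poly_orthonormal_eigenbasis[OF v]) (simp only: proots_prod_list_linear ls_def diff_Suc_1)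
  have "sorted_wrt (\<ge>) ls" by (simp add: ls_def sorted_wrt_rev)
  then have sorted: "i \<le> j \<longrightarrow> j < n \<longrightarrow> ls ! j \<le> ls ! i" for i j
    using len by (metis le_less order_refl sorted_wrt_nth_less)
  show ?thesis
    using v pn pinj nth ke sorted
    by (intro that[of "\<lambda>j. v (p j)" "\<lambda>j. lam (p j)"]) (auto simp flip: nth)
qed

section \<open>The spectral filter estimator in an eigenbasis\<close>

lemma sum_filter_split:
  fixes F :: "'i \<Rightarrow> real"
  assumes "finite A"
  shows "sum F A = sum F {j\<in>A. P j} + sum F {j\<in>A. \<not> P j}"
proof -
  have "A = {j\<in>A. P j} \<union> {j\<in>A. \<not> P j}" by blast
  then show ?thesis using assms sum.union_disjoint[of "{j\<in>A. P j}" "{j\<in>A. \<not> P j}" F] by fastforce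
qed

text \<open>One fixed design with an eigenbasis of its kernel matrix. Membership and the kernel
  bound are imposed at the design points only, where they hold almost surely.\<close>

locale sampled_rkhs =
  fixes X :: "'x set" and k H ip and n :: nat and x :: "nat \<Rightarrow> 'x" and M :: real
    and v :: "nat \<Rightarrow> nat \<Rightarrow> real" and lam :: "nat \<Rightarrow> real"
  assumes rkhs: "is_rkhs X k H ip"
    and n_pos: "1 \<le> n"
    and x_in: "\<And>i. i < n \<Longrightarrow> x i \<in> X"
    and k_bound: "\<And>i. i < n \<Longrightarrow> ip_norm ip (kernel_section X k (x i)) \<le> M"
    and M_pos: "0 < M"
    and on: "\<forall>j<n. \<forall>l<n. (\<Sum>i<n. v j i * v l i) = of_bool (j = l)"
    and complete: "\<forall>i<n. \<forall>l<n. (\<Sum>j<n. v j i * v j l) = of_bool (i = l)"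
    and ev: "\<forall>j<n. \<forall>i<n. (\<Sum>l<n. k (x i) (x l) / real n * v j l) = lam j * v j i"
begin

lemma H_zero: "(\<lambda>x. 0) \<in> H"
  and H_lin: "h \<in> H \<Longrightarrow> h' \<in> H \<Longrightarrow> (\<lambda>x. a * h x + b * h' x) \<in> H"
  and ip_sym: "h \<in> H \<Longrightarrow> h' \<in> H \<Longrightarrow> ip h h' = ip h' h"
  and ip_lin: "h \<in> H \<Longrightarrow> h' \<in> H \<Longrightarrow> l \<in> H \<Longrightarrow> ip (\<lambda>x. a * h x + b * h' x) l = a * ip h l + b * ip h' l"
  and ip_nonneg: "h \<in> H \<Longrightarrow> 0 \<le> ip h h"
  and ip_definite: "h \<in> H \<Longrightarrow> ip h h = 0 \<Longrightarrow> h = (\<lambda>x. 0)"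
  and section_in: "i < n \<Longrightarrow> kernel_section X k (x i) \<in> H"
  and reproducing: "i < n \<Longrightarrow> h \<in> H \<Longrightarrow> ip h (kernel_section X k (x i)) = h (x i)"
proof -
  note hs = rkhs[unfolded is_rkhs_def function_hilbert_space_def]
  show "(\<lambda>x. 0) \<in> H" using conjunct1[OF conjunct2[OF conjunct1[OF hs]]] .
  show "h \<in> H \<Longrightarrow> h' \<in> H \<Longrightarrow> (\<lambda>x. a * h x + b * h' x) \<in> H"
    using conjunct1[OF conjunct2[OF conjunct2[OF conjunct1[OF hs]]]] by fast
  show "h \<in> H \<Longrightarrow> h' \<in> H \<Longrightarrow> ip h h' = ip h' h"
    using conjunct1[OF conjunct2[OF conjunct2[OF conjunct2[OF conjunct1[OF hs]]]]] by fast
  show "h \<in> H \<Longrightarrow> h' \<in> H \<Longrightarrow> l \<in> H \<Longrightarrow> ip (\<lambda>x. a * h x + b * h' x) l = a * ip h l + b * ip h' l"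
    using conjunct1[OF conjunct2[OF conjunct2[OF conjunct2[OF conjunct2[OF conjunct1[OF hs]]]]]] by fast
  show "h \<in> H \<Longrightarrow> 0 \<le> ip h h"
    using conjunct1[OF conjunct2[OF conjunct2[OF conjunct2[OF conjunct2[OF conjunct2[OF conjunct1[OF hs]]]]]]] by fast
  show "h \<in> H \<Longrightarrow> ip h h = 0 \<Longrightarrow> h = (\<lambda>x. 0)"
    using conjunct1[OF conjunct2[OF conjunct2[OF conjunct2[OF conjunct2[OF conjunct2[OF conjunct2[OF conjunct1[OF hs]]]]]]]] by fast
  show "i < n \<Longrightarrow> kernel_section X k (x i) \<in> H"
    using conjunct1[OF conjunct2[OF hs]] x_in by fast
  show "i < n \<Longrightarrow> h \<in> H \<Longrightarrow> ip h (kernel_section X k (x i)) = h (x i)"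
    using conjunct2[OF conjunct2[OF hs]] x_in by fast
qed

lemma H_scale: "h \<in> H \<Longrightarrow> (\<lambda>x. a * h x) \<in> H"
  using H_lin[of h "\<lambda>x. 0" a 0] H_zero by simp

lemma H_diff: "h \<in> H \<Longrightarrow> h' \<in> H \<Longrightarrow> (\<lambda>x. h x - h' x) \<in> H"
  using H_lin[of h h' 1 "-1"] by simp

lemma H_sum: "finite F \<Longrightarrow> (\<And>j. j \<in> F \<Longrightarrow> h j \<in> H) \<Longrightarrow> (\<lambda>x. \<Sum>j\<in>F. a j * h j x) \<in> H"
proof (induction F rule: finite_induct)
  case (insert j F)
  then show ?case using H_lin[of "h j" "\<lambda>x. \<Sum>j\<in>F. a j * h j x" "a j" 1] by simp
qed (simp add: H_zero)

lemma ip_zero: "l \<in> H \<Longrightarrow> ip (\<lambda>x. 0) l = 0"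
  using ip_lin[OF H_zero H_zero, of l 0 0] by simp

lemma ip_scale: "h \<in> H \<Longrightarrow> l \<in> H \<Longrightarrow> ip (\<lambda>x. a * h x) l = a * ip h l"
  using ip_lin[of h "\<lambda>x. 0" l a 0] H_zero by simp

lemma ip_diff: "h \<in> H \<Longrightarrow> h' \<in> H \<Longrightarrow> l \<in> H \<Longrightarrow> ip (\<lambda>x. h x - h' x) l = ip h l - ip h' l"
  using ip_lin[of h h' l 1 "-1"] by simp

lemma ip_sum:
  "finite F \<Longrightarrow> (\<And>j. j \<in> F \<Longrightarrow> h j \<in> H) \<Longrightarrow> l \<in> H \<Longrightarrow>
    ip (\<lambda>x. \<Sum>j\<in>F. a j * h j x) l = (\<Sum>j\<in>F. a j * ip (h j) l)"
proof (induction F rule: finite_induct)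
  case (insert j F)
  then show ?case
    using ip_lin[of "h j" "\<lambda>x. \<Sum>j\<in>F. a j * h j x" l "a j" 1] H_sum[of F h a] by simp
qed (simp add: ip_zero)

lemma ip_eqI:
  assumes "h \<in> H" "h' \<in> H" "\<And>l. l \<in> H \<Longrightarrow> ip l h = ip l h'"
  shows "h = h'"
proof -
  have "ip (\<lambda>x. h x - h' x) (\<lambda>x. h x - h' x) = 0"
    using assms ip_diff[OF assms(1,2)] H_diff[OF assms(1,2)] ip_sym by simp
  then have "(\<lambda>x. h x - h' x) = (\<lambda>x. 0)" using ip_definite H_diff assms by blast
  then show ?thesis by (auto simp: fun_eq_iff)
qed

section \<open>The adjoint of sampling and the eigenvectors of the covariance operator\<close>

text \<open>Explicit form of \<open>sampling_adj\<close>, which is defined by its adjoint property: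
  by the reproducing property, a combination of kernel sections represents the matching combination
  of point evaluations.\<close>

definition adj :: "(nat \<Rightarrow> real) \<Rightarrow> 'x \<Rightarrow> real" where
  "adj a = (\<lambda>z. \<Sum>i<n. (a i / real n) * kernel_section X k (x i) z)"

lemma adj_in: "adj a \<in> H"
  unfolding adj_def by (rule H_sum) (auto simp: section_in)

lemma ip_adj: "h \<in> H \<Longrightarrow> ip h (adj a) = (\<Sum>i<n. a i * h (x i)) / real n"
proof -
  assume h: "h \<in> H"
  have "ip h (adj a) = ip (adj a) h" using h adj_in ip_sym by blast
  also have "\<dots> = (\<Sum>i<n. (a i / real n) * ip (kernel_section X k (x i)) h)"
    unfolding adj_def using h by (intro ip_sum) (auto simp: section_in)
  also have "\<dots> = (\<Sum>i<n. (a i / real n) * h (x i))"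
    using h section_in reproducing ip_sym by (intro sum.cong) auto
  finally show ?thesis by (simp add: sum_divide_distrib)
qed

lemma sampling_adj_eq: "sampling_adj H ip n x a = adj a"
  unfolding sampling_adj_def
proof (rule the_equality)
  show "adj a \<in> H \<and> (\<forall>h'\<in>H. ip h' (adj a) = emp_inner n (sampling_op n x h') a)"
    using adj_in ip_adj by (auto simp: emp_inner_def sampling_op_def mult.commute intro!: sum.cong)
  then show "h = adj a" if "h \<in> H \<and> (\<forall>h'\<in>H. ip h' h = emp_inner n (sampling_op n x h') a)" for h
    using that by (intro ip_eqI) auto
qed

abbreviation S where "S \<equiv> sampling_op n x"
abbreviation Sigma where "Sigma \<equiv> emp_cov_op H ip n x"

lemma Sigma_eq: "Sigma h = adj (\<lambda>i. h (x i))"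
  unfolding emp_cov_op_def sampling_adj_eq adj_def by (simp add: sampling_op_def)

lemma Sigma_in: "Sigma h \<in> H"
  by (simp add: Sigma_eq adj_in)

lemma ip_Sigma: "h \<in> H \<Longrightarrow> h' \<in> H \<Longrightarrow> ip h (Sigma h') = (\<Sum>i<n. h (x i) * h' (x i)) / real n"
  by (simp add: Sigma_eq ip_adj mult.commute)

lemma Sigma_selfadjoint: "h \<in> H \<Longrightarrow> h' \<in> H \<Longrightarrow> ip (Sigma h) h' = ip h (Sigma h')"
  using ip_sym[OF Sigma_in[of h], of h'] ip_Sigma[of h' h] ip_Sigma[of h h'] by (simp add: mult.commute)

text \<open>The image of \<open>v j\<close> under the adjoint. It is left unnormalised: its squared
  norm is \<open>lam j / n\<close>, so it vanishes exactly when \<open>lam j\<close> does.\<close>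

definition w where "w j = adj (v j)"

lemma w_in: "w j \<in> H" by (simp add: w_def adj_in)

lemma w_sample: "j < n \<Longrightarrow> i < n \<Longrightarrow> w j (x i) = lam j * v j i"
proof -
  assume ji: "j < n" "i < n"
  have "w j (x i) = (\<Sum>l<n. (v j l / real n) * k (x l) (x i))"
    using x_in ji by (simp add: w_def adj_def kernel_section_def)
  also have "\<dots> = (\<Sum>l<n. k (x i) (x l) / real n * v j l)"
  proof (intro sum.cong refl)
    fix l assume "l \<in> {..<n}"
    then have l: "l < n" by simp
    have "k (x l) (x i) = ip (kernel_section X k (x l)) (kernel_section X k (x i))"
      using reproducing[OF ji(2) section_in[OF l]] x_in ji by (simp add: kernel_section_def)
    also have "\<dots> = ip (kernel_section X k (x i)) (kernel_section X k (x l))"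
      using section_in ji l ip_sym by blast
    also have "\<dots> = k (x i) (x l)"
      using reproducing[OF l section_in[OF ji(2)]] x_in l by (simp add: kernel_section_def)
    finally show "(v j l / real n) * k (x l) (x i) = k (x i) (x l) / real n * v j l" by simp
  qed
  also have "\<dots> = lam j * v j i" using ev ji by simp
  finally show ?thesis .
qed

lemma Sigma_w: "j < n \<Longrightarrow> Sigma (w j) = (\<lambda>z. lam j * w j z)"
proof -
  assume j: "j < n"
  have "Sigma (w j) = (\<lambda>z. \<Sum>i<n. (lam j * v j i / real n) * kernel_section X k (x i) z)"
    unfolding Sigma_eq using w_sample[OF j] by (simp add: adj_def)
  also have "\<dots> = (\<lambda>z. lam j * w j z)"
    by (simp add: w_def adj_def sum_distrib_left mult.assoc)
  finally show ?thesis .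
qed

lemma ip_w: "j < n \<Longrightarrow> l < n \<Longrightarrow> ip (w j) (w l) = lam j * of_bool (j = l) / real n"
proof -
  assume j: "j < n" and l: "l < n"
  have "ip (w j) (w l) = (\<Sum>i<n. v l i * w j (x i)) / real n"
    unfolding w_def[of l] by (rule ip_adj[OF w_in])
  also have "(\<Sum>i<n. v l i * w j (x i)) = (\<Sum>i<n. lam j * (v j i * v l i))"
    using w_sample[OF j] by (intro sum.cong) auto
  also have "\<dots> = lam j * of_bool (j = l)" using on j l by (simp flip: sum_distrib_left)
  finally show ?thesis .
qed

text \<open>Up to the factor 1/n this is the squared norm of \<open>w j\<close>.\<close>

lemma lam_nonneg: "j < n \<Longrightarrow> 0 \<le> lam j"
  using ip_nonneg[OF w_in[of j]] ip_w[of j j] n_pos by (simp add: zero_le_divide_iff)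

lemma cauchy_schwarz:
  assumes "h \<in> H" "h' \<in> H"
  shows "(ip h h')\<^sup>2 \<le> ip h h * ip h' h'"
proof (cases "ip h' h' = 0")
  case True
  then have "h' = (\<lambda>x. 0)" using ip_definite assms by blast
  then show ?thesis using assms ip_zero ip_sym[of h "\<lambda>x. 0"] H_zero by simp
next
  case False
  then have pos: "ip h' h' > 0" using ip_nonneg[OF assms(2)] by simp
  \<comment> \<open>A multiple of the component of \<open>h\<close> orthogonal to \<open>h'\<close>,
    scaled so that no division occurs.\<close>
  define g where "g = (\<lambda>x. ip h' h' * h x + (- ip h h') * h' x)"
  have g: "g \<in> H" unfolding g_def by (rule H_lin[OF assms])
  have *: "ip l g = ip h' h' * ip l h + (- ip h h') * ip l h'" if "l \<in> H" for l
    using ip_lin[OF assms that, of "ip h' h'" "- ip h h'"] ip_sym[OF g that] ip_sym[OF that assms(1)]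
      ip_sym[OF that assms(2)] by (simp add: g_def)
  have "0 \<le> ip g g" using ip_nonneg[OF g] .
  also have "ip g g = ip h' h' * (ip h h * ip h' h' - (ip h h')\<^sup>2)"
    using ip_lin[OF assms g, of "ip h' h'" "- ip h h'"] *[OF assms(1)] *[OF assms(2)] ip_sym[OF assms]
    unfolding g_def[symmetric] by (simp add: algebra_simps power2_eq_square)
  finally show ?thesis using pos by (simp add: zero_le_mult_iff)
qed

text \<open>The values of \<open>w j\<close> at the design points have sum of squares \<lambda>^2,
  while each is at most the norm of \<open>w j\<close> times \<open>M\<close> by Cauchy-Schwarz. As
  that squared norm is \<lambda>/n, this gives \<lambda>^2 \<le> \<lambda> M^2.\<close>

lemma lam_le: "j < n \<Longrightarrow> lam j \<le> M\<^sup>2"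
proof -
  assume j: "j < n"
  have "lam j * lam j = (\<Sum>i<n. (w j (x i))\<^sup>2)"
  proof -
    have "(\<Sum>i<n. (w j (x i))\<^sup>2) = (\<Sum>i<n. lam j * lam j * (v j i * v j i))"
      using w_sample[OF j] by (intro sum.cong) (auto simp: power2_eq_square)
    also have "\<dots> = lam j * lam j * (\<Sum>i<n. v j i * v j i)" by (rule sum_distrib_left[symmetric])
    finally show ?thesis using on j by simp
  qed
  also have "\<dots> \<le> (\<Sum>i<n. lam j / real n * M\<^sup>2)"
  proof (intro sum_mono)
    fix i assume "i \<in> {..<n}"
    then have i: "i < n" by simp
    let ?k = "kernel_section X k (x i)"
    have "(w j (x i))\<^sup>2 \<le> ip (w j) (w j) * ip ?k ?k"
      using cauchy_schwarz[OF w_in section_in[OF i], of j] reproducing[OF i w_in] by simp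
    also have "ip ?k ?k \<le> M\<^sup>2"
      using k_bound[OF i] ip_nonneg[OF section_in[OF i]] M_pos unfolding ip_norm_def
      by (meson real_sqrt_le_iff real_sqrt_le_mono sqrt_le_D)
    then have "ip (w j) (w j) * ip ?k ?k \<le> ip (w j) (w j) * M\<^sup>2"
      by (intro mult_left_mono ip_nonneg w_in)
    also have "\<dots> = lam j / real n * M\<^sup>2" using ip_w[OF j j] by simp
    finally show "(w j (x i))\<^sup>2 \<le> lam j / real n * M\<^sup>2" .
  qed
  also have "\<dots> = lam j * M\<^sup>2" using n_pos by simp
  finally show ?thesis using lam_nonneg[OF j] by (cases "lam j = 0") auto
qed

section \<open>Functional calculus in coordinates\<close>

lemma expand: "i < n \<Longrightarrow> y i = (\<Sum>j<n. (\<Sum>l<n. y l * v j l) * v j i)"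
proof -
  assume i: "i < n"
  have "(\<Sum>j<n. (\<Sum>l<n. y l * v j l) * v j i) = (\<Sum>l<n. y l * (\<Sum>j<n. v j l * v j i))"
    by (simp add: sum_distrib_left sum_distrib_right mult.assoc) (rule sum.swap)
  also have "\<dots> = (\<Sum>l<n. if l = i then y l else 0)" using complete i by (intro sum.cong) auto
  finally show ?thesis using i by simp
qed

lemma adj_expand: "adj y = (\<lambda>z. \<Sum>j<n. (\<Sum>l<n. y l * v j l) * w j z)"
proof
  fix z
  have "adj y z = (\<Sum>i<n. (\<Sum>j<n. (\<Sum>l<n. y l * v j l) * v j i) / real n * kernel_section X k (x i) z)"
    unfolding adj_def using expand[of _ y] by (intro sum.cong) auto
  also have "\<dots> = (\<Sum>j<n. (\<Sum>l<n. y l * v j l) * w j z)"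
    unfolding w_def adj_def sum_distrib_left sum_divide_distrib sum_distrib_right
    by (subst sum.swap) (simp add: sum_distrib_left sum_distrib_right sum_divide_distrib mult_ac)
  finally show "adj y z = (\<Sum>j<n. (\<Sum>l<n. y l * v j l) * w j z)" .
qed

text \<open>By self-adjointness an eigenvector for any other \<mu> is orthogonal to every
  \<open>w j\<close>. Completeness of the basis then makes it vanish at all design points, so
  \<open>Sigma\<close> annihilates it and \<mu> = 0.\<close>

lemma op_eigenvalues_subset: "op_eigenvalues H Sigma \<subseteq> insert 0 (lam ` {..<n})"
proof
  fix \<mu> assume "\<mu> \<in> op_eigenvalues H Sigma"
  then obtain h where h: "h \<in> H" "Sigma h = (\<lambda>z. \<mu> * h z)" "h \<noteq> (\<lambda>z. 0)"
    by (auto simp: op_eigenvalues_def eigenspace_def)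
  show "\<mu> \<in> insert 0 (lam ` {..<n})"
  proof (rule ccontr)
    assume not: "\<not> ?thesis"
    let ?c = "\<lambda>j. \<Sum>l<n. h (x l) * v j l"
    have "?c j * v j i = 0" if "j < n" "i < n" for i j
    proof -
      have "lam j * ip (w j) h = ip (Sigma (w j)) h"
        using Sigma_w[OF that(1)] ip_scale[OF w_in h(1)] by simp
      also have "\<dots> = \<mu> * ip (w j) h"
        using Sigma_selfadjoint[OF w_in h(1), of j] h ip_scale[OF h(1) w_in, of \<mu> j]
          ip_sym[OF w_in h(1), of j] ip_sym[OF w_in H_scale[OF h(1)], of j \<mu>] by simp
      finally have "ip (w j) h = 0" using not that by auto
      moreover have "ip (w j) h = ?c j / real n"
        using ip_sym[OF w_in h(1), of j] ip_adj[OF h(1), of "v j"] by (simp add: w_def mult.commute)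
      ultimately show ?thesis using n_pos by simp
    qed
    then have "(\<Sum>j<n. ?c j * v j i) = 0" if "i < n" for i using that by (intro sum.neutral) auto
    then have "h (x i) = 0" if "i < n" for i using expand[OF that, of "\<lambda>i. h (x i)"] that by simp
    then have "Sigma h = (\<lambda>z. 0)" by (simp add: Sigma_eq adj_def)
    then show False using h not by (auto simp: fun_eq_iff)
  qed
qed

text \<open>In the expansion of \<open>adj y\<close> along the \<open>w j\<close>, the terms with
  \<open>lam j = \<mu>\<close> lie in the eigenspace, and self-adjointness makes the remaining ones
  orthogonal to it.\<close>

lemma orth_proj_adj:
  "orth_proj ip (eigenspace H Sigma \<mu>) (adj y)
    = (\<lambda>z. \<Sum>j\<in>{j\<in>{..<n}. lam j = \<mu>}. (\<Sum>l<n. y l * v j l) * w j z)" (is "_ = ?p")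
  if \<mu>: "\<mu> \<noteq> 0"
  unfolding orth_proj_def
proof (rule the_equality)
  let ?W = "eigenspace H Sigma \<mu>"
  have p_in: "?p \<in> H" by (intro H_sum w_in) auto
  have W_in: "u \<in> H" if "u \<in> ?W" for u using that by (simp add: eigenspace_def)
  have "Sigma ?p = (\<lambda>z. \<mu> * ?p z)"
  proof -
    have "?p (x i) = (\<Sum>j\<in>{j\<in>{..<n}. lam j = \<mu>}. (\<Sum>l<n. y l * v j l) * (\<mu> * v j i))" if "i < n" for i
      using w_sample that by (intro sum.cong) auto
    then have "Sigma ?p = adj (\<lambda>i. \<Sum>j\<in>{j\<in>{..<n}. lam j = \<mu>}. (\<Sum>l<n. y l * v j l) * (\<mu> * v j i))"
      by (simp add: Sigma_eq adj_def)
    also have "\<dots> = (\<lambda>z. \<mu> * ?p z)"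
      unfolding adj_def w_def sum_distrib_left sum_divide_distrib sum_distrib_right
      by (rule ext, subst sum.swap) (simp add: sum_distrib_left sum_distrib_right mult_ac)
    finally show ?thesis .
  qed
  then have p_W: "?p \<in> ?W" using p_in by (simp add: eigenspace_def)
  have orth: "ip (\<lambda>z. adj y z - ?p z) u = 0" if "u \<in> ?W" for u
  proof -
    have u: "u \<in> H" "Sigma u = (\<lambda>z. \<mu> * u z)" using that by (auto simp: eigenspace_def)
    have diff: "(\<lambda>z. adj y z - ?p z) = (\<lambda>z. \<Sum>j\<in>{j\<in>{..<n}. lam j \<noteq> \<mu>}. (\<Sum>l<n. y l * v j l) * w j z)"
    proof
      fix z
      have "adj y z = ?p z + (\<Sum>j\<in>{j\<in>{..<n}. lam j \<noteq> \<mu>}. (\<Sum>l<n. y l * v j l) * w j z)"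
        unfolding adj_expand by (rule sum_filter_split) simp
      then show "adj y z - ?p z = (\<Sum>j\<in>{j\<in>{..<n}. lam j \<noteq> \<mu>}. (\<Sum>l<n. y l * v j l) * w j z)" by simp
    qed
    have "ip (w j) u = 0" if "j < n" "lam j \<noteq> \<mu>" for j
    proof -
      have "lam j * ip (w j) u = ip (Sigma (w j)) u"
        using Sigma_w[OF that(1)] ip_scale[OF w_in u(1)] by simp
      also have "\<dots> = \<mu> * ip (w j) u"
        using Sigma_selfadjoint[OF w_in u(1), of j] u ip_scale[OF u(1) w_in, of \<mu> j]
          ip_sym[OF w_in u(1), of j] ip_sym[OF w_in H_scale[OF u(1)], of j \<mu>] by simp
      finally show ?thesis using that by auto
    qed
    then show ?thesis unfolding diff using u(1) by (subst ip_sum) (auto simp: w_in)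
  qed
  show "?p \<in> ?W \<and> (\<forall>u\<in>?W. ip (\<lambda>z. adj y z - ?p z) u = 0)" using p_W orth by auto
  fix q assume q: "q \<in> ?W \<and> (\<forall>u\<in>?W. ip (\<lambda>z. adj y z - q z) u = 0)"
  show "q = ?p"
  \<comment> \<open>Two candidates lie in the eigenspace and their difference is orthogonal to it,
    hence to itself.\<close>
  proof -
    have qH: "q \<in> H" using q W_in by auto
    let ?d = "\<lambda>z. q z - ?p z"
    have dH: "?d \<in> H" using H_diff[OF qH p_in] .
    have "ip ?d q = ip ?d ?p"
    proof -
      have eq: "ip ?d u = 0" if "u \<in> ?W" for u
      proof -
        have u: "u \<in> H" using that W_in by auto
        have "ip (adj y) u - ip q u = 0" "ip (adj y) u - ip ?p u = 0"
          using q orth[OF that] ip_diff[OF adj_in qH u] ip_diff[OF adj_in p_in u] that by auto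
        then show ?thesis using ip_diff[OF qH p_in u] by simp
      qed
      show ?thesis using eq[of q] eq[OF p_W] q by simp
    qed
    then have "ip ?d ?d = 0"
      using ip_diff[OF qH p_in dH] ip_sym[OF dH qH] ip_sym[OF dH p_in] by simp
    then have "?d = (\<lambda>z. 0)" using ip_definite[OF dH] by blast
    then show ?thesis by (auto simp: fun_eq_iff)
  qed
qed

text \<open>The definition sums over distinct eigenvalues; grouping the indices \<open>j\<close> by
  \<open>lam j\<close> replaces this by a sum over the basis. The eigenvalue 0 drops out because
  \<phi> vanishes there.\<close>

lemma fun_calc_adj:
  assumes "\<phi> 0 = 0"
  shows "fun_calc H ip \<phi> Sigma (adj y) = (\<lambda>z. \<Sum>j<n. \<phi> (lam j) * (\<Sum>l<n. y l * v j l) * w j z)"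
proof
  fix z
  let ?O = "op_eigenvalues H Sigma"
  define c where "c = (\<lambda>j. \<Sum>l<n. y l * v j l)"
  have proj: "orth_proj ip (eigenspace H Sigma \<mu>) (adj y) = (\<lambda>z. \<Sum>j\<in>{j\<in>{..<n}. lam j = \<mu>}. c j * w j z)"
    if "\<mu> \<noteq> 0" for \<mu> using orth_proj_adj[OF that, of y] by (simp add: c_def)
  have fin: "finite ?O" using op_eigenvalues_subset finite_subset by blast
  have "fun_calc H ip \<phi> Sigma (adj y) z
      = (\<Sum>\<mu>\<in>?O. \<Sum>j\<in>{j\<in>{..<n}. lam j = \<mu>}. \<phi> (lam j) * c j * w j z)"
    unfolding fun_calc_def
  proof (intro sum.cong refl)
    fix \<mu>
    show "\<phi> \<mu> * orth_proj ip (eigenspace H Sigma \<mu>) (adj y) z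
        = (\<Sum>j\<in>{j\<in>{..<n}. lam j = \<mu>}. \<phi> (lam j) * c j * w j z)"
      by (cases "\<mu> = 0") (auto simp: assms proj sum_distrib_left mult.assoc)
  qed
  also have "\<dots> = (\<Sum>\<mu>\<in>?O. \<Sum>j | j \<in> {j\<in>{..<n}. lam j \<in> ?O} \<and> lam j = \<mu>. \<phi> (lam j) * c j * w j z)"
    by (intro sum.cong refl) auto
  also have "\<dots> = (\<Sum>j\<in>{j\<in>{..<n}. lam j \<in> ?O}. \<phi> (lam j) * c j * w j z)"
    using fin by (intro sum.group) auto
  also have "\<dots> = (\<Sum>j<n. \<phi> (lam j) * c j * w j z)"
  proof (intro sum.mono_neutral_left ballI)
    \<comment> \<open>If \<open>lam j\<close> is not an eigenvalue of \<open>Sigma\<close>, then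
      \<open>w j\<close>, which satisfies the eigenvector equation, must be 0. This occurs for
      \<open>lam j = 0\<close> when \<open>Sigma\<close> is injective.\<close>
    fix j assume j: "j \<in> {..<n} - {j\<in>{..<n}. lam j \<in> ?O}"
    then have "w j = (\<lambda>z. 0)"
      using Sigma_w[of j] w_in[of j] by (auto simp: op_eigenvalues_def eigenspace_def)
    then show "\<phi> (lam j) * c j * w j z = 0" by simp
  qed auto
  finally show "fun_calc H ip \<phi> Sigma (adj y) z = (\<Sum>j<n. \<phi> (lam j) * (\<Sum>l<n. y l * v j l) * w j z)" by (simp add: c_def)
qed

text \<open>Sampling \<open>w j\<close> contributes a factor \<open>lam j\<close>, which turns the
  filter g_t(\<lambda>) on the Hilbert space into \<lambda> g_t(\<lambda>) on the sample.\<close>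

lemma fitted_eq:
  assumes "i < n"
  shows "fitted H ip g n x y t i = (\<Sum>j<n. lam j * filter_fun g t (lam j) * (\<Sum>l<n. y l * v j l) * v j i)"
proof -
  have "fitted H ip g n x y t i = (\<Sum>j<n. filter_fun g t (lam j) * (\<Sum>l<n. y l * v j l) * w j (x i))"
    using assms unfolding fitted_def filter_estimator_def sampling_adj_eq
    by (subst fun_calc_adj) (auto simp: filter_fun_def sampling_op_def)
  also have "\<dots> = (\<Sum>j<n. lam j * filter_fun g t (lam j) * (\<Sum>l<n. y l * v j l) * v j i)"
    using assms w_sample by (intro sum.cong) auto
  finally show ?thesis .
qed

lemma emp_norm_expand:
  assumes "\<And>i. i < n \<Longrightarrow> a i = (\<Sum>j<n. c j * v j i)"
  shows "(emp_norm n a)\<^sup>2 = (\<Sum>j<n. (c j)\<^sup>2) / real n"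
proof -
  have "(\<Sum>i<n. a i * a i) = (\<Sum>i<n. (\<Sum>j<n. c j * v j i)\<^sup>2)"
    using assms by (intro sum.cong) (auto simp: power2_eq_square)
  also have "\<dots> = (\<Sum>j<n. (c j)\<^sup>2)" by (rule orthonormal_sum_squares[OF on])
  finally show ?thesis by (simp add: emp_norm_def emp_inner_def sum_nonneg)
qed

lemma sq_loss_eq:
  "sq_loss H ip g n f x y t = (\<Sum>j<n. ((\<Sum>l<n. f (x l) * v j l)
      - lam j * filter_fun g t (lam j) * (\<Sum>l<n. y l * v j l))\<^sup>2) / real n"
  unfolding sq_loss_def
proof (rule emp_norm_expand)
  fix i assume i: "i < n"
  show "f (x i) - fitted H ip g n x y t i = (\<Sum>j<n. ((\<Sum>l<n. f (x l) * v j l)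
      - lam j * filter_fun g t (lam j) * (\<Sum>l<n. y l * v j l)) * v j i)"
    using expand[OF i, of "\<lambda>i. f (x i)"] fitted_eq[OF i, of g y t]
    by (simp only: left_diff_distrib sum_subtractf)
qed

lemma residual_eq:
  "(emp_norm n (\<lambda>i. y i - fitted H ip g n x y t i))\<^sup>2
     = (\<Sum>j<n. ((\<Sum>l<n. y l * v j l) - lam j * filter_fun g t (lam j) * (\<Sum>l<n. y l * v j l))\<^sup>2) / real n"
proof (rule emp_norm_expand)
  fix i assume i: "i < n"
  show "y i - fitted H ip g n x y t i = (\<Sum>j<n. ((\<Sum>l<n. y l * v j l)
      - lam j * filter_fun g t (lam j) * (\<Sum>l<n. y l * v j l)) * v j i)"
    using expand[OF i, of y] fitted_eq[OF i, of g y t]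
    by (simp only: left_diff_distrib sum_subtractf)
qed

end

section \<open>Concentration of quadratic forms in sub-Gaussian noise\<close>

lemma exp_le_quadratic:
  fixes x :: real
  assumes "x \<le> 1"
  shows "exp x \<le> 1 + x + x\<^sup>2"
proof -
  consider "0 \<le> x" | "-1 \<le> x" "x < 0" | "x < -1" by linarith
  then show ?thesis
  proof cases
    case 1
    then show ?thesis using exp_bound[of x] assms by simp
  next
    case 2
    \<comment> \<open>Both sides are compared with 1/(1 - x), using (1 + x + x^2)(1 - x) = 1 -
      x^3.\<close>
    have "1 + (- x) \<le> exp (- x)" by (rule exp_ge_add_one_self)
    then have "exp x * (1 - x) \<le> exp x * exp (- x)" by (intro mult_left_mono) auto
    then have "exp x * (1 - x) \<le> 1" by (simp flip: exp_add)
    also have "1 \<le> (1 + x + x\<^sup>2) * (1 - x)"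
    proof -
      have "(1 + x + x\<^sup>2) * (1 - x) = 1 - x * x\<^sup>2" by (simp add: algebra_simps power2_eq_square)
      moreover have "x * x\<^sup>2 \<le> 0" using 2 by (intro mult_nonpos_nonneg) auto
      ultimately show ?thesis by simp
    qed
    finally show ?thesis using 2 by simp
  next
    case 3
    then have "exp x \<le> 1" by simp
    also have "1 \<le> 1 + x + x\<^sup>2"
    proof -
      have "0 \<le> (- x) * (- x - 1)" using 3 by (intro mult_nonneg_nonneg) auto
      then show ?thesis by (simp add: algebra_simps power2_eq_square)
    qed
    finally show ?thesis .
  qed
qed

text \<open>For a centred variable the linear term has mean 0, so the exponential moment is
  controlled by that of the square.\<close>

lemma exp_le_add_exp_square:
  fixes x :: real
  shows "exp x \<le> x + exp (x\<^sup>2)"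
proof (cases "x \<le> 1")
  case True
  have "exp x \<le> x + (1 + x\<^sup>2)" using exp_le_quadratic[OF True] by simp
  also have "\<dots> \<le> x + exp (x\<^sup>2)" using exp_ge_add_one_self[of "x\<^sup>2"] by linarith
  finally show ?thesis .
next
  case False
  then have "x * 1 \<le> x * x" by (intro mult_left_mono) auto
  then have "exp x \<le> exp (x\<^sup>2)" by (simp add: power2_eq_square)
  then show ?thesis using False by linarith
qed

text \<open>The second-order counterpart for variables without an upper bound; the linear term again
  disappears after centring.\<close>

lemma exp_le_quadratic_exp:
  fixes y :: real
  shows "exp y \<le> 1 + y + y\<^sup>2 * exp \<bar>y\<bar>"
proof (cases "y \<le> 1")
  case True
  have "y\<^sup>2 * 1 \<le> y\<^sup>2 * exp \<bar>y\<bar>" by (intro mult_left_mono) auto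
  then show ?thesis using exp_le_quadratic[OF True] by linarith
next
  case False
  then have "1 * 1 \<le> y * y" by (intro mult_mono) auto
  then have "1 * exp y \<le> y\<^sup>2 * exp y" by (intro mult_right_mono) (auto simp: power2_eq_square)
  then have "exp y \<le> y\<^sup>2 * exp \<bar>y\<bar>" using False by simp
  then show ?thesis using False by linarith
qed

text \<open>Interpolation between the exponents 0 and \<open>z\<close>: with E exp(z) \<le> 2 it
  gives E exp(p z) \<le> 1 + p, which is small for small \<open>p\<close>.\<close>

lemma exp_convex_le:
  fixes p z :: real
  assumes "0 \<le> p" "p \<le> 1"
  shows "exp (p * z) \<le> 1 - p + p * exp z"
proof -
  have "convex_on UNIV (exp :: real \<Rightarrow> real)" by (rule exp_convex)
  from convex_onD[OF this, of p 0 z] assms show ?thesis by simp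
qed

lemma square_le_exp_half:
  fixes z :: real
  assumes "0 \<le> z"
  shows "z\<^sup>2 \<le> 8 * exp (z / 2)"
  using exp_lower_Taylor_quadratic[of "z / 2"] assms by (simp add: power2_eq_square)

section \<open>Gaussian integration and exponential moments of quadratic forms\<close>

text \<open>Completing the square turns the integrand into a multiple of a normal density with
  variance 1/(1 - \<alpha>).\<close>

lemma gaussian_mgf:
  fixes \<alpha> b :: real
  assumes "\<alpha> < 1"
  shows "(\<integral>\<^sup>+z. ennreal (std_normal_density z * exp (\<alpha> * z\<^sup>2 / 2 + b * z)) \<partial>lborel)
    = ennreal (exp (b\<^sup>2 / (2 * (1 - \<alpha>))) / sqrt (1 - \<alpha>))"
proof -
  define s where "s = 1 / sqrt (1 - \<alpha>)"
  have s: "s > 0" and s2: "s\<^sup>2 = 1 / (1 - \<alpha>)" using assms by (auto simp: s_def power_divide)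
  have eq: "std_normal_density z * exp (\<alpha> * z\<^sup>2 / 2 + b * z)
      = (exp (b\<^sup>2 / (2 * (1 - \<alpha>))) * s) * normal_density (b * s\<^sup>2) s z" for z
  proof -
    have "- (z\<^sup>2) / 2 + (\<alpha> * z\<^sup>2 / 2 + b * z) = b\<^sup>2 / (2 * (1 - \<alpha>)) + - ((z - b * s\<^sup>2)\<^sup>2) / (2 * s\<^sup>2)"
    proof -
      define d where "d = 1 - \<alpha>"
      have d: "d \<noteq> 0" "\<alpha> = 1 - d" using assms by (auto simp: d_def)
      show ?thesis unfolding s2 d(2) using d(1) by (simp add: field_simps power2_eq_square)
    qed
    then have e1: "exp (- (z\<^sup>2) / 2) * exp (\<alpha> * z\<^sup>2 / 2 + b * z)
        = exp (b\<^sup>2 / (2 * (1 - \<alpha>))) * exp (- ((z - b * s\<^sup>2)\<^sup>2) / (2 * s\<^sup>2))"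
      by (simp only: flip: exp_add)
    have e2: "1 / sqrt (2 * pi) = 1 / sqrt (2 * pi * s\<^sup>2) * s"
      using s by (simp add: real_sqrt_mult)
    have "std_normal_density z * exp (\<alpha> * z\<^sup>2 / 2 + b * z)
        = (1 / sqrt (2 * pi)) * (exp (- (z\<^sup>2) / 2) * exp (\<alpha> * z\<^sup>2 / 2 + b * z))"
      by (simp add: std_normal_density_def)
    also have "\<dots> = (1 / sqrt (2 * pi * s\<^sup>2) * s) *
        (exp (b\<^sup>2 / (2 * (1 - \<alpha>))) * exp (- ((z - b * s\<^sup>2)\<^sup>2) / (2 * s\<^sup>2)))"
      by (simp only: e1 e2)
    finally show ?thesis unfolding normal_density_def by (simp only: mult_ac)
  qed
  have "(\<integral>\<^sup>+z. ennreal (normal_density (b * s\<^sup>2) s z) \<partial>lborel) = 1"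
    using prob_space.emeasure_space_1[OF prob_space_normal_density[OF s, of "b * s\<^sup>2"]]
    by (simp add: emeasure_density)
  then show ?thesis unfolding eq using s
    by (subst ennreal_mult, simp, simp, subst nn_integral_cmult) (auto simp: s_def)
qed

text \<open>After squaring it suffices that (1 + 2\<alpha>)(1 - \<alpha>) = 1 + \<alpha>(1 -
  2\<alpha>) \<ge> 1.\<close>

lemma inverse_sqrt_le_exp:
  fixes \<alpha> :: real
  assumes "0 \<le> \<alpha>" "\<alpha> \<le> 1 / 2"
  shows "1 / sqrt (1 - \<alpha>) \<le> exp \<alpha>"
proof -
  have "1 \<le> (1 + 2 * \<alpha>) * (1 - \<alpha>)"
  proof -
    have "0 \<le> \<alpha> * (1 - 2 * \<alpha>)" using assms by (intro mult_nonneg_nonneg) auto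
    then show ?thesis by (simp add: algebra_simps)
  qed
  also have "\<dots> \<le> exp (2 * \<alpha>) * (1 - \<alpha>)"
    using exp_ge_add_one_self[of "2 * \<alpha>"] assms by (intro mult_right_mono) auto
  also have "\<dots> = (exp \<alpha> * sqrt (1 - \<alpha>))\<^sup>2"
    using assms by (simp add: power_mult_distrib exp_double)
  finally have "1 \<le> exp \<alpha> * sqrt (1 - \<alpha>)"
    using assms by (intro power2_le_imp_le[of 1]) auto
  then show ?thesis using assms by (simp add: divide_le_eq)
qed

text \<open>
  Induction on \<open>m\<close>: writing \<open>exp (a\<^sup>2/2)\<close> as the Gaussian mean of \<open>exp (a z)\<close> turns the last square
  into a perturbation of the linear term \<open>v\<close>, which the induction hypothesis handles for each \<open>z\<close>.
\<close>

lemma quadratic_form_mgf: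
  fixes Z :: "'a \<Rightarrow> nat \<Rightarrow> real" and u :: "nat \<Rightarrow> nat \<Rightarrow> real"
  assumes "sigma_finite_measure N"
    and meas [measurable]: "\<And>i. i < n \<Longrightarrow> (\<lambda>w. Z w i) \<in> borel_measurable N"
    and K: "0 \<le> K"
    and mgf: "\<And>v. (\<integral>\<^sup>+w. ennreal (exp (\<Sum>i<n. v i * Z w i)) \<partial>N) \<le> ennreal (exp (K / 2 * (\<Sum>i<n. (v i)\<^sup>2)))"
    and on: "\<forall>j<n. \<forall>l<n. (\<Sum>i<n. u j i * u l i) = of_bool (j = l)"
    and c: "\<And>j. j < n \<Longrightarrow> 0 \<le> c j" "\<And>j. j < n \<Longrightarrow> K * c j \<le> 1 / 2"
    and "m \<le> n"
  shows "(\<integral>\<^sup>+w. ennreal (exp ((\<Sum>j<m. c j * (\<Sum>i<n. u j i * Z w i)\<^sup>2) / 2 + (\<Sum>i<n. v i * Z w i))) \<partial>N)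
    \<le> ennreal (exp (K * (\<Sum>j<m. c j) + K / 2 * ((\<Sum>i<n. (v i)\<^sup>2) + (\<Sum>j<m. 2 * K * c j * (\<Sum>i<n. v i * u j i)\<^sup>2))))"
  using \<open>m \<le> n\<close>
proof (induction m arbitrary: v)
  case 0
  then show ?case using mgf[of v] by simp
next
  case (Suc m)
  interpret N: sigma_finite_measure N by fact
  interpret P: pair_sigma_finite N lborel ..
  have m: "m < n" using Suc.prems by simp
  define q where "q w = (\<Sum>j<m. c j * (\<Sum>i<n. u j i * Z w i)\<^sup>2) / 2" for w
  define r where "r = sqrt (c m)"
  define a where "a w = r * (\<Sum>i<n. u m i * Z w i)" for w
  define R where "R = K * (\<Sum>j<m. c j) + K / 2 * ((\<Sum>i<n. (v i)\<^sup>2) + (\<Sum>j<m. 2 * K * c j * (\<Sum>i<n. v i * u j i)\<^sup>2))"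
  define p where "p = (\<Sum>i<n. v i * u m i)"
  have r2: "r\<^sup>2 = c m" using c(1)[OF m] by (simp add: r_def)
  have qm [measurable]: "q \<in> borel_measurable N" unfolding q_def by measurable
  have am [measurable]: "a \<in> borel_measurable N" unfolding a_def by measurable
  have vm [measurable]: "(\<lambda>w. \<Sum>i<n. v i * Z w i) \<in> borel_measurable N" by measurable
  have gauss: "ennreal (exp (x\<^sup>2 / 2)) = (\<integral>\<^sup>+z. ennreal (std_normal_density z * exp (x * z)) \<partial>lborel)" for x
    using gaussian_mgf[of 0 x] by simp
  have IH: "(\<integral>\<^sup>+w. ennreal (exp (q w + ((\<Sum>i<n. v i * Z w i) + a w * z))) \<partial>N)
      \<le> ennreal (exp (R + K * r * p * z + K * c m * z\<^sup>2 / 2))" for z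
  proof -
    \<comment> \<open>For fixed \<open>z\<close> the linearised square shifts \<open>v\<close> along
      \<open>u m\<close>. Orthogonality to \<open>u j\<close> for \<open>j < m\<close> leaves the
      terms of the induction hypothesis indexed by \<open>j\<close> unchanged; only the squared norm
      of \<open>v\<close> changes.\<close>
    define v' where "v' i = v i + r * z * u m i" for i
    have lin: "(\<Sum>i<n. v' i * Z w i) = (\<Sum>i<n. v i * Z w i) + a w * z" for w
      by (simp add: v'_def a_def sum.distrib sum_distrib_left algebra_simps)
    have "(\<Sum>i<n. (v' i)\<^sup>2) = (\<Sum>i<n. (v i)\<^sup>2) + 2 * r * z * p + (r * z)\<^sup>2 * (\<Sum>i<n. u m i * u m i)"
      by (simp add: v'_def p_def power2_eq_square sum.distrib sum_distrib_left algebra_simps)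
    then have sq: "(\<Sum>i<n. (v' i)\<^sup>2) = (\<Sum>i<n. (v i)\<^sup>2) + 2 * r * z * p + c m * z\<^sup>2"
      using on m r2 by (simp add: power_mult_distrib)
    have orth: "(\<Sum>i<n. v' i * u j i) = (\<Sum>i<n. v i * u j i)" if "j < m" for j
    proof -
      have "(\<Sum>i<n. v' i * u j i) = (\<Sum>i<n. v i * u j i) + r * z * (\<Sum>i<n. u m i * u j i)"
        by (simp add: v'_def sum.distrib sum_distrib_left algebra_simps)
      then show ?thesis using on m that by simp
    qed
    have "K * (\<Sum>j<m. c j) + K / 2 * ((\<Sum>i<n. (v' i)\<^sup>2) + (\<Sum>j<m. 2 * K * c j * (\<Sum>i<n. v' i * u j i)\<^sup>2))
        = R + K * r * p * z + K * c m * z\<^sup>2 / 2"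
      unfolding R_def sq using orth by (simp add: algebra_simps)
    then show ?thesis using Suc.IH[of v'] m unfolding lin q_def by simp
  qed
  have "(\<integral>\<^sup>+w. ennreal (exp ((\<Sum>j<Suc m. c j * (\<Sum>i<n. u j i * Z w i)\<^sup>2) / 2 + (\<Sum>i<n. v i * Z w i))) \<partial>N)
      = (\<integral>\<^sup>+w. ennreal (exp (q w + (\<Sum>i<n. v i * Z w i))) * ennreal (exp ((a w)\<^sup>2 / 2)) \<partial>N)"
  proof (intro nn_integral_cong)
    fix w
    have "(\<Sum>j<Suc m. c j * (\<Sum>i<n. u j i * Z w i)\<^sup>2) / 2 + (\<Sum>i<n. v i * Z w i)
        = (q w + (\<Sum>i<n. v i * Z w i)) + (a w)\<^sup>2 / 2"
      by (simp add: q_def a_def power_mult_distrib r2 algebra_simps)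
    then show "ennreal (exp ((\<Sum>j<Suc m. c j * (\<Sum>i<n. u j i * Z w i)\<^sup>2) / 2 + (\<Sum>i<n. v i * Z w i)))
        = ennreal (exp (q w + (\<Sum>i<n. v i * Z w i))) * ennreal (exp ((a w)\<^sup>2 / 2))"
      by (simp flip: ennreal_mult exp_add)
  qed
  also have "\<dots> = (\<integral>\<^sup>+w. \<integral>\<^sup>+z. ennreal (exp (q w + (\<Sum>i<n. v i * Z w i))) * ennreal (std_normal_density z * exp (a w * z)) \<partial>lborel \<partial>N)"
    unfolding gauss by (simp add: nn_integral_cmult)
  also have "\<dots> = (\<integral>\<^sup>+w. \<integral>\<^sup>+z. ennreal (std_normal_density z) * ennreal (exp (q w + ((\<Sum>i<n. v i * Z w i) + a w * z))) \<partial>lborel \<partial>N)"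
    by (intro nn_integral_cong) (simp add: exp_add ac_simps flip: ennreal_mult)
  also have "\<dots> = (\<integral>\<^sup>+z. \<integral>\<^sup>+w. ennreal (std_normal_density z) * ennreal (exp (q w + ((\<Sum>i<n. v i * Z w i) + a w * z))) \<partial>N \<partial>lborel)"
    by (rule P.Fubini'[symmetric]) measurable
  also have "\<dots> = (\<integral>\<^sup>+z. ennreal (std_normal_density z) * (\<integral>\<^sup>+w. ennreal (exp (q w + ((\<Sum>i<n. v i * Z w i) + a w * z))) \<partial>N) \<partial>lborel)"
    by (simp add: nn_integral_cmult)
  also have "\<dots> \<le> (\<integral>\<^sup>+z. ennreal (std_normal_density z) * ennreal (exp (R + K * r * p * z + K * c m * z\<^sup>2 / 2)) \<partial>lborel)"
    by (intro nn_integral_mono mult_left_mono IH) auto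
  also have "\<dots> = (\<integral>\<^sup>+z. ennreal (exp R) * ennreal (std_normal_density z * exp (K * c m * z\<^sup>2 / 2 + K * r * p * z)) \<partial>lborel)"
    by (intro nn_integral_cong) (simp add: exp_add ac_simps flip: ennreal_mult)
  also have "\<dots> = ennreal (exp R) * ennreal (exp ((K * r * p)\<^sup>2 / (2 * (1 - K * c m))) / sqrt (1 - K * c m))"
    using gaussian_mgf[of "K * c m" "K * r * p"] c(2)[OF m] by (simp add: nn_integral_cmult)
  \<comment> \<open>The remaining Gaussian integral has \<alpha> = K c_m \<le> 1/2. Its normalising
    factor yields the trace term K c_m, and the same restriction bounds 1/(2(1 - \<alpha>)) by 1 in
    the exponent.\<close>
  also have "\<dots> \<le> ennreal (exp R) * ennreal (exp (K\<^sup>2 * c m * p\<^sup>2) * exp (K * c m))"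
  proof (intro mult_left_mono ennreal_leI)
    have Kc: "0 \<le> K * c m" "K * c m \<le> 1 / 2" using K c m by auto
    have "(K * r * p)\<^sup>2 / (2 * (1 - K * c m)) \<le> (K * r * p)\<^sup>2 / 1"
      using Kc by (intro divide_left_mono) auto
    also have "\<dots> = K\<^sup>2 * c m * p\<^sup>2" by (simp add: power_mult_distrib r2)
    finally have "exp ((K * r * p)\<^sup>2 / (2 * (1 - K * c m))) \<le> exp (K\<^sup>2 * c m * p\<^sup>2)" by simp
    then have "exp ((K * r * p)\<^sup>2 / (2 * (1 - K * c m))) * (1 / sqrt (1 - K * c m)) \<le> exp (K\<^sup>2 * c m * p\<^sup>2) * exp (K * c m)"
      using inverse_sqrt_le_exp[OF Kc] Kc by (intro mult_mono) auto
    then show "exp ((K * r * p)\<^sup>2 / (2 * (1 - K * c m))) / sqrt (1 - K * c m) \<le> exp (K\<^sup>2 * c m * p\<^sup>2) * exp (K * c m)"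
      by simp
  qed auto
  also have "\<dots> = ennreal (exp (R + (K\<^sup>2 * c m * p\<^sup>2 + K * c m)))"
    by (simp add: exp_add flip: ennreal_mult)
  also have "R + (K\<^sup>2 * c m * p\<^sup>2 + K * c m) = K * (\<Sum>j<Suc m. c j) + K / 2 * ((\<Sum>i<n. (v i)\<^sup>2) + (\<Sum>j<Suc m. 2 * K * c j * (\<Sum>i<n. v i * u j i)\<^sup>2))"
    by (simp add: R_def p_def algebra_simps power2_eq_square)
  finally show ?case .
qed

lemma linear_le_squares:
  fixes \<theta> x \<beta> :: real
  assumes "0 < \<beta>"
  shows "\<theta> * x \<le> \<theta>\<^sup>2 / (2 * \<beta>) + 1 / 2 * (\<beta> * x\<^sup>2)"
proof -
  define r where "r = \<theta> / \<beta>"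
  have \<theta>: "\<theta> = \<beta> * r" using assms by (simp add: r_def)
  have "0 \<le> \<beta> * (r - x)\<^sup>2" using assms by (intro mult_nonneg_nonneg) auto
  then show ?thesis unfolding \<theta> using assms by (simp add: power2_eq_square algebra_simps)
qed

section \<open>Exponential moments of independent noise\<close>

text \<open>The laws may differ between coordinates, because the conditional law of the noise may
  depend on the covariate. Assumption \<open>psi2\<close> says that the Orlicz psi_2-norm is at most
  1/sqrt(\<beta>).\<close>

locale noise_model =
  fixes n :: nat and \<nu> :: "nat \<Rightarrow> real measure" and \<sigma> \<beta> :: real
  assumes prob: "\<And>i. prob_space (\<nu> i)"
    and sets_\<nu>: "\<And>i. sets (\<nu> i) = sets borel"
    and \<beta>: "0 < \<beta>"
    and mean: "\<And>i. i < n \<Longrightarrow> (\<integral>x. x \<partial>\<nu> i) = 0"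
    and var: "\<And>i. i < n \<Longrightarrow> (\<integral>x. x\<^sup>2 \<partial>\<nu> i) = \<sigma>\<^sup>2"
    and psi2: "\<And>i. i < n \<Longrightarrow> (\<integral>\<^sup>+x. ennreal (exp (\<beta> * x\<^sup>2)) \<partial>\<nu> i) \<le> 2"
begin

sublocale product_prob_space \<nu> "{..<n}"
  by (intro product_prob_spaceI prob)

abbreviation "PN \<equiv> Pi\<^sub>M {..<n} \<nu>"

lemma space_\<nu> [simp]: "space (\<nu> i) = UNIV"
  using sets_eq_imp_space_eq[OF sets_\<nu>] by simp

lemma measurable_\<nu> [simp]: "borel_measurable (\<nu> i) = borel_measurable borel"
  by (rule measurable_cong_sets[OF sets_\<nu> refl])

lemma measure_UNIV [simp]: "measure (\<nu> i) UNIV = 1"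
  using prob_space.prob_space[OF prob, of i] by simp

lemma exp_square_integrable: "i < n \<Longrightarrow> integrable (\<nu> i) (\<lambda>x. exp (\<beta> * x\<^sup>2))"
  using psi2[of i] by (intro integrableI_nonneg) (auto intro: le_less_trans)

lemma exp_square_expectation: "i < n \<Longrightarrow> (\<integral>x. exp (\<beta> * x\<^sup>2) \<partial>\<nu> i) \<le> 2"
proof -
  assume i: "i < n"
  have "ennreal (\<integral>x. exp (\<beta> * x\<^sup>2) \<partial>\<nu> i) = (\<integral>\<^sup>+x. ennreal (exp (\<beta> * x\<^sup>2)) \<partial>\<nu> i)"
    by (rule nn_integral_eq_integral[symmetric]) (use exp_square_integrable[OF i] in auto)
  with psi2[OF i] have "ennreal (\<integral>x. exp (\<beta> * x\<^sup>2) \<partial>\<nu> i) \<le> ennreal 2" by simp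
  then show ?thesis by (subst (asm) ennreal_le_iff) auto
qed

lemma square_integrable: "i < n \<Longrightarrow> integrable (\<nu> i) (\<lambda>x. x\<^sup>2)"
proof -
  assume i: "i < n"
  have "norm (x\<^sup>2) \<le> norm (exp (\<beta> * x\<^sup>2) / \<beta>)" for x :: real
  proof -
    have "\<beta> * x\<^sup>2 \<le> exp (\<beta> * x\<^sup>2)" using exp_ge_add_one_self[of "\<beta> * x\<^sup>2"] by linarith
    then show ?thesis using \<beta> by (simp add: pos_le_divide_eq mult.commute)
  qed
  then show ?thesis using exp_square_integrable[OF i]
    by (intro Bochner_Integration.integrable_bound[of "\<nu> i" "\<lambda>x. exp (\<beta> * x\<^sup>2) / \<beta>" "\<lambda>x. x\<^sup>2"]
        integrable_divide AE_I2) simp_all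
qed

lemma integrable_id: "i < n \<Longrightarrow> integrable (\<nu> i) (\<lambda>x. x)"
proof -
  assume i: "i < n"
  have "\<bar>x\<bar> \<le> 1 + x\<^sup>2" for x :: real
  proof -
    have "0 \<le> (\<bar>x\<bar> - 1)\<^sup>2" by simp
    then have "2 * \<bar>x\<bar> \<le> 1 + x\<^sup>2" by (simp add: power2_eq_square algebra_simps)
    then show ?thesis by linarith
  qed
  then have "norm x \<le> norm (1 + x\<^sup>2)" for x :: real by (metis abs_ge_self order_trans real_norm_def)
  then show ?thesis using square_integrable[OF i]
    by (intro Bochner_Integration.integrable_bound[of "\<nu> i" "\<lambda>x. 1 + x\<^sup>2" "\<lambda>x. x"] AE_I2) simp_all
qed

lemma variance_le: "i < n \<Longrightarrow> \<beta> * \<sigma>\<^sup>2 \<le> 1"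
proof -
  assume i: "i < n"
  have "1 + \<beta> * \<sigma>\<^sup>2 = (\<integral>x. 1 + \<beta> * x\<^sup>2 \<partial>\<nu> i)"
    using square_integrable[OF i] var[OF i] by (simp)
  also have "\<dots> \<le> (\<integral>x. exp (\<beta> * x\<^sup>2) \<partial>\<nu> i)"
    using square_integrable[OF i] exp_square_integrable[OF i] by (intro integral_mono) auto
  finally show ?thesis using exp_square_expectation[OF i] by simp
qed

text \<open>The variance proxy is 3/\<beta>. Small \<theta> needs centring, so that the bound tends
  to 1 at \<theta> = 0. For large \<theta> a constant factor is affordable and Young's inequality
  suffices; there the exponents \<theta>^2/(2\<beta>) and \<theta>^2/\<beta> add up to the stated
  one.\<close>

lemma mgf: "i < n \<Longrightarrow> (\<integral>\<^sup>+x. ennreal (exp (\<theta> * x)) \<partial>\<nu> i) \<le> ennreal (exp (3 / \<beta> / 2 * \<theta>\<^sup>2))"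
proof -
  assume i: "i < n"
  show ?thesis
  proof (cases "\<theta>\<^sup>2 \<le> \<beta>")
    case True
    \<comment> \<open>This choice gives (\<theta> x)^2 = p \<beta> x^2 with p \<le> 1, so convexity
      reduces to \<open>exp (\<beta> * x\<^sup>2)\<close>, and the mean is at most 1 + p.\<close>
    define p where "p = \<theta>\<^sup>2 / \<beta>"
    have p: "0 \<le> p" "p \<le> 1" "\<theta>\<^sup>2 = p * \<beta>" using True \<beta> by (auto simp: p_def)
    have bd: "exp (\<theta> * x) \<le> \<theta> * x + (1 - p + p * exp (\<beta> * x\<^sup>2))" for x
      using exp_le_add_exp_square[of "\<theta> * x"] exp_convex_le[OF p(1,2), of "\<beta> * x\<^sup>2"]
      by (simp add: power_mult_distrib p(3) mult.assoc)
    have "(\<integral>\<^sup>+x. ennreal (exp (\<theta> * x)) \<partial>\<nu> i) \<le> (\<integral>\<^sup>+x. ennreal (\<theta> * x + (1 - p + p * exp (\<beta> * x\<^sup>2))) \<partial>\<nu> i)"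
      by (intro nn_integral_mono ennreal_leI bd)
    also have "\<dots> = ennreal (\<integral>x. \<theta> * x + (1 - p + p * exp (\<beta> * x\<^sup>2)) \<partial>\<nu> i)"
      using integrable_id[OF i] exp_square_integrable[OF i]
      by (intro nn_integral_eq_integral AE_I2) (auto intro: order_trans[OF _ bd])
    also have "(\<integral>x. \<theta> * x + (1 - p + p * exp (\<beta> * x\<^sup>2)) \<partial>\<nu> i) = 1 - p + p * (\<integral>x. exp (\<beta> * x\<^sup>2) \<partial>\<nu> i)"
      using integrable_id[OF i] exp_square_integrable[OF i] mean[OF i] by (simp)
    also have "\<dots> \<le> 1 - p + p * 2"
      using exp_square_expectation[OF i] p by (intro add_left_mono mult_left_mono) auto
    also have "1 - p + p * 2 \<le> exp (3 / \<beta> / 2 * \<theta>\<^sup>2)"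
    proof -
      have "1 - p + p * 2 \<le> exp p" using exp_ge_add_one_self[of p] by linarith
      also have "\<dots> \<le> exp (3 / \<beta> / 2 * \<theta>\<^sup>2)" using p \<beta> by simp
      finally show ?thesis .
    qed
    finally show ?thesis by (simp add: ennreal_leI)
  next
    case False
    have bd: "exp (\<theta> * x) \<le> exp (\<theta>\<^sup>2 / (2 * \<beta>)) * (1 / 2 + 1 / 2 * exp (\<beta> * x\<^sup>2))" for x
    proof -
      have "\<theta> * x \<le> \<theta>\<^sup>2 / (2 * \<beta>) + 1 / 2 * (\<beta> * x\<^sup>2)" by (rule linear_le_squares[OF \<beta>])
      then have "exp (\<theta> * x) \<le> exp (\<theta>\<^sup>2 / (2 * \<beta>)) * exp (1 / 2 * (\<beta> * x\<^sup>2))"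
        by (simp only: exp_le_cancel_iff flip: exp_add)
      also have "\<dots> \<le> exp (\<theta>\<^sup>2 / (2 * \<beta>)) * (1 / 2 + 1 / 2 * exp (\<beta> * x\<^sup>2))"
        using exp_convex_le[of "1 / 2" "\<beta> * x\<^sup>2"] by (intro mult_left_mono) auto
      finally show ?thesis .
    qed
    have "(\<integral>\<^sup>+x. ennreal (exp (\<theta> * x)) \<partial>\<nu> i) \<le> (\<integral>\<^sup>+x. ennreal (exp (\<theta>\<^sup>2 / (2 * \<beta>)) * (1 / 2 + 1 / 2 * exp (\<beta> * x\<^sup>2))) \<partial>\<nu> i)"
      by (intro nn_integral_mono ennreal_leI bd)
    also have "\<dots> = ennreal (\<integral>x. exp (\<theta>\<^sup>2 / (2 * \<beta>)) * (1 / 2 + 1 / 2 * exp (\<beta> * x\<^sup>2)) \<partial>\<nu> i)"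
      using exp_square_integrable[OF i]
      by (intro nn_integral_eq_integral AE_I2) auto
    also have "(\<integral>x. exp (\<theta>\<^sup>2 / (2 * \<beta>)) * (1 / 2 + 1 / 2 * exp (\<beta> * x\<^sup>2)) \<partial>\<nu> i)
        = exp (\<theta>\<^sup>2 / (2 * \<beta>)) * (1 / 2 + 1 / 2 * (\<integral>x. exp (\<beta> * x\<^sup>2) \<partial>\<nu> i))"
      using exp_square_integrable[OF i] by simp
    also have "\<dots> \<le> exp (\<theta>\<^sup>2 / (2 * \<beta>)) * exp (\<theta>\<^sup>2 / \<beta>)"
    proof (intro mult_left_mono)
      \<comment> \<open>The averaged factor is at most 3/2, hence below 1 + \<theta>^2/\<beta>,
        which exceeds 2 in this regime.\<close>
      have "1 < \<theta>\<^sup>2 / \<beta>" using False \<beta> by simp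
      then show "1 / 2 + 1 / 2 * (\<integral>x. exp (\<beta> * x\<^sup>2) \<partial>\<nu> i) \<le> exp (\<theta>\<^sup>2 / \<beta>)"
        using exp_square_expectation[OF i] exp_ge_add_one_self[of "\<theta>\<^sup>2 / \<beta>"] by linarith
    qed auto
    also have "\<dots> = exp (3 / \<beta> / 2 * \<theta>\<^sup>2)"
    proof -
      have "3 / \<beta> / 2 * \<theta>\<^sup>2 = 3 / 2 * (\<theta>\<^sup>2 / \<beta>)" "\<theta>\<^sup>2 / (2 * \<beta>) = 1 / 2 * (\<theta>\<^sup>2 / \<beta>)"
        by simp_all
      then have "\<theta>\<^sup>2 / (2 * \<beta>) + \<theta>\<^sup>2 / \<beta> = 3 / \<beta> / 2 * \<theta>\<^sup>2" by linarith
      then show ?thesis by (simp only: flip: exp_add)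
    qed
    finally show ?thesis by (simp add: ennreal_leI)
  qed
qed

text \<open>Put z = \<beta> |x^2 - \<sigma>^2|. The restriction on \<open>s\<close> spends only half
  of exp(z) on the remainder of the expansion; the other half pays for z^2 \<le> 8 exp(z/2). Since
  \<beta> \<sigma>^2 \<le> 1, exp(z) is at most 3 exp(\<beta> x^2), of mean at most 6, and 8 * 6 =
  48.\<close>

lemma square_mgf:
  assumes i: "i < n" and s: "\<bar>s\<bar> \<le> \<beta> / 2"
  shows "(\<integral>\<^sup>+x. ennreal (exp (s * (x\<^sup>2 - \<sigma>\<^sup>2))) \<partial>\<nu> i) \<le> ennreal (exp (48 * (s / \<beta>)\<^sup>2))"
proof -
  define r where "r = (s / \<beta>)\<^sup>2"
  have r: "0 \<le> r" by (simp add: r_def)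
  have bd: "exp (s * (x\<^sup>2 - \<sigma>\<^sup>2)) \<le> 1 + s * (x\<^sup>2 - \<sigma>\<^sup>2) + r * (24 * exp (\<beta> * x\<^sup>2))" for x
  proof -
    define z where "z = \<beta> * \<bar>x\<^sup>2 - \<sigma>\<^sup>2\<bar>"
    have z: "0 \<le> z" using \<beta> by (simp add: z_def)
    have "\<bar>s * (x\<^sup>2 - \<sigma>\<^sup>2)\<bar> \<le> (\<beta> / 2) * \<bar>x\<^sup>2 - \<sigma>\<^sup>2\<bar>"
      unfolding abs_mult using s by (intro mult_right_mono) auto
    then have "exp \<bar>s * (x\<^sup>2 - \<sigma>\<^sup>2)\<bar> \<le> exp (z / 2)" by (simp add: z_def)
    moreover have "(s * (x\<^sup>2 - \<sigma>\<^sup>2))\<^sup>2 = r * z\<^sup>2"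
      using \<beta> by (simp add: r_def z_def power_mult_distrib power_divide)
    ultimately have "(s * (x\<^sup>2 - \<sigma>\<^sup>2))\<^sup>2 * exp \<bar>s * (x\<^sup>2 - \<sigma>\<^sup>2)\<bar> \<le> (r * z\<^sup>2) * exp (z / 2)"
      using r by (auto intro!: mult_left_mono)
    also have "\<dots> \<le> r * ((8 * exp (z / 2)) * exp (z / 2))"
      using square_le_exp_half[OF z] r by (simp only: mult.assoc) (intro mult_left_mono mult_right_mono, auto)
    also have "\<dots> = r * (8 * exp z)" by (simp flip: exp_add)
    also have "\<dots> \<le> r * (8 * (3 * exp (\<beta> * x\<^sup>2)))"
    proof (intro mult_left_mono r)
      have "\<bar>x\<^sup>2 - \<sigma>\<^sup>2\<bar> \<le> \<sigma>\<^sup>2 + x\<^sup>2" by (simp add: abs_le_iff)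
      then have "z \<le> \<beta> * (\<sigma>\<^sup>2 + x\<^sup>2)" unfolding z_def using \<beta> by (intro mult_left_mono) auto
      also have "\<dots> \<le> 1 + \<beta> * x\<^sup>2" using variance_le[OF i] by (simp add: algebra_simps)
      finally have "exp z \<le> exp 1 * exp (\<beta> * x\<^sup>2)" by (simp flip: exp_add)
      also have "\<dots> \<le> 3 * exp (\<beta> * x\<^sup>2)" using exp_le by (intro mult_right_mono) auto
      finally show "exp z \<le> 3 * exp (\<beta> * x\<^sup>2)" .
    qed auto
    finally show ?thesis using exp_le_quadratic_exp[of "s * (x\<^sup>2 - \<sigma>\<^sup>2)"] by simp
  qed
  have int: "integrable (\<nu> i) (\<lambda>x. 1 + s * (x\<^sup>2 - \<sigma>\<^sup>2) + r * (24 * exp (\<beta> * x\<^sup>2)))"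
    using square_integrable[OF i] exp_square_integrable[OF i] by auto
  have "(\<integral>\<^sup>+x. ennreal (exp (s * (x\<^sup>2 - \<sigma>\<^sup>2))) \<partial>\<nu> i)
      \<le> (\<integral>\<^sup>+x. ennreal (1 + s * (x\<^sup>2 - \<sigma>\<^sup>2) + r * (24 * exp (\<beta> * x\<^sup>2))) \<partial>\<nu> i)"
    by (intro nn_integral_mono ennreal_leI bd)
  also have "\<dots> = ennreal (\<integral>x. 1 + s * (x\<^sup>2 - \<sigma>\<^sup>2) + r * (24 * exp (\<beta> * x\<^sup>2)) \<partial>\<nu> i)"
    by (intro nn_integral_eq_integral AE_I2 int) (auto intro: order_trans[OF _ bd])
  also have "(\<integral>x. 1 + s * (x\<^sup>2 - \<sigma>\<^sup>2) + r * (24 * exp (\<beta> * x\<^sup>2)) \<partial>\<nu> i)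
      = 1 + r * (24 * (\<integral>x. exp (\<beta> * x\<^sup>2) \<partial>\<nu> i))"
    using square_integrable[OF i] exp_square_integrable[OF i] var[OF i] by (simp)
  also have "\<dots> \<le> 1 + r * (24 * 2)"
    using exp_square_expectation[OF i] r by (intro add_left_mono mult_left_mono) auto
  also have "\<dots> \<le> exp (48 * r)" using exp_ge_add_one_self[of "48 * r"] by linarith
  finally show ?thesis by (simp add: ennreal_leI r_def)
qed

lemma nn_integral_prod_le:
  assumes "finite I" "\<And>i. i \<in> I \<Longrightarrow> h i \<in> borel_measurable borel"
    "\<And>i. i \<in> I \<Longrightarrow> (\<integral>\<^sup>+x. ennreal (exp (h i x)) \<partial>\<nu> i) \<le> ennreal (exp (b i))"
  shows "(\<integral>\<^sup>+x. ennreal (exp (\<Sum>i\<in>I. h i (x i))) \<partial>Pi\<^sub>M I \<nu>) \<le> ennreal (exp (\<Sum>i\<in>I. b i))"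
proof -
  have "(\<integral>\<^sup>+x. ennreal (exp (\<Sum>i\<in>I. h i (x i))) \<partial>Pi\<^sub>M I \<nu>)
      = (\<integral>\<^sup>+x. (\<Prod>i\<in>I. ennreal (exp (h i (x i)))) \<partial>Pi\<^sub>M I \<nu>)"
    using assms(1) by (simp add: exp_sum prod_ennreal)
  also have "\<dots> = (\<Prod>i\<in>I. \<integral>\<^sup>+x. ennreal (exp (h i x)) \<partial>\<nu> i)"
    using assms by (intro product_nn_integral_prod) auto
  also have "\<dots> \<le> (\<Prod>i\<in>I. ennreal (exp (b i)))"
    using assms(1,3) by (induction I rule: finite_induct) (auto intro!: mult_mono)
  also have "\<dots> = ennreal (exp (\<Sum>i\<in>I. b i))"
    using assms(1) by (simp add: exp_sum prod_ennreal)
  finally show ?thesis .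
qed

lemma linear_mgf:
  assumes "I \<subseteq> {..<n}"
  shows "(\<integral>\<^sup>+x. ennreal (exp (\<Sum>i\<in>I. v i * x i)) \<partial>Pi\<^sub>M I \<nu>) \<le> ennreal (exp (3 / \<beta> / 2 * (\<Sum>i\<in>I. (v i)\<^sup>2)))"
proof -
  have "(\<integral>\<^sup>+x. ennreal (exp (\<Sum>i\<in>I. v i * x i)) \<partial>Pi\<^sub>M I \<nu>) \<le> ennreal (exp (\<Sum>i\<in>I. 3 / \<beta> / 2 * (v i)\<^sup>2))"
    using assms by (intro nn_integral_prod_le mgf) (auto intro: finite_subset)
  then show ?thesis by (simp only: sum_distrib_left)
qed

end

section \<open>Decoupling and diagonal terms\<close>

text \<open>Such a set is determined by its trace on the elements other than \<open>i\<close> and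
  \<open>l\<close>, so a quarter of all subsets qualify.\<close>

lemma card_separating_subsets:
  assumes "finite S" "i \<in> S" "l \<in> S" "i \<noteq> l"
  shows "4 * card {I \<in> Pow S. i \<in> I \<and> l \<notin> I} = 2 ^ card S"
proof -
  have "{I \<in> Pow S. i \<in> I \<and> l \<notin> I} = insert i ` Pow (S - {i, l})"
  proof (intro equalityI subsetI)
    fix I assume "I \<in> {I \<in> Pow S. i \<in> I \<and> l \<notin> I}"
    then have "I = insert i (I - {i})" "I - {i} \<in> Pow (S - {i, l})" by auto
    then show "I \<in> insert i ` Pow (S - {i, l})" by blast
  qed (use assms in auto)
  moreover have "inj_on (insert i) (Pow (S - {i, l}))"
    by (auto simp: inj_on_def)
  ultimately have "card {I \<in> Pow S. i \<in> I \<and> l \<notin> I} = 2 ^ card (S - {i, l})"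
    using assms(1) by (simp add: card_image card_Pow)
  moreover have "card S = Suc (Suc (card (S - {i, l})))"
    using assms card_mono[of S "{i, l}"] card_Diff_subset[of "{i, l}" S] by auto
  ultimately show ?thesis by simp
qed

text \<open>An ordered pair of distinct indices is separated by a quarter of the index sets, which
  explains the factor 4; a diagonal pair is never separated.\<close>

lemma offdiagonal_sum_as_average:
  fixes G :: "nat \<Rightarrow> nat \<Rightarrow> real"
  shows "(\<Sum>i<n. \<Sum>l\<in>{..<n} - {i}. G i l)
    = (\<Sum>I\<in>Pow {..<n}. (1 / 2 ^ n) * (4 * (\<Sum>i\<in>I. \<Sum>l\<in>{..<n} - I. G i l)))"
proof -
  have "(\<Sum>I\<in>Pow {..<n}. (\<Sum>i\<in>I. \<Sum>l\<in>{..<n} - I. G i l))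
      = (\<Sum>I\<in>Pow {..<n}. \<Sum>i<n. \<Sum>l<n. (if i \<in> I \<and> l \<notin> I then G i l else 0))"
  proof (rule sum.cong[OF refl])
    fix I assume "I \<in> Pow {..<n}"
    then have I: "I = {i\<in>{..<n}. i \<in> I}" "{..<n} - I = {l\<in>{..<n}. l \<notin> I}" by auto
    have "(\<Sum>l<n. (if i \<in> I \<and> l \<notin> I then G i l else 0)) = (if i \<in> I then \<Sum>l\<in>{..<n} - I. G i l else 0)" for i
      by (subst I(2), subst sum.inter_filter) (auto intro: sum.cong)
    then show "(\<Sum>i\<in>I. \<Sum>l\<in>{..<n} - I. G i l) = (\<Sum>i<n. \<Sum>l<n. (if i \<in> I \<and> l \<notin> I then G i l else 0))"
      by (subst I(1), subst sum.inter_filter) auto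
  qed
  also have "\<dots> = (\<Sum>i<n. \<Sum>I\<in>Pow {..<n}. \<Sum>l<n. (if i \<in> I \<and> l \<notin> I then G i l else 0))"
    by (rule sum.swap)
  also have "\<dots> = (\<Sum>i<n. \<Sum>l<n. \<Sum>I\<in>Pow {..<n}. (if i \<in> I \<and> l \<notin> I then G i l else 0))"
    by (rule sum.cong[OF refl], rule sum.swap)
  also have "\<dots> = (\<Sum>i<n. \<Sum>l<n. real (card {I \<in> Pow {..<n}. i \<in> I \<and> l \<notin> I}) * G i l)"
    by (intro sum.cong refl) (simp flip: sum.inter_filter)
  also have "\<dots> = (\<Sum>i<n. \<Sum>l<n. if l \<noteq> i then (2 ^ n / 4) * G i l else 0)"
  proof (intro sum.cong refl)
    fix i l assume il: "i \<in> {..<n}" "l \<in> {..<n}"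
    show "real (card {I \<in> Pow {..<n}. i \<in> I \<and> l \<notin> I}) * G i l = (if l \<noteq> i then (2 ^ n / 4) * G i l else 0)"
    proof (cases "l = i")
      case True
      then have "{I \<in> Pow {..<n}. i \<in> I \<and> l \<notin> I} = {}" by auto
      then show ?thesis using True by (simp only: card.empty) simp
    next
      case False
      define c where "c = card {I \<in> Pow {..<n}. i \<in> I \<and> l \<notin> I}"
      have "4 * c = 2 ^ n"
        using card_separating_subsets[of "{..<n}" i l] il False by (simp add: c_def)
      then have "real (4 * c) = real (2 ^ n)" by (rule arg_cong)
      then have "real c = 2 ^ n / 4" by simp
      then show ?thesis unfolding c_def[symmetric] using False by simp
    qed
  qed
  also have "\<dots> = (2 ^ n / 4) * (\<Sum>i<n. \<Sum>l\<in>{..<n} - {i}. G i l)"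
  proof -
    have "(\<Sum>l<n. if l \<noteq> i then (2 ^ n / 4) * G i l else 0) = (2 ^ n / 4) * (\<Sum>l\<in>{..<n} - {i}. G i l)" for i
    proof -
      have "{..<n} - {i} = {l\<in>{..<n}. l \<noteq> i}" by auto
      then show ?thesis by (simp only: sum.inter_filter[symmetric] finite_lessThan sum_distrib_left)
    qed
    then show ?thesis by (simp add: sum_distrib_left)
  qed
  finally have "(\<Sum>I\<in>Pow {..<n}. (\<Sum>i\<in>I. \<Sum>l\<in>{..<n} - I. G i l)) = (2 ^ n / 4) * (\<Sum>i<n. \<Sum>l\<in>{..<n} - {i}. G i l)" .
  moreover have "(\<Sum>I\<in>Pow {..<n}. (1 / 2 ^ n) * (4 * (\<Sum>i\<in>I. \<Sum>l\<in>{..<n} - I. G i l)))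
      = (1 / 2 ^ n) * (4 * (\<Sum>I\<in>Pow {..<n}. (\<Sum>i\<in>I. \<Sum>l\<in>{..<n} - I. G i l)))"
    by (simp only: sum_distrib_left)
  ultimately show ?thesis by (simp only:) simp
qed

lemma chernoff:
  assumes "prob_space N" and [measurable]: "Y \<in> borel_measurable N"
    and le: "(\<integral>\<^sup>+w. ennreal (exp (Y w)) \<partial>N) \<le> ennreal (exp c)"
  shows "measure N {w \<in> space N. c + u < Y w} \<le> exp (- u)"
proof -
  interpret prob_space N by fact
  have "emeasure N {w \<in> space N. c + u < Y w} = (\<integral>\<^sup>+w. indicator {w \<in> space N. c + u < Y w} w \<partial>N)"
    by simp
  also have "\<dots> \<le> (\<integral>\<^sup>+w. ennreal (exp (- (c + u))) * ennreal (exp (Y w)) \<partial>N)"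
  proof (intro nn_integral_mono)
    fix w
    have "1 \<le> exp (- (c + u)) * exp (Y w)" if "c + u < Y w" using that by (simp flip: exp_add)
    then show "indicator {w \<in> space N. c + u < Y w} w \<le> ennreal (exp (- (c + u))) * ennreal (exp (Y w))"
      by (auto simp: indicator_def simp flip: ennreal_mult)
  qed
  also have "\<dots> = ennreal (exp (- (c + u))) * (\<integral>\<^sup>+w. ennreal (exp (Y w)) \<partial>N)"
    by (simp add: nn_integral_cmult)
  also have "\<dots> \<le> ennreal (exp (- (c + u))) * ennreal (exp c)"
    by (intro mult_left_mono le) auto
  also have "\<dots> = ennreal (exp (- u))"
    by (simp flip: ennreal_mult exp_add)
  finally show ?thesis by (simp add: emeasure_eq_measure)
qed

context noise_model
begin

lemma integrable_product_pair:
  assumes "i < n" "l < n"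
  shows "integrable PN (\<lambda>x. x i * x l)"
    and "(\<integral>x. x i * x l \<partial>PN) = (if i = l then \<sigma>\<^sup>2 else 0)"
proof -
  \<comment> \<open>One family of factors covers both cases: for \<open>i = l\<close> the two
    factors meet in one coordinate and give a square, otherwise they sit in two independent
    coordinates.\<close>
  define h :: "nat \<Rightarrow> real \<Rightarrow> real" where "h m y = (if m = i then y else 1) * (if m = l then y else 1)" for m y
  have prod: "x i * x l = (\<Prod>m<n. h m (x m))" for x
    using assms by (simp add: h_def prod.distrib)
  have int: "integrable (\<nu> m) (h m)" if "m \<in> {..<n}" for m
    using integrable_id[of m] square_integrable[of m] that
    by (cases "m = i"; cases "m = l") (simp_all add: h_def[abs_def] power2_eq_square)
  show "integrable PN (\<lambda>x. x i * x l)"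
    unfolding prod by (intro product_integrable_prod int) auto
  have "(\<integral>x. x i * x l \<partial>PN) = (\<Prod>m<n. \<integral>y. h m y \<partial>\<nu> m)"
    unfolding prod by (intro product_integral_prod int) auto
  also have "\<dots> = (if i = l then \<sigma>\<^sup>2 else 0)"
  proof (cases "i = l")
    case True
    have "(\<integral>y. h m y \<partial>\<nu> m) = (if m = l then \<sigma>\<^sup>2 else 1)" if "m \<in> {..<n}" for m
      using var[of l] that True by (cases "m = l") (auto simp: h_def power2_eq_square)
    then have "(\<Prod>m<n. \<integral>y. h m y \<partial>\<nu> m) = (\<Prod>m<n. if m = l then \<sigma>\<^sup>2 else 1)"
      by (intro prod.cong) auto
    then show ?thesis using True assms by simp
  next
    case False
    then have "(\<integral>y. h i y \<partial>\<nu> i) = 0" using mean assms by (simp add: h_def)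
    then show ?thesis using False assms by (auto intro!: prod_zero)
  qed
  finally show "(\<integral>x. x i * x l \<partial>PN) = (if i = l then \<sigma>\<^sup>2 else 0)" .
qed

lemma linear_form_expectation:
  shows "integrable PN (\<lambda>x. \<Sum>i<n. v i * x i)"
    and "(\<integral>x. (\<Sum>i<n. v i * x i) \<partial>PN) = 0"
proof -
  have *: "integrable PN (\<lambda>x. x i) \<and> (\<integral>x. x i \<partial>PN) = 0" if "i < n" for i
  proof -
    define h :: "nat \<Rightarrow> real \<Rightarrow> real" where "h m y = (if m = i then y else 1)" for m y
    have prod: "x i = (\<Prod>m<n. h m (x m))" for x
      using that by (simp add: h_def)
    have int: "integrable (\<nu> m) (h m)" if "m \<in> {..<n}" for m
      using integrable_id[of m] that by (cases "m = i") (simp_all add: h_def[abs_def])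
    have "(\<integral>y. h i y \<partial>\<nu> i) = 0" using mean that by (simp add: h_def)
    then have "(\<Prod>m<n. \<integral>y. h m y \<partial>\<nu> m) = 0" using that by (auto intro!: prod_zero)
    moreover have "(\<integral>x. x i \<partial>PN) = (\<Prod>m<n. \<integral>y. h m y \<partial>\<nu> m)"
      unfolding prod by (intro product_integral_prod int) auto
    moreover have "integrable PN (\<lambda>x. x i)"
      unfolding prod by (intro product_integrable_prod int) auto
    ultimately show ?thesis by simp
  qed
  show "integrable PN (\<lambda>x. \<Sum>i<n. v i * x i)" using * by auto
  show "(\<integral>x. (\<Sum>i<n. v i * x i) \<partial>PN) = 0"
    using * by (subst Bochner_Integration.integral_sum) auto
qed

lemma linear_form_variance:
  shows "integrable PN (\<lambda>x. (\<Sum>i<n. v i * x i)\<^sup>2)"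
    and "(\<integral>x. (\<Sum>i<n. v i * x i)\<^sup>2 \<partial>PN) = \<sigma>\<^sup>2 * (\<Sum>i<n. (v i)\<^sup>2)"
proof -
  have sq: "(\<Sum>i<n. v i * x i)\<^sup>2 = (\<Sum>i<n. \<Sum>l<n. (v i * v l) * (x i * x l))" for x :: "nat \<Rightarrow> real"
    by (simp add: power2_eq_square sum_product mult_ac)
  show "integrable PN (\<lambda>x. (\<Sum>i<n. v i * x i)\<^sup>2)"
    unfolding sq by (intro Bochner_Integration.integrable_sum integrable_mult_right integrable_product_pair(1)) auto
  have "(\<integral>x. (\<Sum>i<n. v i * x i)\<^sup>2 \<partial>PN) = (\<Sum>i<n. \<Sum>l<n. (v i * v l) * (if i = l then \<sigma>\<^sup>2 else 0))"
  proof -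
    have 1: "integrable PN (\<lambda>x. (v i * v l) * (x i * x l))" if "i < n" "l < n" for i l
      by (intro integrable_mult_right integrable_product_pair(1) that)
    have 2: "(\<integral>x. (\<Sum>l<n. (v i * v l) * (x i * x l)) \<partial>PN) = (\<Sum>l<n. (v i * v l) * (if i = l then \<sigma>\<^sup>2 else 0))"
      if "i < n" for i
    proof (subst Bochner_Integration.integral_sum)
      show "(\<Sum>l<n. \<integral>x. (v i * v l) * (x i * x l) \<partial>PN) = (\<Sum>l<n. (v i * v l) * (if i = l then \<sigma>\<^sup>2 else 0))"
        using integrable_product_pair(2)[OF that] by (intro sum.cong refl) simp
    qed (use 1 that in auto)
    show ?thesis unfolding sq
    proof (subst Bochner_Integration.integral_sum)
      show "(\<Sum>i<n. \<integral>x. (\<Sum>l<n. (v i * v l) * (x i * x l)) \<partial>PN) = (\<Sum>i<n. \<Sum>l<n. (v i * v l) * (if i = l then \<sigma>\<^sup>2 else 0))"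
        using 2 by (intro sum.cong refl) simp
    qed (use 1 in \<open>auto intro!: Bochner_Integration.integrable_sum\<close>)
  qed
  also have "\<dots> = (\<Sum>i<n. \<Sum>l<n. if i = l then \<sigma>\<^sup>2 * (v i)\<^sup>2 else 0)"
    by (intro sum.cong refl) (auto simp: power2_eq_square)
  also have "\<dots> = \<sigma>\<^sup>2 * (\<Sum>i<n. (v i)\<^sup>2)" by (simp add: sum_distrib_left)
  finally show "(\<integral>x. (\<Sum>i<n. v i * x i)\<^sup>2 \<partial>PN) = \<sigma>\<^sup>2 * (\<Sum>i<n. (v i)\<^sup>2)" .
qed

lemma component_measurable: "i \<in> I \<Longrightarrow> (\<lambda>x. x i) \<in> borel_measurable (Pi\<^sub>M I \<nu>)"
  using measurable_component_singleton[of i I \<nu>] by (simp add: measurable_cong_sets[OF refl sets_\<nu>])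

text \<open>
  Decoupling: the off-diagonal sum is the average over index sets \<open>I\<close> of four times its part with
  row index in \<open>I\<close> and column index outside. By convexity it suffices to treat each \<open>I\<close>,
  and there the noise in \<open>I\<close> enters linearly once the noise outside is fixed.
\<close>

lemma offdiagonal_mgf:
  fixes u :: "nat \<Rightarrow> nat \<Rightarrow> real"
  assumes on: "\<forall>j<n. \<forall>l<n. (\<Sum>i<n. u j i * u l i) = of_bool (j = l)"
    and s: "32 * (3 / \<beta>)\<^sup>2 * s\<^sup>2 \<le> 1"
    and a: "\<And>j. j < n \<Longrightarrow> 0 \<le> a j" "\<And>j. j < n \<Longrightarrow> a j \<le> 1"
    and A: "\<And>i l. A i l = (\<Sum>j<n. a j * (u j i * u j l))"
  shows "(\<integral>\<^sup>+x. ennreal (exp (s * (\<Sum>i<n. \<Sum>l\<in>{..<n} - {i}. A i l * (x i * x l)))) \<partial>PN)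
    \<le> ennreal (exp (16 * (3 / \<beta>)\<^sup>2 * s\<^sup>2 * (\<Sum>j<n. (a j)\<^sup>2)))"
proof -
  define K where "K = 3 / \<beta>"
  have K: "0 \<le> K" using \<beta> by (simp add: K_def)
  define q where "q I x = (\<Sum>i\<in>I. \<Sum>l\<in>{..<n} - I. A i l * (x i * x l))" for I and x :: "nat \<Rightarrow> real"
  define bnd where "bnd = exp (16 * K\<^sup>2 * s\<^sup>2 * (\<Sum>j<n. (a j)\<^sup>2))"
  have [measurable]: "(\<lambda>x. x i) \<in> borel_measurable (Pi\<^sub>M I \<nu>)" if "i \<in> I" for i I
    using that by (rule component_measurable)
  have qm [measurable]: "q I \<in> borel_measurable PN" if "I \<subseteq> {..<n}" for I
    unfolding q_def using that by (intro borel_measurable_sum borel_measurable_times borel_measurable_const component_measurable) auto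
  have jensen: "exp (s * (\<Sum>i<n. \<Sum>l\<in>{..<n} - {i}. A i l * (x i * x l)))
      \<le> (\<Sum>I\<in>Pow {..<n}. (1 / 2 ^ n) * exp (4 * s * q I x))" for x
  proof -
    have "s * (\<Sum>i<n. \<Sum>l\<in>{..<n} - {i}. A i l * (x i * x l)) = (\<Sum>I\<in>Pow {..<n}. (1 / 2 ^ n) *\<^sub>R (4 * s * q I x))"
      by (subst offdiagonal_sum_as_average) (simp add: q_def sum_distrib_left mult_ac)
    moreover have "exp (\<Sum>I\<in>Pow {..<n}. (1 / 2 ^ n) *\<^sub>R (4 * s * q I x))
        \<le> (\<Sum>I\<in>Pow {..<n}. (1 / 2 ^ n) * exp (4 * s * q I x))"
      by (rule convex_on_sum[OF _ _ exp_convex]) (auto simp: card_Pow)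
    ultimately show ?thesis by simp
  qed
  have block: "(\<integral>\<^sup>+x. ennreal (exp (4 * s * q I x)) \<partial>PN) \<le> ennreal bnd" if I: "I \<subseteq> {..<n}" for I
  proof -
    define J where "J = {..<n} - I"
    have IJ: "J \<inter> I = {}" "J \<union> I = {..<n}" "finite I" "finite J"
      using I by (auto simp: J_def intro: finite_subset)
    define w where "w x i = 4 * s * (\<Sum>l\<in>J. A i l * x l)" for x :: "nat \<Rightarrow> real" and i
    \<comment> \<open>Noise outside \<open>I\<close>, padded with zeros to length \<open>n\<close>,
      so that the quadratic form bound for the full orthonormal basis applies.\<close>
    define Z where "Z x i = (if i \<in> J then x i else 0)" for x :: "nat \<Rightarrow> real" and i
    \<comment> \<open>Integrating out the noise in \<open>I\<close> leaves K/2 times the squared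
      norm of \<open>w x\<close>; Parseval gives this norm the coefficients 16 s^2 a_j^2. So c_j/2
      is the resulting coefficient.\<close>
    define c where "c j = 16 * K * s\<^sup>2 * (a j)\<^sup>2" for j
    have Zm: "(\<lambda>x. Z x i) \<in> borel_measurable (Pi\<^sub>M J \<nu>)" for i
      unfolding Z_def by (cases "i \<in> J") (auto intro: component_measurable)
    have "sigma_finite_measure (Pi\<^sub>M J \<nu>)"
      using prob_space_PiM[OF prob, of J] by (rule prob_space_imp_sigma_finite)
    have lin: "(\<integral>\<^sup>+x. ennreal (exp (\<Sum>i<n. v i * Z x i)) \<partial>Pi\<^sub>M J \<nu>) \<le> ennreal (exp (K / 2 * (\<Sum>i<n. (v i)\<^sup>2)))" for v
    proof -
      have "(\<Sum>i<n. v i * Z x i) = (\<Sum>i\<in>J. v i * x i)" for x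
        unfolding Z_def J_def by (intro sum.mono_neutral_cong_right) auto
      moreover have "(\<Sum>i\<in>J. (v i)\<^sup>2) \<le> (\<Sum>i<n. (v i)\<^sup>2)"
        by (intro sum_mono2) (auto simp: J_def)
      then have "exp (K / 2 * (\<Sum>i\<in>J. (v i)\<^sup>2)) \<le> exp (K / 2 * (\<Sum>i<n. (v i)\<^sup>2))"
        using K by (simp add: mult_left_mono)
      ultimately show ?thesis
        using linear_mgf[of J v] unfolding K_def[symmetric] by (auto simp: J_def intro: order_trans[OF _ ennreal_leI])
    qed
    have parseval: "(\<Sum>i<n. (w x i)\<^sup>2) = 16 * s\<^sup>2 * (\<Sum>j<n. (a j)\<^sup>2 * (\<Sum>i<n. u j i * Z x i)\<^sup>2)" for x
    proof -
      define z where "z j = a j * (\<Sum>i<n. u j i * Z x i)" for j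
      have wz: "w x i = 4 * s * (\<Sum>j<n. z j * u j i)" for i
      proof -
        have "(\<Sum>l\<in>J. A i l * x l) = (\<Sum>l<n. A i l * Z x l)"
          unfolding Z_def J_def by (intro sum.mono_neutral_cong_left) auto
        also have "\<dots> = (\<Sum>l<n. \<Sum>j<n. a j * (u j i * u j l) * Z x l)"
          unfolding A by (simp add: sum_distrib_right)
        also have "\<dots> = (\<Sum>j<n. \<Sum>l<n. a j * (u j i * u j l) * Z x l)" by (rule sum.swap)
        also have "\<dots> = (\<Sum>j<n. z j * u j i)"
          by (simp add: z_def sum_distrib_left sum_distrib_right mult_ac)
        finally show ?thesis by (simp add: w_def)
      qed
      have "(\<Sum>i<n. (\<Sum>j<n. z j * u j i)\<^sup>2) = (\<Sum>j<n. (z j)\<^sup>2)"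
        by (rule orthonormal_sum_squares[OF on])
      then have "(\<Sum>i<n. (w x i)\<^sup>2) = 16 * s\<^sup>2 * (\<Sum>j<n. (z j)\<^sup>2)"
        unfolding wz power_mult_distrib by (simp flip: sum_distrib_left)
      then show ?thesis by (simp add: z_def power_mult_distrib)
    qed
    have inner: "(\<integral>\<^sup>+y. ennreal (exp (4 * s * q I (merge J I (x, y)))) \<partial>Pi\<^sub>M I \<nu>)
        \<le> ennreal (exp ((\<Sum>j<n. c j * (\<Sum>i<n. u j i * Z x i)\<^sup>2) / 2 + (\<Sum>i<n. 0 * Z x i)))" for x
    proof -
      have "4 * s * q I (merge J I (x, y)) = (\<Sum>i\<in>I. w x i * y i)" for y
      proof -
        have "q I (merge J I (x, y)) = (\<Sum>i\<in>I. \<Sum>l\<in>J. A i l * (y i * x l))"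
          unfolding q_def J_def[symmetric] using IJ(1)
          by (intro sum.cong refl) (auto simp: merge_def)
        then show ?thesis by (simp add: w_def sum_distrib_left sum_distrib_right mult_ac)
      qed
      then have "(\<integral>\<^sup>+y. ennreal (exp (4 * s * q I (merge J I (x, y)))) \<partial>Pi\<^sub>M I \<nu>)
          \<le> ennreal (exp (K / 2 * (\<Sum>i\<in>I. (w x i)\<^sup>2)))"
        using linear_mgf[OF I, of "w x"] by (simp add: K_def)
      also have "\<dots> \<le> ennreal (exp (K / 2 * (\<Sum>i<n. (w x i)\<^sup>2)))"
        using K I by (intro ennreal_leI) (auto intro!: mult_left_mono sum_mono2)
      also have "K / 2 * (\<Sum>i<n. (w x i)\<^sup>2) = (\<Sum>j<n. c j * (\<Sum>i<n. u j i * Z x i)\<^sup>2) / 2 + (\<Sum>i<n. 0 * Z x i)"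
        unfolding parseval by (simp add: c_def sum_distrib_left mult_ac sum_divide_distrib)
      finally show ?thesis .
    qed
    have "(\<integral>\<^sup>+x. ennreal (exp (4 * s * q I x)) \<partial>PN)
        = (\<integral>\<^sup>+x. \<integral>\<^sup>+y. ennreal (exp (4 * s * q I (merge J I (x, y)))) \<partial>Pi\<^sub>M I \<nu> \<partial>Pi\<^sub>M J \<nu>)"
      using IJ I by (subst product_nn_integral_fold[symmetric]) auto
    also have "\<dots> \<le> (\<integral>\<^sup>+x. ennreal (exp ((\<Sum>j<n. c j * (\<Sum>i<n. u j i * Z x i)\<^sup>2) / 2 + (\<Sum>i<n. 0 * Z x i))) \<partial>Pi\<^sub>M J \<nu>)"
      by (intro nn_integral_mono inner)
    also have "\<dots> \<le> ennreal (exp (K * (\<Sum>j<n. c j) + K / 2 * ((\<Sum>i<n. (0::real)\<^sup>2) + (\<Sum>j<n. 2 * K * c j * (\<Sum>i<n. 0 * u j i)\<^sup>2))))"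
    proof (rule quadratic_form_mgf[OF \<open>sigma_finite_measure (Pi\<^sub>M J \<nu>)\<close> Zm K lin on])
      fix j assume j: "j < n"
      show "0 \<le> c j" using K by (simp add: c_def)
      have "(a j)\<^sup>2 \<le> 1" using a[OF j] by (simp add: power_le_one)
      then have "16 * K\<^sup>2 * s\<^sup>2 * (a j)\<^sup>2 \<le> 16 * K\<^sup>2 * s\<^sup>2 * 1" by (intro mult_left_mono) auto
      \<comment> \<open>The restriction on \<open>s\<close> is chosen so that K c_j \<le> 1/2
        whenever a_j \<le> 1.\<close>
      moreover have "16 * K\<^sup>2 * s\<^sup>2 \<le> 1 / 2" using s by (simp add: K_def)
      moreover have "K * c j = 16 * K\<^sup>2 * s\<^sup>2 * (a j)\<^sup>2" by (simp add: c_def power2_eq_square)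
      ultimately show "K * c j \<le> 1 / 2" by linarith
    qed auto
    also have "K * (\<Sum>j<n. c j) + K / 2 * ((\<Sum>i<n. (0::real)\<^sup>2) + (\<Sum>j<n. 2 * K * c j * (\<Sum>i<n. 0 * u j i)\<^sup>2))
        = 16 * K\<^sup>2 * s\<^sup>2 * (\<Sum>j<n. (a j)\<^sup>2)"
      by (simp add: c_def sum_distrib_left power2_eq_square mult_ac)
    finally show ?thesis by (simp add: bnd_def)
  qed
  have "(\<integral>\<^sup>+x. ennreal (exp (s * (\<Sum>i<n. \<Sum>l\<in>{..<n} - {i}. A i l * (x i * x l)))) \<partial>PN)
      \<le> (\<integral>\<^sup>+x. (\<Sum>I\<in>Pow {..<n}. ennreal (1 / 2 ^ n) * ennreal (exp (4 * s * q I x))) \<partial>PN)"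
  proof (intro nn_integral_mono)
    fix x
    have "ennreal (exp (s * (\<Sum>i<n. \<Sum>l\<in>{..<n} - {i}. A i l * (x i * x l)))) \<le> ennreal (\<Sum>I\<in>Pow {..<n}. (1 / 2 ^ n) * exp (4 * s * q I x))"
      by (intro ennreal_leI jensen)
    also have "\<dots> = (\<Sum>I\<in>Pow {..<n}. ennreal (1 / 2 ^ n) * ennreal (exp (4 * s * q I x)))"
    proof -
      have "(\<Sum>I\<in>Pow {..<n}. ennreal (1 / 2 ^ n) * ennreal (exp (4 * s * q I x)))
          = (\<Sum>I\<in>Pow {..<n}. ennreal ((1 / 2 ^ n) * exp (4 * s * q I x)))"
        by (intro sum.cong refl ennreal_mult[symmetric]) auto
      also have "\<dots> = ennreal (\<Sum>I\<in>Pow {..<n}. (1 / 2 ^ n) * exp (4 * s * q I x))"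
        by (intro sum_ennreal) auto
      finally show ?thesis ..
    qed
    finally show "ennreal (exp (s * (\<Sum>i<n. \<Sum>l\<in>{..<n} - {i}. A i l * (x i * x l)))) \<le> (\<Sum>I\<in>Pow {..<n}. ennreal (1 / 2 ^ n) * ennreal (exp (4 * s * q I x)))" .
  qed
  also have "\<dots> = (\<Sum>I\<in>Pow {..<n}. \<integral>\<^sup>+x. ennreal (1 / 2 ^ n) * ennreal (exp (4 * s * q I x)) \<partial>PN)"
    by (rule nn_integral_sum) simp
  also have "\<dots> = (\<Sum>I\<in>Pow {..<n}. ennreal (1 / 2 ^ n) * (\<integral>\<^sup>+x. ennreal (exp (4 * s * q I x)) \<partial>PN))"
    by (intro sum.cong refl nn_integral_cmult) simp
  also have "\<dots> \<le> (\<Sum>I\<in>Pow {..<n}. ennreal (1 / 2 ^ n) * ennreal bnd)"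
    by (intro sum_mono mult_left_mono block) auto
  also have "\<dots> = ennreal (\<Sum>I\<in>Pow {..<n}. (1 / 2 ^ n) * bnd)"
  proof -
    have "(\<Sum>I\<in>Pow {..<n}. ennreal (1 / 2 ^ n) * ennreal bnd) = (\<Sum>I\<in>Pow {..<n}. ennreal ((1 / 2 ^ n) * bnd))"
      by (intro sum.cong refl ennreal_mult[symmetric]) (auto simp: bnd_def)
    also have "\<dots> = ennreal (\<Sum>I\<in>Pow {..<n}. (1 / 2 ^ n) * bnd)"
      by (intro sum_ennreal) (auto simp: bnd_def)
    finally show ?thesis .
  qed
  also have "(\<Sum>I\<in>Pow {..<n}. (1 / 2 ^ n) * bnd) = bnd" by (simp add: card_Pow)
  finally show ?thesis by (simp add: bnd_def K_def)
qed

text \<open>The coordinates are independent, and d_i^2 \<le> d_i turns the sum of squares into the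
  trace.\<close>

lemma diagonal_mgf:
  assumes s: "\<bar>s\<bar> \<le> \<beta> / 2" and d: "\<And>i. i < n \<Longrightarrow> 0 \<le> d i" "\<And>i. i < n \<Longrightarrow> d i \<le> 1"
  shows "(\<integral>\<^sup>+x. ennreal (exp (s * (\<Sum>i<n. d i * ((x i)\<^sup>2 - \<sigma>\<^sup>2)))) \<partial>PN)
    \<le> ennreal (exp (48 * (s / \<beta>)\<^sup>2 * (\<Sum>i<n. d i)))"
proof -
  have "(\<integral>\<^sup>+x. ennreal (exp (\<Sum>i<n. s * d i * ((x i)\<^sup>2 - \<sigma>\<^sup>2))) \<partial>PN)
      \<le> ennreal (exp (\<Sum>i<n. 48 * (s * d i / \<beta>)\<^sup>2))"
  proof (intro nn_integral_prod_le square_mgf)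
    fix i assume "i \<in> {..<n}"
    then have i: "i < n" by simp
    then show "i < n" .
    have "\<bar>s * d i\<bar> \<le> \<bar>s\<bar> * 1" unfolding abs_mult using d[OF i] by (intro mult_left_mono) auto
    then show "\<bar>s * d i\<bar> \<le> \<beta> / 2" using s by simp
  qed auto
  also have "\<dots> \<le> ennreal (exp (48 * (s / \<beta>)\<^sup>2 * (\<Sum>i<n. d i)))"
  proof -
    have "48 * (s * d i / \<beta>)\<^sup>2 \<le> 48 * (s / \<beta>)\<^sup>2 * d i" if "i < n" for i
    proof -
      have "d i * d i \<le> d i * 1" using d[OF that] by (intro mult_left_mono) auto
      then have "(d i)\<^sup>2 \<le> d i" by (simp add: power2_eq_square)
      then have "48 * (s / \<beta>)\<^sup>2 * (d i)\<^sup>2 \<le> 48 * (s / \<beta>)\<^sup>2 * d i" by (intro mult_left_mono) auto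
      moreover have "48 * (s * d i / \<beta>)\<^sup>2 = 48 * (s / \<beta>)\<^sup>2 * (d i)\<^sup>2" by (simp add: power_mult_distrib power_divide)
      ultimately show ?thesis by linarith
    qed
    then have "(\<Sum>i<n. 48 * (s * d i / \<beta>)\<^sup>2) \<le> 48 * (s / \<beta>)\<^sup>2 * (\<Sum>i<n. d i)"
      unfolding sum_distrib_left by (intro sum_mono) auto
    then show ?thesis by (simp add: ennreal_leI)
  qed
  finally show ?thesis by (simp add: sum_distrib_left mult.assoc)
qed

end

section \<open>Tails of quadratic and linear forms\<close>

locale noise_model_basis = noise_model +
  fixes u :: "nat \<Rightarrow> nat \<Rightarrow> real"
  assumes on: "\<forall>j<n. \<forall>l<n. (\<Sum>i<n. u j i * u l i) = of_bool (j = l)"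
    and complete: "\<forall>i<n. \<forall>l<n. (\<Sum>j<n. u j i * u j l) = of_bool (i = l)"
begin

definition qform :: "(nat \<Rightarrow> real) \<Rightarrow> (nat \<Rightarrow> real) \<Rightarrow> real" where
  "qform a x = (\<Sum>j<n. a j * (\<Sum>i<n. u j i * x i)\<^sup>2)"

lemma qform_measurable: "qform a \<in> borel_measurable PN"
  unfolding qform_def
  by (intro borel_measurable_sum borel_measurable_times borel_measurable_const borel_measurable_power component_measurable) auto

text \<open>A Hanson-Wright inequality for exponential moments. The diagonal and off-diagonal parts
  are dependent; convexity bounds the exponential of their sum by the average of two exponentials,
  at the price of doubling \<open>s\<close>. The off-diagonal exponent is 16 * 9 * 4 = 576, the
  diagonal one 48 * 4 = 192. The range \<beta>/34 comes from 32 * 9 * 4 = 1152 < 34^2.\<close>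

lemma hanson_wright_mgf:
  assumes s: "\<bar>s\<bar> \<le> \<beta> / 34"
    and a: "\<And>j. j < n \<Longrightarrow> 0 \<le> a j" "\<And>j. j < n \<Longrightarrow> a j \<le> 1"
  shows "(\<integral>\<^sup>+x. ennreal (exp (s * (qform a x - \<sigma>\<^sup>2 * (\<Sum>j<n. a j)))) \<partial>PN)
    \<le> ennreal (exp (576 * (s / \<beta>)\<^sup>2 * (\<Sum>j<n. a j)))"
proof -
  define A where "A i l = (\<Sum>j<n. a j * (u j i * u j l))" for i l
  define off where "off x = (\<Sum>i<n. \<Sum>l\<in>{..<n} - {i}. A i l * (x i * x l))" for x :: "nat \<Rightarrow> real"
  define dia where "dia x = (\<Sum>i<n. A i i * ((x i)\<^sup>2 - \<sigma>\<^sup>2))" for x :: "nat \<Rightarrow> real"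
  define c where "c = 576 * (s / \<beta>)\<^sup>2 * (\<Sum>j<n. a j)"
  have diag_sum: "(\<Sum>i<n. A i i) = (\<Sum>j<n. a j)"
  proof -
    have "(\<Sum>i<n. A i i) = (\<Sum>j<n. \<Sum>i<n. a j * (u j i * u j i))" unfolding A_def by (rule sum.swap)
    also have "\<dots> = (\<Sum>j<n. a j)" using on by (simp flip: sum_distrib_left)
    finally show ?thesis .
  qed
  have diag_bounds: "0 \<le> A i i" "A i i \<le> 1" if "i < n" for i
  proof -
    show "0 \<le> A i i" unfolding A_def by (intro sum_nonneg mult_nonneg_nonneg[OF _ zero_le_square] a) simp
    have "A i i \<le> (\<Sum>j<n. 1 * (u j i * u j i))" unfolding A_def using a by (intro sum_mono mult_right_mono) auto
    then show "A i i \<le> 1" using complete that by simp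
  qed
  have decomp: "qform a x - \<sigma>\<^sup>2 * (\<Sum>j<n. a j) = dia x + off x" for x
  proof -
    have "qform a x = (\<Sum>j<n. \<Sum>i<n. \<Sum>l<n. a j * (u j i * u j l) * (x i * x l))"
      by (simp add: qform_def power2_eq_square sum_product sum_distrib_left mult_ac)
    also have "\<dots> = (\<Sum>i<n. \<Sum>j<n. \<Sum>l<n. a j * (u j i * u j l) * (x i * x l))" by (rule sum.swap)
    also have "\<dots> = (\<Sum>i<n. \<Sum>l<n. \<Sum>j<n. a j * (u j i * u j l) * (x i * x l))"
      by (rule sum.cong[OF refl], rule sum.swap)
    also have "\<dots> = (\<Sum>i<n. \<Sum>l<n. A i l * (x i * x l))" by (simp add: A_def sum_distrib_right)
    also have "\<dots> = (\<Sum>i<n. A i i * (x i * x i) + (\<Sum>l\<in>{..<n} - {i}. A i l * (x i * x l)))"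
      by (intro sum.cong refl sum.remove) auto
    also have "\<dots> = dia x + \<sigma>\<^sup>2 * (\<Sum>i<n. A i i) + off x"
      by (simp add: dia_def off_def sum.distrib sum_subtractf sum_distrib_left power2_eq_square algebra_simps)
    finally show ?thesis by (simp add: diag_sum)
  qed
  have "\<beta> / 34 \<le> \<beta> / 4" using \<beta> by simp
  have dia_mgf: "(\<integral>\<^sup>+x. ennreal (exp (2 * s * dia x)) \<partial>PN) \<le> ennreal (exp c)"
  proof -
    have "(\<integral>\<^sup>+x. ennreal (exp (2 * s * dia x)) \<partial>PN)
        \<le> ennreal (exp (48 * (2 * s / \<beta>)\<^sup>2 * (\<Sum>i<n. A i i)))"
      unfolding dia_def using s \<open>\<beta> / 34 \<le> \<beta> / 4\<close> diag_bounds by (intro diagonal_mgf) auto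
    also have "\<dots> \<le> ennreal (exp c)"
    proof -
      have "0 \<le> (s / \<beta>)\<^sup>2 * (\<Sum>j<n. a j)" using a by (intro mult_nonneg_nonneg sum_nonneg) auto
      then have "48 * (2 * s / \<beta>)\<^sup>2 * (\<Sum>i<n. A i i) \<le> c"
        by (simp add: c_def diag_sum power_mult_distrib power_divide)
      then show ?thesis by (simp add: ennreal_leI)
    qed
    finally show ?thesis .
  qed
  have off_mgf: "(\<integral>\<^sup>+x. ennreal (exp (2 * s * off x)) \<partial>PN) \<le> ennreal (exp c)"
  proof -
    have "\<bar>s / \<beta>\<bar> \<le> 1 / 34" using s \<beta> by (simp add: abs_divide field_simps)
    then have "\<bar>s / \<beta>\<bar>\<^sup>2 \<le> (1 / 34)\<^sup>2" by (intro power_mono) auto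
    then have "(s / \<beta>)\<^sup>2 \<le> (1 / 34)\<^sup>2" by (simp only: power2_abs)
    moreover have "(1 / 34 :: real)\<^sup>2 = 1 / 1156" by (simp add: power2_eq_square)
    ultimately have sb: "1156 * (s / \<beta>)\<^sup>2 \<le> 1" by linarith
    have "32 * (3 / \<beta>)\<^sup>2 * (2 * s)\<^sup>2 = 1152 * (s / \<beta>)\<^sup>2"
      by (simp add: power_mult_distrib power_divide)
    also have "\<dots> \<le> 1" using sb zero_le_power2[of "s / \<beta>"] by linarith
    finally have "32 * (3 / \<beta>)\<^sup>2 * (2 * s)\<^sup>2 \<le> 1" .
    then have "(\<integral>\<^sup>+x. ennreal (exp (2 * s * off x)) \<partial>PN)
        \<le> ennreal (exp (16 * (3 / \<beta>)\<^sup>2 * (2 * s)\<^sup>2 * (\<Sum>j<n. (a j)\<^sup>2)))"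
      unfolding off_def using a by (intro offdiagonal_mgf[OF on]) (auto simp: A_def)
    also have "\<dots> \<le> ennreal (exp c)"
    proof -
      have "(\<Sum>j<n. (a j)\<^sup>2) \<le> (\<Sum>j<n. a j)"
        using a by (intro sum_mono) (auto simp: power2_eq_square mult_left_le)
      then have "576 * (s / \<beta>)\<^sup>2 * (\<Sum>j<n. (a j)\<^sup>2) \<le> c"
        unfolding c_def by (intro mult_left_mono) auto
      then show ?thesis by (simp add: ennreal_leI power_mult_distrib power_divide)
    qed
    finally show ?thesis .
  qed
  have m: "(\<lambda>x. x i) \<in> borel_measurable PN" if "i < n" for i
    using that by (intro component_measurable) auto
  have [measurable]: "dia \<in> borel_measurable PN" "off \<in> borel_measurable PN"
    unfolding dia_def off_def
    by (intro borel_measurable_sum borel_measurable_times borel_measurable_diff borel_measurable_const borel_measurable_power m; simp)+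
  have "(\<integral>\<^sup>+x. ennreal (exp (s * (qform a x - \<sigma>\<^sup>2 * (\<Sum>j<n. a j)))) \<partial>PN)
      \<le> (\<integral>\<^sup>+x. ennreal (1 / 2) * ennreal (exp (2 * s * dia x)) + ennreal (1 / 2) * ennreal (exp (2 * s * off x)) \<partial>PN)"
  proof (intro nn_integral_mono)
    fix x
    have "exp (s * (dia x + off x)) = exp ((1 - 1 / 2) *\<^sub>R (2 * s * dia x) + (1 / 2) *\<^sub>R (2 * s * off x))"
      by (simp add: algebra_simps)
    also have "\<dots> \<le> (1 - 1 / 2) * exp (2 * s * dia x) + (1 / 2) * exp (2 * s * off x)"
      by (intro convex_onD[OF exp_convex]) auto
    finally have "ennreal (exp (s * (dia x + off x))) \<le> ennreal ((1 / 2) * exp (2 * s * dia x) + (1 / 2) * exp (2 * s * off x))"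
      by (intro ennreal_leI) simp
    also have "\<dots> = ennreal (1 / 2) * ennreal (exp (2 * s * dia x)) + ennreal (1 / 2) * ennreal (exp (2 * s * off x))"
      by (subst ennreal_plus, simp, simp, subst ennreal_mult, simp, simp, subst ennreal_mult, simp, simp, rule refl)
    finally show "ennreal (exp (s * (qform a x - \<sigma>\<^sup>2 * (\<Sum>j<n. a j))))
        \<le> ennreal (1 / 2) * ennreal (exp (2 * s * dia x)) + ennreal (1 / 2) * ennreal (exp (2 * s * off x))"
      by (simp only: decomp)
  qed
  also have "\<dots> = ennreal (1 / 2) * (\<integral>\<^sup>+x. ennreal (exp (2 * s * dia x)) \<partial>PN)
      + ennreal (1 / 2) * (\<integral>\<^sup>+x. ennreal (exp (2 * s * off x)) \<partial>PN)"
    by (subst nn_integral_add, measurable, subst nn_integral_cmult, measurable, subst nn_integral_cmult, measurable)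
  also have "\<dots> \<le> ennreal (1 / 2) * ennreal (exp c) + ennreal (1 / 2) * ennreal (exp c)"
    by (intro add_mono mult_left_mono dia_mgf off_mgf) auto
  also have "\<dots> = ennreal (exp c)"
  proof -
    have "ennreal (1 / 2) + ennreal (1 / 2) = 1" by (subst ennreal_plus[symmetric]) auto
    then show ?thesis by (metis distrib_right mult_1)
  qed
  finally show ?thesis by (simp add: c_def)
qed

lemma prob_space_noise: "prob_space PN"
  by (intro prob_space_PiM prob)

text \<open>The exponent is taken at the end of the admissible range, where 576/34^2 < 1/2. The
  excess is then a multiple of the trace rather than its square root times sqrt(t): for the
  stochastic error the trace part can be absorbed into the variance.\<close>

lemma qform_upper_tail:
  assumes a: "\<And>j. j < n \<Longrightarrow> 0 \<le> a j" "\<And>j. j < n \<Longrightarrow> a j \<le> 1"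
  shows "measure PN {x \<in> space PN.
      \<sigma>\<^sup>2 * (\<Sum>j<n. a j) + (17 * (\<Sum>j<n. a j) + 34 * t) / \<beta> < qform a x} \<le> exp (- t)"
proof -
  note [measurable] = qform_measurable
  define v where "v = (\<Sum>j<n. a j)"
  have v: "0 \<le> v" unfolding v_def using a by (intro sum_nonneg) auto
  define Y where "Y x = \<beta> / 34 * (qform a x - \<sigma>\<^sup>2 * v)" for x
  have "(\<integral>\<^sup>+x. ennreal (exp (Y x)) \<partial>PN) \<le> ennreal (exp (576 * (\<beta> / 34 / \<beta>)\<^sup>2 * v))"
    unfolding Y_def v_def using \<beta> a by (intro hanson_wright_mgf) auto
  also have "\<dots> \<le> ennreal (exp (v / 2))"
    using \<beta> v by (intro ennreal_leI) (simp add: power2_eq_square)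
  finally have "measure PN {x \<in> space PN. v / 2 + t < Y x} \<le> exp (- t)"
    by (intro chernoff prob_space_noise) (auto simp: Y_def)
  moreover have "v / 2 + t < Y x \<longleftrightarrow> \<sigma>\<^sup>2 * v + (17 * v + 34 * t) / \<beta> < qform a x" for x
  proof -
    define z where "z = qform a x - \<sigma>\<^sup>2 * v"
    have "(17 * v + 34 * t) / \<beta> < z \<longleftrightarrow> \<beta> / 34 * ((17 * v + 34 * t) / \<beta>) < \<beta> / 34 * z"
      using \<beta> by (intro mult_less_cancel_left_pos[symmetric]) simp
    moreover have "\<beta> / 34 * ((17 * v + 34 * t) / \<beta>) = v / 2 + t" using \<beta> by simp
    ultimately have "v / 2 + t < \<beta> / 34 * z \<longleftrightarrow> (17 * v + 34 * t) / \<beta> < z" by simp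
    then show ?thesis unfolding Y_def z_def[symmetric] by (auto simp: z_def)
  qed
  ultimately show ?thesis by (simp add: v_def)
qed

text \<open>For the residual the trace may be close to \<open>n\<close>, so a multiple of it would
  be too large; the exponent has to be tuned to sqrt(n t) fluctuations. The sign \<open>e\<close>
  covers both tails.\<close>

lemma qform_deviation:
  assumes a: "\<And>j. j < n \<Longrightarrow> 0 \<le> a j" "\<And>j. j < n \<Longrightarrow> a j \<le> 1"
    and e: "\<bar>e\<bar> = 1" and t: "0 < t" and n: "0 < n"
  shows "measure PN {x \<in> space PN.
      51 * (sqrt (real n * t) + t) / \<beta> < e * (qform a x - \<sigma>\<^sup>2 * (\<Sum>j<n. a j))} \<le> exp (- t)"
proof -
  note [measurable] = qform_measurable
  define v where "v = (\<Sum>j<n. a j)"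
  have v: "0 \<le> v" unfolding v_def using a by (intro sum_nonneg) auto
  have "v \<le> (\<Sum>j<n. 1)" unfolding v_def using a by (intro sum_mono) auto
  then have vn: "v \<le> real n" by simp
  \<comment> \<open>Balances the two costs within the admissible range: r^2 n \<le> t keeps the
    exponential moment below exp(t/2), while t/r \<le> sqrt(n t) + t. The level 3t/2 rescaled by
    34/(\<beta> r) gives the constant 51.\<close>
  define r where "r = min 1 (sqrt (t / real n))"
  have r: "0 < r" "r \<le> 1" using t n by (auto simp: r_def)
  have "r\<^sup>2 \<le> (sqrt (t / real n))\<^sup>2" using r by (intro power_mono) (auto simp: r_def)
  then have rn: "r\<^sup>2 * real n \<le> t" using t n by (simp add: field_simps)
  have tr: "t / r \<le> sqrt (real n * t) + t"
  proof (cases "r = 1")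
    case True
    then show ?thesis using t by simp
  next
    case False
    then have "r = sqrt (t / real n)" by (auto simp: r_def min_def)
    then have "t / r = (sqrt t * sqrt t) / (sqrt t / sqrt (real n))"
      using t by (simp add: real_sqrt_divide)
    also have "\<dots> = sqrt (real n * t)"
    proof -
      have "(p * p) / (p / q) = q * p" if "0 < p" "0 < q" for p q :: real
        using that by (simp add: field_simps)
      then show ?thesis using t n by (simp only: real_sqrt_mult real_sqrt_gt_zero of_nat_0_less_iff)
    qed
    finally have "t / r = sqrt (real n * t)" .
    then show ?thesis using t by simp
  qed
  define Y where "Y x = e * (\<beta> / 34 * r) * (qform a x - \<sigma>\<^sup>2 * v)" for x
  have "(\<integral>\<^sup>+x. ennreal (exp (Y x)) \<partial>PN) \<le> ennreal (exp (576 * (e * (\<beta> / 34 * r) / \<beta>)\<^sup>2 * v))"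
    unfolding Y_def v_def using \<beta> a r e by (intro hanson_wright_mgf) (auto simp: abs_mult)
  also have "\<dots> \<le> ennreal (exp (t / 2))"
  proof -
    have "e\<^sup>2 = 1" using e by (metis power2_abs one_power2)
    then have "(e * (\<beta> / 34 * r) / \<beta>)\<^sup>2 = r\<^sup>2 / 1156" using \<beta> by (simp add: power_mult_distrib power_divide)
    then have "576 * (e * (\<beta> / 34 * r) / \<beta>)\<^sup>2 * v = 576 / 1156 * (r\<^sup>2 * v)" by (simp only:)
    moreover have "r\<^sup>2 * v \<le> t" using rn vn by (meson mult_left_mono order_trans zero_le_power2)
    ultimately have "576 * (e * (\<beta> / 34 * r) / \<beta>)\<^sup>2 * v \<le> t / 2" using t by linarith
    then show ?thesis by (simp add: ennreal_leI)
  qed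
  finally have *: "measure PN {x \<in> space PN. t / 2 + t < Y x} \<le> exp (- t)"
    by (intro chernoff prob_space_noise) (auto simp: Y_def)
  interpret P: prob_space "PN" by (rule prob_space_noise)
  have "measure PN {x \<in> space PN. 51 * (sqrt (real n * t) + t) / \<beta> < e * (qform a x - \<sigma>\<^sup>2 * v)}
      \<le> measure PN {x \<in> space PN. t / 2 + t < Y x}"
  proof (intro P.finite_measure_mono subsetI)
    show "{x \<in> space PN. t / 2 + t < Y x} \<in> sets PN"
      unfolding Y_def by measurable
    fix x assume x: "x \<in> {x \<in> space PN. 51 * (sqrt (real n * t) + t) / \<beta> < e * (qform a x - \<sigma>\<^sup>2 * v)}"
    define z where "z = e * (qform a x - \<sigma>\<^sup>2 * v)"
    have "51 * (t / r) / \<beta> \<le> 51 * (sqrt (real n * t) + t) / \<beta>"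
      using tr \<beta> by (intro divide_right_mono) auto
    then have "51 * (t / r) / \<beta> < z" using x by (auto simp: z_def)
    then have "(\<beta> / 34 * r) * (51 * (t / r) / \<beta>) < (\<beta> / 34 * r) * z"
      using \<beta> r by (intro mult_strict_left_mono) auto
    moreover have "(\<beta> / 34 * r) * (51 * (t / r) / \<beta>) = t / 2 + t" using \<beta> r by simp
    moreover have "(\<beta> / 34 * r) * z = Y x" by (simp add: Y_def z_def)
    ultimately show "x \<in> {x \<in> space PN. t / 2 + t < Y x}" using x by auto
  qed
  then show ?thesis using * by (simp add: v_def)
qed

text \<open>The form 2<w,x> is tilted by \<beta>/12, so that \<open>b\<close> enters with
  coefficient exactly 1/2: the exponent is \<beta> b/24. With \<open>b\<close> the bias, this is the
  half of the bias given up in the balance equations.\<close>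

lemma linear_tail:
  assumes "(\<Sum>i<n. (w i)\<^sup>2) \<le> b"
  shows "measure PN {x \<in> space PN.
      b / 2 + 12 * t / \<beta> < 2 * (\<Sum>i<n. w i * x i)} \<le> exp (- t)"
proof -
  note [measurable] = component_measurable
  define Y where "Y x = (\<Sum>i<n. \<beta> / 6 * w i * x i)" for x
  have Ym [measurable]: "Y \<in> borel_measurable PN"
    unfolding Y_def by (intro borel_measurable_sum borel_measurable_times borel_measurable_const component_measurable) auto
  have "(\<integral>\<^sup>+x. ennreal (exp (Y x)) \<partial>PN) \<le> ennreal (exp (3 / \<beta> / 2 * (\<Sum>i<n. (\<beta> / 6 * w i)\<^sup>2)))"
    unfolding Y_def by (rule linear_mgf) simp
  also have "\<dots> \<le> ennreal (exp (\<beta> / 24 * b))"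
  proof -
    have "3 / \<beta> / 2 * (\<Sum>i<n. (\<beta> / 6 * w i)\<^sup>2) = \<beta> / 24 * (\<Sum>i<n. (w i)\<^sup>2)"
      unfolding power_mult_distrib sum_distrib_left[symmetric] using \<beta> by (simp add: power2_eq_square)
    also have "\<dots> \<le> \<beta> / 24 * b" using assms \<beta> by (intro mult_left_mono) auto
    finally show ?thesis by (simp add: ennreal_leI)
  qed
  finally have "measure PN {x \<in> space PN. \<beta> / 24 * b + t < Y x} \<le> exp (- t)"
    by (intro chernoff prob_space_noise Ym)
  moreover have "\<beta> / 24 * b + t < Y x \<longleftrightarrow> b / 2 + 12 * t / \<beta> < 2 * (\<Sum>i<n. w i * x i)" for x
  proof -
    have "Y x = \<beta> / 6 * (\<Sum>i<n. w i * x i)" by (simp add: Y_def sum_distrib_left mult.assoc)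
    also have "\<dots> = \<beta> / 12 * (2 * (\<Sum>i<n. w i * x i))" by simp
    finally have Y: "Y x = \<beta> / 12 * (2 * (\<Sum>i<n. w i * x i))" .
    have "\<beta> / 12 * (b / 2 + 12 * t / \<beta>) = \<beta> / 24 * b + t" using \<beta> by (simp add: distrib_left)
    moreover have "b / 2 + 12 * t / \<beta> < 2 * (\<Sum>i<n. w i * x i)
        \<longleftrightarrow> \<beta> / 12 * (b / 2 + 12 * t / \<beta>) < \<beta> / 12 * (2 * (\<Sum>i<n. w i * x i))"
      using \<beta> by (intro mult_less_cancel_left_pos[symmetric]) simp
    ultimately show ?thesis unfolding Y by (simp only:)
  qed
  ultimately show ?thesis by simp
qed

end

section \<open>Deterministic analysis of the discrepancy principle\<close>

text \<open>Intermediate value theorem on times including infinity. A positive value at infinity is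
  a limit, so \<phi> is already positive at some finite time, and the crossing is found on a compact
  interval.\<close>

lemma filter_zero_crossing:
  fixes \<phi> :: "ennreal \<Rightarrow> real"
  assumes cont: "continuous_on {0..} (\<lambda>r. \<phi> (ennreal r))"
    and lim: "((\<lambda>r. \<phi> (ennreal r)) \<longlongrightarrow> \<phi> \<infinity>) at_top"
    and neg: "\<phi> 0 < 0"
  shows "\<phi> T \<le> 0 \<or> (\<exists>t\<le>T. \<phi> t = 0)"
proof (cases "\<phi> T \<le> 0")
  case False
  then have pos: "0 < \<phi> T" by simp
  have "\<exists>r\<ge>0. ennreal r \<le> T \<and> 0 < \<phi> (ennreal r)"
  proof (cases T)
    case (real r)
    then show ?thesis using pos by auto
  next
    case top
    have "eventually (\<lambda>r. 0 < \<phi> (ennreal r)) at_top"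
      using lim pos top by (intro order_tendstoD(1)[OF lim]) auto
    moreover have "eventually (\<lambda>r::real. 0 \<le> r) at_top" by (rule eventually_ge_at_top)
    ultimately have "eventually (\<lambda>r. 0 \<le> r \<and> 0 < \<phi> (ennreal r)) at_top" by eventually_elim simp
    then obtain r where "0 \<le> r" "0 < \<phi> (ennreal r)" by (auto simp: eventually_at_top_linorder)
    then show ?thesis using top by auto
  qed
  then obtain r where r: "0 \<le> r" "ennreal r \<le> T" "0 < \<phi> (ennreal r)" by auto
  have "\<exists>s. 0 \<le> s \<and> s \<le> r \<and> \<phi> (ennreal s) = 0"
    using neg r continuous_on_subset[OF cont, of "{0..r}"] by (intro IVT') auto
  then obtain s where "0 \<le> s" "s \<le> r" "\<phi> (ennreal s) = 0" by auto
  then have "\<exists>t\<le>T. \<phi> t = 0"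
    using r by (intro exI[of _ "ennreal s"]) (auto intro: order_trans[of _ "ennreal r"] ennreal_leI)
  then show ?thesis ..
qed simp

text \<open>
  Everything is multiplied by \<open>n\<close>, and \<open>F\<close>, \<open>e\<close> are the coefficients of the regression function and
  of the noise in a basis orthonormal for the unnormalised inner product.
\<close>

locale spectral_filter =
  fixes n :: nat and F :: "nat \<Rightarrow> real" and \<sigma> :: real and \<gamma> :: "ennreal \<Rightarrow> nat \<Rightarrow> real"
    and T :: ennreal and c1 c2 D :: real
  assumes \<gamma>_0: "\<And>j. j < n \<Longrightarrow> \<gamma> 0 j = 0"
    and \<gamma>_bounds: "\<And>t j. j < n \<Longrightarrow> 0 \<le> \<gamma> t j" "\<And>t j. j < n \<Longrightarrow> \<gamma> t j \<le> 1"
    and \<gamma>_mono: "\<And>s t j. j < n \<Longrightarrow> s \<le> t \<Longrightarrow> \<gamma> s j \<le> \<gamma> t j"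
    and \<gamma>_cont: "\<And>j. j < n \<Longrightarrow> continuous_on {0..} (\<lambda>r. \<gamma> (ennreal r) j)"
    and \<gamma>_lim: "\<And>j. j < n \<Longrightarrow> ((\<lambda>r. \<gamma> (ennreal r) j) \<longlongrightarrow> \<gamma> \<infinity> j) at_top"
    and trace_bound: "\<And>t. t \<le> T \<Longrightarrow> (\<Sum>j<n. \<gamma> t j) \<le> c1 * (\<Sum>j<n. (\<gamma> t j)\<^sup>2) + c2"
    and c_nonneg: "0 \<le> c1" "0 \<le> c2"
    and D_pos: "0 < D"
begin

definition "bias t = (\<Sum>j<n. (1 - \<gamma> t j)\<^sup>2 * (F j)\<^sup>2)"
definition "var t = \<sigma>\<^sup>2 * (\<Sum>j<n. (\<gamma> t j)\<^sup>2)"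
definition "gap t = \<sigma>\<^sup>2 * (\<Sum>j<n. 2 * \<gamma> t j - (\<gamma> t j)\<^sup>2)"
definition "resid e t = (\<Sum>j<n. ((1 - \<gamma> t j) * (F j + e j))\<^sup>2)"
definition "stoch e t = (\<Sum>j<n. (\<gamma> t j)\<^sup>2 * (e j)\<^sup>2)"
definition "loss e t = (\<Sum>j<n. ((1 - \<gamma> t j) * F j - \<gamma> t j * e j)\<^sup>2)"

lemma bias_antimono: "s \<le> t \<Longrightarrow> bias t \<le> bias s"
  unfolding bias_def using \<gamma>_mono \<gamma>_bounds
  by (intro sum_mono mult_right_mono power_mono) auto

lemma bias_nonneg: "0 \<le> bias t"
  unfolding bias_def by (intro sum_nonneg) auto

lemma var_mono: "s \<le> t \<Longrightarrow> var s \<le> var t"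
  unfolding var_def using \<gamma>_mono \<gamma>_bounds
  by (intro mult_left_mono sum_mono power_mono) auto

lemma var_nonneg: "0 \<le> var t"
  unfolding var_def by (intro mult_nonneg_nonneg sum_nonneg) auto

text \<open>In this form monotonicity in time is visible.\<close>

lemma gap_alt: "gap t = \<sigma>\<^sup>2 * (\<Sum>j<n. 1 - (1 - \<gamma> t j)\<^sup>2)"
  unfolding gap_def by (simp add: power2_eq_square algebra_simps)

lemma gap_mono: "s \<le> t \<Longrightarrow> gap s \<le> gap t"
  unfolding gap_alt using \<gamma>_mono \<gamma>_bounds
  by (intro mult_left_mono sum_mono diff_left_mono power_mono) auto

lemma resid_antimono: "s \<le> t \<Longrightarrow> resid e t \<le> resid e s"
  unfolding resid_def power_mult_distrib using \<gamma>_mono \<gamma>_bounds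
  by (intro sum_mono mult_right_mono power_mono) auto

lemma stoch_mono: "s \<le> t \<Longrightarrow> stoch e s \<le> stoch e t"
  unfolding stoch_def using \<gamma>_mono \<gamma>_bounds
  by (intro sum_mono mult_right_mono power_mono) auto

lemma loss_le: "loss e t \<le> 2 * bias t + 2 * stoch e t"
proof -
  have "(a - b)\<^sup>2 \<le> 2 * a\<^sup>2 + 2 * b\<^sup>2" for a b :: real
  proof -
    have "0 \<le> (a + b)\<^sup>2" by simp
    then show ?thesis by (simp add: power2_eq_square algebra_simps)
  qed
  then have "loss e t \<le> (\<Sum>j<n. 2 * ((1 - \<gamma> t j) * F j)\<^sup>2 + 2 * (\<gamma> t j * e j)\<^sup>2)"
    unfolding loss_def by (rule sum_mono)
  also have "\<dots> = 2 * bias t + 2 * stoch e t"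
    by (simp add: bias_def stoch_def sum.distrib sum_distrib_left power_mult_distrib)
  finally show ?thesis .
qed

lemma var_le_gap: "var t \<le> gap t"
proof -
  have "(\<gamma> t j)\<^sup>2 \<le> 2 * \<gamma> t j - (\<gamma> t j)\<^sup>2" if "j < n" for j
  proof -
    have "\<gamma> t j * \<gamma> t j \<le> \<gamma> t j * 1" using \<gamma>_bounds[OF that] by (intro mult_left_mono) auto
    then show ?thesis by (simp add: power2_eq_square)
  qed
  then show ?thesis unfolding var_def gap_def by (intro mult_left_mono sum_mono) auto
qed

text \<open>The gap is linear in small \<gamma>, the variance quadratic. Here the trace bound, and
  through it the eigenvalue condition, makes the two comparable.\<close>

lemma gap_le: "t \<le> T \<Longrightarrow> gap t \<le> 2 * c1 * var t + 2 * c2 * \<sigma>\<^sup>2"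
proof -
  assume t: "t \<le> T"
  have "(\<Sum>j<n. 2 * \<gamma> t j - (\<gamma> t j)\<^sup>2) \<le> 2 * (\<Sum>j<n. \<gamma> t j)"
    unfolding sum_distrib_left by (intro sum_mono) auto
  also have "\<dots> \<le> 2 * (c1 * (\<Sum>j<n. (\<gamma> t j)\<^sup>2) + c2)" using trace_bound[OF t] by simp
  finally have "gap t \<le> \<sigma>\<^sup>2 * (2 * (c1 * (\<Sum>j<n. (\<gamma> t j)\<^sup>2) + c2))"
    unfolding gap_def by (intro mult_left_mono) auto
  then show ?thesis by (simp add: var_def algebra_simps)
qed

lemma gap_0: "gap 0 = 0"
  by (simp add: gap_def \<gamma>_0)

lemma continuous:
  "continuous_on {0..} (\<lambda>r. bias (ennreal r))" "continuous_on {0..} (\<lambda>r. gap (ennreal r))"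
  unfolding bias_def gap_def by (intro continuous_intros \<gamma>_cont; simp)+

lemma limits:
  "((\<lambda>r. bias (ennreal r)) \<longlongrightarrow> bias \<infinity>) at_top" "((\<lambda>r. gap (ennreal r)) \<longlongrightarrow> gap \<infinity>) at_top"
  unfolding bias_def gap_def by (intro tendsto_intros \<gamma>_lim; simp)+

text \<open>The factor 3/2 is the bias itself plus the half lost to the linear noise term. If the
  gap never catches up before \<open>T\<close>, then \<open>T\<close> serves, since the stopping
  time is capped there.\<close>

lemma upper_time_exists:
  "\<exists>t1\<le>T. gap t1 \<le> 3 / 2 * bias t1 + D \<and> (t1 = T \<or> gap t1 = 3 / 2 * bias t1 + D)"
proof -
  define \<phi> where "\<phi> t = gap t - 3 / 2 * bias t - D" for t
  have "\<phi> T \<le> 0 \<or> (\<exists>t\<le>T. \<phi> t = 0)"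
    unfolding \<phi>_def using D_pos bias_nonneg[of 0] gap_0
    by (intro filter_zero_crossing continuous_intros tendsto_intros continuous limits) auto
  then show ?thesis
  proof
    assume "\<phi> T \<le> 0"
    then show ?thesis by (intro exI[of _ T]) (auto simp: \<phi>_def)
  next
    assume "\<exists>t\<le>T. \<phi> t = 0"
    then obtain t where "t \<le> T" "\<phi> t = 0" by auto
    then show ?thesis by (intro exI[of _ t]) (auto simp: \<phi>_def)
  qed
qed

text \<open>The slack is 2D because one \<open>D\<close> pays for the deviation and the other keeps
  the residual strictly above the threshold. If the gap side dominates at the start, time 0
  serves.\<close>

lemma lower_time_exists:
  "\<exists>t2\<le>T. (t2 = 0 \<or> gap t2 + 2 * D \<le> bias t2 / 2) \<and> (t2 = T \<or> bias t2 / 2 \<le> gap t2 + 2 * D)"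
proof -
  define \<phi> where "\<phi> t = gap t + 2 * D - bias t / 2" for t
  show ?thesis
  proof (cases "\<phi> 0 < 0")
    case False
    then show ?thesis by (intro exI[of _ 0]) (auto simp: \<phi>_def)
  next
    case True
    then have "\<phi> T \<le> 0 \<or> (\<exists>t\<le>T. \<phi> t = 0)"
      unfolding \<phi>_def
      by (intro filter_zero_crossing continuous_intros tendsto_intros continuous limits) auto
    then show ?thesis
    proof
      assume "\<phi> T \<le> 0"
      then show ?thesis by (intro exI[of _ T]) (auto simp: \<phi>_def)
    next
      assume "\<exists>t\<le>T. \<phi> t = 0"
      then obtain t where "t \<le> T" "\<phi> t = 0" by auto
      then show ?thesis by (intro exI[of _ t]) (auto simp: \<phi>_def)
    qed
  qed
qed

definition "stop e = min (Inf {ennreal t | t. 0 \<le> t \<and> resid e (ennreal t) \<le> real n * \<sigma>\<^sup>2}) T"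

lemma stop_le:
  assumes "t1 \<le> T" "t1 = T \<or> gap t1 = 3 / 2 * bias t1 + D"
    and "resid e t1 \<le> real n * \<sigma>\<^sup>2 - gap t1 + 3 / 2 * bias t1 + D"
  shows "stop e \<le> t1"
proof (cases "t1 = T")
  case True
  then show ?thesis by (simp add: stop_def)
next
  case False
  \<comment> \<open>The infimum ranges over finite times, so \<open>t1\<close> must be seen to be
    finite before it can be a candidate.\<close>
  then have "t1 < T" using assms(1) by simp
  then obtain r where r: "0 \<le> r" "t1 = ennreal r" by (cases t1) (auto simp: top_unique)
  have "resid e t1 \<le> real n * \<sigma>\<^sup>2" using False assms(2,3) by linarith
  then have "t1 \<in> {ennreal t | t. 0 \<le> t \<and> resid e (ennreal t) \<le> real n * \<sigma>\<^sup>2}" using r by auto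
  then show ?thesis by (auto simp: stop_def intro: min.coboundedI1 Inf_lower)
qed

lemma le_stop:
  assumes "t2 \<le> T" "t2 = 0 \<or> gap t2 + 2 * D \<le> bias t2 / 2"
    and "real n * \<sigma>\<^sup>2 - gap t2 + bias t2 / 2 - D \<le> resid e t2"
  shows "t2 \<le> stop e"
proof (cases "t2 = 0")
  case False
  \<comment> \<open>Strictly above the threshold at \<open>t2\<close>, hence at every earlier time,
    because the residual decreases.\<close>
  then have *: "real n * \<sigma>\<^sup>2 < resid e t2" using assms(2,3) D_pos by linarith
  have "t2 \<le> s" if "s \<in> {ennreal t | t. 0 \<le> t \<and> resid e (ennreal t) \<le> real n * \<sigma>\<^sup>2}" for s
  proof (rule ccontr)
    assume "\<not> t2 \<le> s"
    then have "resid e t2 \<le> resid e s" by (intro resid_antimono) auto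
    then show False using that * by auto
  qed
  then show ?thesis using assms(1) by (auto simp: stop_def intro: Inf_greatest)
qed simp

text \<open>Here \<open>t\<close> is the competing oracle time. If t \<le> t2, the bias at
  \<open>t2\<close> is below that at \<open>t\<close> by monotonicity. Otherwise t2 < T, so the
  balance equation bounds it by the gap at \<open>t2\<close>, hence at \<open>t\<close>, hence by
  the variance at \<open>t\<close>. For \<open>t1\<close> the argument is mirrored: var \<le> gap
  \<le> 3/2 bias + D at \<open>t1\<close> if t \<le> t1, and var is monotone otherwise.\<close>

lemma loss_at_stop:
  assumes t1: "t1 \<le> T" "gap t1 \<le> 3 / 2 * bias t1 + D" "t1 = T \<or> gap t1 = 3 / 2 * bias t1 + D"
    and t2: "t2 \<le> T" "t2 = 0 \<or> gap t2 + 2 * D \<le> bias t2 / 2" "t2 = T \<or> bias t2 / 2 \<le> gap t2 + 2 * D"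
    and e1: "resid e t1 \<le> real n * \<sigma>\<^sup>2 - gap t1 + 3 / 2 * bias t1 + D"
    and e2: "stoch e t1 \<le> c3 * var t1 + c4" and c3: "0 \<le> c3"
    and e3: "real n * \<sigma>\<^sup>2 - gap t2 + bias t2 / 2 - D \<le> resid e t2"
    and t: "t \<le> T"
  shows "loss e (stop e) \<le> 2 * (bias t + 4 * c1 * var t + 4 * c2 * \<sigma>\<^sup>2 + 4 * D)
      + 2 * (c3 * (3 / 2 * bias t + 3 / 2 * var t + D) + c4)"
proof -
  have "bias (stop e) \<le> bias t2" by (intro bias_antimono le_stop t2 e3)
  moreover have "stoch e (stop e) \<le> stoch e t1" by (intro stoch_mono stop_le t1 e1)
  ultimately have "loss e (stop e) \<le> 2 * bias t2 + 2 * stoch e t1"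
    using loss_le[of e "stop e"] by linarith
  also have "\<dots> \<le> 2 * bias t2 + 2 * (c3 * var t1 + c4)" using e2 by simp
  finally have "loss e (stop e) \<le> 2 * bias t2 + 2 * (c3 * var t1 + c4)" .
  moreover have "bias t2 \<le> bias t + 4 * c1 * var t + 4 * c2 * \<sigma>\<^sup>2 + 4 * D"
  proof -
    have nn: "0 \<le> 4 * c1 * var t + 4 * c2 * \<sigma>\<^sup>2 + 4 * D"
      using c_nonneg D_pos var_nonneg[of t] by (intro add_nonneg_nonneg mult_nonneg_nonneg) auto
    show ?thesis
    proof (cases "t \<le> t2")
      case True
      then show ?thesis using bias_antimono[OF True] nn by linarith
    next
      case False
      then have "bias t2 / 2 \<le> gap t2 + 2 * D" using t2(3) t by auto
      moreover have "gap t2 \<le> gap t" using False by (intro gap_mono) auto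
      ultimately show ?thesis using gap_le[OF t] bias_nonneg[of t] by linarith
    qed
  qed
  moreover have "c3 * var t1 \<le> c3 * (3 / 2 * bias t + 3 / 2 * var t + D)"
  proof (intro mult_left_mono c3)
    show "var t1 \<le> 3 / 2 * bias t + 3 / 2 * var t + D"
    proof (cases "t \<le> t1")
      case True
      then show ?thesis using bias_antimono[OF True] var_le_gap[of t1] t1(2) var_nonneg[of t] by linarith
    next
      case False
      then have "var t1 \<le> var t" by (intro var_mono) auto
      then show ?thesis using bias_nonneg[of t] var_nonneg[of t] D_pos by linarith
    qed
  qed
  ultimately show ?thesis by (simp only: distrib_left)
qed

end

section \<open>Conditional law of the responses given the design\<close>

text \<open>For each set of responses, \<open>\<kappa>\<close> is a conditional probability outside
  a null set depending on that set. Integrated identities do not see these null sets: the joint law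
  and the mixture agree on rectangles, which generate the product and are stable under
  intersection.\<close>

lemma disintegration:
  assumes P: "prob_space P" and rc: "regular_cond_distr P N X L Y \<kappa>"
    and h: "h \<in> borel_measurable (N \<Otimes>\<^sub>M L)"
  shows "(\<integral>\<^sup>+\<omega>. h (X \<omega>, Y \<omega>) \<partial>P) = (\<integral>\<^sup>+\<omega>. \<integral>\<^sup>+y. h (X \<omega>, y) \<partial>\<kappa> (X \<omega>) \<partial>P)"
proof -
  interpret P: prob_space P by fact
  have X [measurable]: "X \<in> P \<rightarrow>\<^sub>M N" and Y [measurable]: "Y \<in> P \<rightarrow>\<^sub>M L"
    and \<kappa>: "\<kappa> \<in> N \<rightarrow>\<^sub>M prob_algebra L"
    using rc by (auto simp: regular_cond_distr_def)
  have \<kappa>s [measurable]: "\<kappa> \<in> N \<rightarrow>\<^sub>M subprob_algebra L" using \<kappa> by (rule measurable_prob_algebraD)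
  have \<kappa>X [measurable]: "(\<lambda>\<omega>. \<kappa> (X \<omega>)) \<in> P \<rightarrow>\<^sub>M subprob_algebra L" by measurable
  have sets_\<kappa>: "sets (\<kappa> (X \<omega>)) = sets L" and prob_\<kappa>: "prob_space (\<kappa> (X \<omega>))" if "\<omega> \<in> space P" for \<omega>
    using measurable_space[OF \<kappa> measurable_space[OF X that]] by (auto simp: space_prob_algebra)
  define F where "F = vimage_algebra (space P) X N"
  interpret F: finite_measure_subalgebra P F
  proof
    have Xf: "X \<in> space P \<rightarrow> space N" using measurable_space[OF X] by auto
    show "subalgebra P F"
      unfolding subalgebra_def F_def sets_vimage_algebra2[OF Xf]
      using measurable_sets[OF X] by auto
  qed
  have rect: "emeasure P {\<omega> \<in> space P. X \<omega> \<in> A \<and> Y \<omega> \<in> S}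
      = (\<integral>\<^sup>+\<omega>. indicator A (X \<omega>) * emeasure (\<kappa> (X \<omega>)) S \<partial>P)"
    if A [measurable]: "A \<in> sets N" and S [measurable]: "S \<in> sets L" for A S
  proof -
    define A' where "A' = X -` A \<inter> space P"
    define B where "B = Y -` S \<inter> space P"
    have A'F: "A' \<in> sets F" unfolding A'_def F_def using A by (rule in_vimage_algebra)
    have A' [measurable]: "A' \<in> sets P" unfolding A'_def using X A by (rule measurable_sets)
    have B [measurable]: "B \<in> sets P" unfolding B_def using Y S by (rule measurable_sets)
    have m [measurable]: "(\<lambda>\<omega>. measure (\<kappa> (X \<omega>)) S) \<in> borel_measurable P"
      using measure_measurable_subprob_algebra2[of P "\<lambda>_. S" L "\<lambda>\<omega>. \<kappa> (X \<omega>)"] S sets.top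
      by (simp add: pair_measureI)
    have le1: "measure (\<kappa> (X \<omega>)) S \<le> 1" if "\<omega> \<in> space P" for \<omega>
      using prob_space.prob_le_1[OF prob_\<kappa>[OF that]] .
    have int: "integrable P (\<lambda>\<omega>. indicator A' \<omega> * measure (\<kappa> (X \<omega>)) S)"
      using le1 by (intro P.integrable_const_bound[of _ 1] AE_I2) (auto simp: indicator_def)
    have AE: "AE \<omega> in P. measure (\<kappa> (X \<omega>)) S = real_cond_exp P F (indicator B) \<omega>"
      using rc S by (auto simp: regular_cond_distr_def F_def B_def)
    have "measure P (A' \<inter> B) = (\<integral>\<omega>. indicator A' \<omega> * indicator B \<omega> \<partial>P)"
      by (simp flip: indicator_inter_arith)
    also have "\<dots> = (\<integral>\<omega>\<in>A'. indicator B \<omega> \<partial>P)" by (simp add: set_lebesgue_integral_def)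
    also have "\<dots> = (\<integral>\<omega>\<in>A'. real_cond_exp P F (indicator B) \<omega> \<partial>P)"
      using A'F by (intro F.real_cond_exp_intA P.integrable_const_bound[of _ 1] AE_I2) (auto simp: indicator_def)
    also have "\<dots> = (\<integral>\<omega>. indicator A' \<omega> * measure (\<kappa> (X \<omega>)) S \<partial>P)"
      unfolding set_lebesgue_integral_def using AE
      by (intro integral_cong_AE) auto
    finally have "emeasure P (A' \<inter> B) = ennreal (\<integral>\<omega>. indicator A' \<omega> * measure (\<kappa> (X \<omega>)) S \<partial>P)"
      by (simp add: P.emeasure_eq_measure)
    also have "\<dots> = (\<integral>\<^sup>+\<omega>. ennreal (indicator A' \<omega> * measure (\<kappa> (X \<omega>)) S) \<partial>P)"
      by (rule nn_integral_eq_integral[symmetric, OF int]) auto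
    also have "\<dots> = (\<integral>\<^sup>+\<omega>. indicator A (X \<omega>) * emeasure (\<kappa> (X \<omega>)) S \<partial>P)"
    proof (intro nn_integral_cong)
      fix \<omega> assume \<omega>: "\<omega> \<in> space P"
      interpret K: prob_space "\<kappa> (X \<omega>)" using prob_\<kappa>[OF \<omega>] .
      show "ennreal (indicator A' \<omega> * measure (\<kappa> (X \<omega>)) S) = indicator A (X \<omega>) * emeasure (\<kappa> (X \<omega>)) S"
        using \<omega> by (auto simp: A'_def indicator_def K.emeasure_eq_measure)
    qed
    also have "A' \<inter> B = {\<omega> \<in> space P. X \<omega> \<in> A \<and> Y \<omega> \<in> S}" by (auto simp: A'_def B_def)
    finally show ?thesis .
  qed
  \<comment> \<open>The conditional law of the pair, carried by the slice over
    \<open>X \<omega>\<close>; binding it to \<open>P\<close> forms the mixture.\<close>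
  define f where "f \<omega> = distr (\<kappa> (X \<omega>)) (N \<Otimes>\<^sub>M L) (Pair (X \<omega>))" for \<omega>
  have f: "f \<in> P \<rightarrow>\<^sub>M subprob_algebra (N \<Otimes>\<^sub>M L)"
    unfolding f_def by (rule measurable_distr2[OF _ \<kappa>X]) simp
  have pair: "Pair (X \<omega>) \<in> \<kappa> (X \<omega>) \<rightarrow>\<^sub>M N \<Otimes>\<^sub>M L" if "\<omega> \<in> space P" for \<omega>
    using measurable_space[OF X that] by (simp add: measurable_cong_sets[OF sets_\<kappa>[OF that] refl])
  have eq: "distr P (N \<Otimes>\<^sub>M L) (\<lambda>\<omega>. (X \<omega>, Y \<omega>)) = P \<bind> f" (is "?D1 = ?D2")
  proof (rule measure_eqI_generator_eq[OF Int_stable_pair_measure_generator[of N L], where \<Omega>="space N \<times> space L" and A="\<lambda>_. space N \<times> space L"])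
    show "{a \<times> b |a b. a \<in> sets N \<and> b \<in> sets L} \<subseteq> Pow (space N \<times> space L)"
      using sets.space_closed[of N] sets.space_closed[of L] by auto
    show "sets ?D1 = sigma_sets (space N \<times> space L) {a \<times> b |a b. a \<in> sets N \<and> b \<in> sets L}"
      by (simp add: sets_pair_measure)
    show "sets ?D2 = sigma_sets (space N \<times> space L) {a \<times> b |a b. a \<in> sets N \<and> b \<in> sets L}"
      using sets_bind_measurable[OF f P.not_empty] by (simp add: sets_pair_measure)
    show "emeasure ?D1 (space N \<times> space L) \<noteq> \<infinity>" for i :: nat
      using P.emeasure_finite by (simp add: emeasure_distr)
    show "range (\<lambda>_::nat. space N \<times> space L) \<subseteq> {a \<times> b |a b. a \<in> sets N \<and> b \<in> sets L}" by auto
    show "(\<Union>i::nat. space N \<times> space L) = space N \<times> space L" by auto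
    fix Z assume "Z \<in> {a \<times> b |a b. a \<in> sets N \<and> b \<in> sets L}"
    then obtain A S where Z: "Z = A \<times> S" and A [measurable]: "A \<in> sets N" and S [measurable]: "S \<in> sets L" by auto
    have "emeasure ?D1 Z = emeasure P {\<omega> \<in> space P. X \<omega> \<in> A \<and> Y \<omega> \<in> S}"
      unfolding Z by (subst emeasure_distr) (auto intro!: arg_cong[where f="emeasure P"])
    also have "\<dots> = (\<integral>\<^sup>+\<omega>. indicator A (X \<omega>) * emeasure (\<kappa> (X \<omega>)) S \<partial>P)" by (rule rect[OF A S])
    also have "\<dots> = (\<integral>\<^sup>+\<omega>. emeasure (f \<omega>) Z \<partial>P)"
    proof (intro nn_integral_cong)
      fix \<omega> assume \<omega>: "\<omega> \<in> space P"
      have "emeasure (f \<omega>) Z = emeasure (\<kappa> (X \<omega>)) (Pair (X \<omega>) -` Z \<inter> space (\<kappa> (X \<omega>)))"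
        unfolding f_def using pair[OF \<omega>] by (rule emeasure_distr) (simp add: Z)
      also have "Pair (X \<omega>) -` Z \<inter> space (\<kappa> (X \<omega>)) = (if X \<omega> \<in> A then S else {})"
        using sets.sets_into_space[OF S] sets_eq_imp_space_eq[OF sets_\<kappa>[OF \<omega>]] by (auto simp: Z)
      finally show "indicator A (X \<omega>) * emeasure (\<kappa> (X \<omega>)) S = emeasure (f \<omega>) Z" by simp
    qed
    also have "\<dots> = emeasure ?D2 Z"
      by (rule emeasure_bind[symmetric, OF P.not_empty f]) (simp add: Z)
    finally show "emeasure ?D1 Z = emeasure ?D2 Z" .
  qed
  have "(\<integral>\<^sup>+\<omega>. h (X \<omega>, Y \<omega>) \<partial>P) = (\<integral>\<^sup>+z. h z \<partial>?D1)"
    by (subst nn_integral_distr) (use h in auto)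
  also have "\<dots> = (\<integral>\<^sup>+\<omega>. \<integral>\<^sup>+z. h z \<partial>f \<omega> \<partial>P)"
    unfolding eq by (rule nn_integral_bind[OF h f])
  also have "\<dots> = (\<integral>\<^sup>+\<omega>. \<integral>\<^sup>+y. h (X \<omega>, y) \<partial>\<kappa> (X \<omega>) \<partial>P)"
    unfolding f_def using h by (intro nn_integral_cong) (simp add: nn_integral_distr[OF pair])
  finally show ?thesis .
qed

locale iid_design =
  fixes N0 :: "'x measure" and \<rho> :: "('x \<times> real) measure" and n :: nat
    and \<kappa> :: "(nat \<Rightarrow> 'x) \<Rightarrow> (nat \<Rightarrow> real) measure"
  assumes prob_\<rho>: "prob_space \<rho>"
    and sets_\<rho>: "sets \<rho> = sets (N0 \<Otimes>\<^sub>M borel)"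
    and n_pos: "1 \<le> n"
    and rcd: "regular_cond_distr (sample_space n \<rho>) (Pi\<^sub>M {..<n} (\<lambda>_. N0)) (design n)
       (Pi\<^sub>M {..<n} (\<lambda>_. borel)) (responses n) \<kappa>"
begin

abbreviation "P \<equiv> sample_space n \<rho>"
abbreviation "N \<equiv> Pi\<^sub>M {..<n} (\<lambda>_. N0)"
abbreviation "L \<equiv> Pi\<^sub>M {..<n} (\<lambda>_. borel :: real measure)"

lemma prob_P: "prob_space P"
  unfolding sample_space_def by (intro prob_space_PiM prob_\<rho>)

lemma design_measurable [measurable]: "design n \<in> P \<rightarrow>\<^sub>M N"
  and \<kappa>_prob: "\<kappa> \<in> N \<rightarrow>\<^sub>M prob_algebra L"
  using rcd by (auto simp: regular_cond_distr_def)

lemma \<kappa>_measurable [measurable]: "\<kappa> \<in> N \<rightarrow>\<^sub>M subprob_algebra L"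
  using \<kappa>_prob by (rule measurable_prob_algebraD)

lemma \<kappa>_sets: "\<omega> \<in> space P \<Longrightarrow> sets (\<kappa> (design n \<omega>)) = sets L"
  and \<kappa>_prob_space: "\<omega> \<in> space P \<Longrightarrow> prob_space (\<kappa> (design n \<omega>))"
  using measurable_space[OF \<kappa>_prob measurable_space[OF design_measurable]] by (auto simp: space_prob_algebra)

lemma fst_measurable [measurable]: "fst \<in> \<rho> \<rightarrow>\<^sub>M N0"
  and snd_measurable [measurable]: "snd \<in> borel_measurable \<rho>"
  by (simp_all add: measurable_cong_sets[OF sets_\<rho> refl])

text \<open>
  With indicators of responses for \<open>\<phi>\<close> this yields conditional independence; with all factors but
  one equal to 1 it yields the conditional moments of a single response.
\<close>

lemma conditional_product:
  fixes \<phi> :: "nat \<Rightarrow> 'x \<times> real \<Rightarrow> ennreal" and \<psi> :: "nat \<Rightarrow> 'x \<Rightarrow> ennreal"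
  assumes \<phi> [measurable]: "\<And>i. \<phi> i \<in> borel_measurable \<rho>"
    and \<psi> [measurable]: "\<And>i. \<psi> i \<in> borel_measurable N0"
    and fin: "\<And>i. (\<integral>\<^sup>+z. \<phi> i z \<partial>\<rho>) \<noteq> \<infinity>"
    and eq: "\<And>i A. A \<in> sets N0 \<Longrightarrow> (\<integral>\<^sup>+z. indicator A (fst z) * \<phi> i z \<partial>\<rho>) = (\<integral>\<^sup>+z. indicator A (fst z) * \<psi> i (fst z) \<partial>\<rho>)"
  shows "AE \<omega> in P. (\<integral>\<^sup>+y. (\<Prod>i<n. \<phi> i (design n \<omega> i, y i)) \<partial>\<kappa> (design n \<omega>)) = (\<Prod>i<n. \<psi> i (design n \<omega> i))"
proof -
  interpret P: prob_space P by (rule prob_P)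
  interpret R: prob_space \<rho> by (rule prob_\<rho>)
  interpret R: product_sigma_finite "\<lambda>_::nat. \<rho>" ..
  define X :: "(nat \<Rightarrow> 'x \<times> real) \<Rightarrow> nat \<Rightarrow> 'x" where "X = design n"
  have X [measurable]: "X \<in> P \<rightarrow>\<^sub>M N" unfolding X_def by measurable
  define PN where "PN = distr P N X"
  have PN_sets [measurable_cong]: "sets PN = sets N" by (simp add: PN_def)
  have \<phi>' [measurable]: "\<phi> i \<in> borel_measurable (N0 \<Otimes>\<^sub>M borel)" for i
    using \<phi>[of i] by (simp add: measurable_cong_sets[OF sets_\<rho> refl])
  define F where "F x = (\<integral>\<^sup>+y. (\<Prod>i<n. \<phi> i (x i, y i)) \<partial>\<kappa> x)" for x
  define G where "G x = (\<Prod>i<n. \<psi> i (x i))" for x :: "nat \<Rightarrow> 'x"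
  have F [measurable]: "F \<in> borel_measurable N"
    unfolding F_def by (rule nn_integral_measurable_subprob_algebra2[OF _ \<kappa>_measurable]) measurable
  have G [measurable]: "G \<in> borel_measurable N" unfolding G_def by measurable
  \<comment> \<open>The covariate law weighted by \<psi>_i. By \<open>eq\<close>, weighting the
    joint law by \<phi>_i and projecting to the covariate gives the same measure.\<close>
  define D where "D i = density (distr \<rho> N0 fst) (\<psi> i)" for i
  have D_emeasure: "emeasure (D i) A = (\<integral>\<^sup>+z. indicator A (fst z) * \<psi> i (fst z) \<partial>\<rho>)" if "A \<in> sets N0" for i A
    using that by (simp add: D_def emeasure_density nn_integral_distr mult.commute)
  have D_sets: "sets (D i) = sets N0" for i by (simp add: D_def)
  have D_fin: "finite_measure (D i)" for i
  proof
    have "emeasure (D i) (space (D i)) = (\<integral>\<^sup>+z. indicator (space N0) (fst z) * \<psi> i (fst z) \<partial>\<rho>)"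
      using D_emeasure[of "space N0" i] by (simp add: D_def)
    also have "\<dots> = (\<integral>\<^sup>+z. indicator (space N0) (fst z) * \<phi> i z \<partial>\<rho>)" by (rule eq[symmetric]) simp
    also have "\<dots> \<le> (\<integral>\<^sup>+z. \<phi> i z \<partial>\<rho>)" by (intro nn_integral_mono) (auto simp: indicator_def)
    finally show "emeasure (D i) (space (D i)) \<noteq> \<infinity>" using fin[of i] by (auto simp: top_unique)
  qed
  interpret D: product_sigma_finite D
    using D_fin by (intro product_sigma_finite.intro) (simp add: finite_measure.axioms(1))
  have prod_indicator: "indicator (Pi\<^sub>E {..<n} A) x = (\<Prod>i<n. indicator (A i) (x i) :: ennreal)"
    if xN: "x \<in> space N" for A :: "nat \<Rightarrow> 'x set" and x
  proof (cases "x \<in> Pi\<^sub>E {..<n} A")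
    case False
    then obtain i where "i < n" "x i \<notin> A i" using xN by (auto simp: space_PiM PiE_iff)
    then have "(\<Prod>i<n. indicator (A i) (x i) :: ennreal) = 0" by (intro prod_zero) (auto intro!: bexI[of _ i])
    then show ?thesis using False by simp
  qed (auto simp: PiE_iff intro!: prod.neutral[symmetric])
  \<comment> \<open>\<open>F\<close> and \<open>G\<close> are shown to be densities of the same
    measure with respect to the law of the design, tested on boxes; uniqueness of densities then
    gives equality almost everywhere.\<close>
  have "density PN F = Pi\<^sub>M {..<n} D"
  proof (rule D.PiM_eqI)
    show "sets (density PN F) = sets (Pi\<^sub>M {..<n} D)" by (simp add: PN_sets D_sets cong: sets_PiM_cong)
    fix A assume "\<And>i. i \<in> {..<n} \<Longrightarrow> A i \<in> sets (D i)"
    then have A [measurable]: "A i \<in> sets N0" if "i < n" for i using that by (simp add: D_sets)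
    have PiA [measurable]: "Pi\<^sub>E {..<n} A \<in> sets N" by (intro sets_PiM_I_finite) (auto simp: A)
    have "emeasure (density PN F) (Pi\<^sub>E {..<n} A) = (\<integral>\<^sup>+\<omega>. indicator (Pi\<^sub>E {..<n} A) (X \<omega>) * F (X \<omega>) \<partial>P)"
      using PiA by (subst emeasure_density) (auto simp: PN_def nn_integral_distr mult.commute)
    also have "\<dots> = (\<integral>\<^sup>+\<omega>. \<integral>\<^sup>+y. (\<Prod>i<n. indicator (A i) (X \<omega> i) * \<phi> i (X \<omega> i, y i)) \<partial>\<kappa> (X \<omega>) \<partial>P)"
    proof (intro nn_integral_cong)
      fix \<omega> assume \<omega>: "\<omega> \<in> space P"
      have x: "X \<omega> \<in> space N" using measurable_space[OF X \<omega>] .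
      have xi: "X \<omega> i \<in> space N0" if "i < n" for i using x that by (auto simp: space_PiM)
      have "(\<integral>\<^sup>+y. (\<Prod>i<n. indicator (A i) (X \<omega> i) * \<phi> i (X \<omega> i, y i)) \<partial>\<kappa> (X \<omega>))
          = (\<integral>\<^sup>+y. indicator (Pi\<^sub>E {..<n} A) (X \<omega>) * (\<Prod>i<n. \<phi> i (X \<omega> i, y i)) \<partial>\<kappa> (X \<omega>))"
        by (simp add: prod_indicator[OF x] prod.distrib)
      also have "\<dots> = indicator (Pi\<^sub>E {..<n} A) (X \<omega>) * F (X \<omega>)"
        unfolding F_def
      proof (rule nn_integral_cmult)
        have "(\<lambda>y. \<phi> i (X \<omega> i, y i)) \<in> borel_measurable L" if "i < n" for i
          using xi[OF that] that
          by (intro measurable_compose[OF measurable_Pair \<phi>'] measurable_const measurable_component_singleton) auto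
        then have "(\<lambda>y. \<Prod>i<n. \<phi> i (X \<omega> i, y i)) \<in> borel_measurable L" by (intro borel_measurable_prod_ennreal) auto
        then show "(\<lambda>y. \<Prod>i<n. \<phi> i (X \<omega> i, y i)) \<in> borel_measurable (\<kappa> (X \<omega>))"
          by (simp add: X_def measurable_cong_sets[OF \<kappa>_sets[OF \<omega>] refl])
      qed
      finally show "indicator (Pi\<^sub>E {..<n} A) (X \<omega>) * F (X \<omega>)
          = (\<integral>\<^sup>+y. (\<Prod>i<n. indicator (A i) (X \<omega> i) * \<phi> i (X \<omega> i, y i)) \<partial>\<kappa> (X \<omega>))" ..
    qed
    also have "\<dots> = (\<integral>\<^sup>+\<omega>. (\<Prod>i<n. indicator (A i) (X \<omega> i) * \<phi> i (X \<omega> i, responses n \<omega> i)) \<partial>P)"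
    proof -
      have c1: "(\<lambda>z. fst z i) \<in> N \<Otimes>\<^sub>M L \<rightarrow>\<^sub>M N0" and c2: "(\<lambda>z. snd z i) \<in> borel_measurable (N \<Otimes>\<^sub>M L)"
        if "i \<in> {..<n}" for i
        using that by measurable
      have m: "(\<lambda>(x, y). \<Prod>i<n. indicator (A i) (x i) * \<phi> i (x i, y i)) \<in> borel_measurable (N \<Otimes>\<^sub>M L)"
        unfolding case_prod_beta
        by (intro borel_measurable_prod_ennreal borel_measurable_times_ennreal
            measurable_compose[OF c1 borel_measurable_indicator] measurable_compose[OF measurable_Pair \<phi>'] c1 c2 A) auto
      show ?thesis using disintegration[OF prob_P rcd m] by (simp add: X_def)
    qed
    also have "\<dots> = (\<integral>\<^sup>+\<omega>. (\<Prod>i<n. indicator (A i) (fst (\<omega> i)) * \<phi> i (\<omega> i)) \<partial>P)"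
      by (intro nn_integral_cong prod.cong) (auto simp: X_def design_def responses_def)
    also have "\<dots> = (\<Prod>i<n. \<integral>\<^sup>+z. indicator (A i) (fst z) * \<phi> i z \<partial>\<rho>)"
      unfolding sample_space_def using A by (intro R.product_nn_integral_prod) auto
    also have "\<dots> = (\<Prod>i<n. emeasure (D i) (A i))"
      using A by (intro prod.cong refl) (simp add: eq D_emeasure)
    finally show "emeasure (density PN F) (Pi\<^sub>E {..<n} A) = (\<Prod>i<n. emeasure (D i) (A i))" .
  qed simp
  moreover have "density PN G = Pi\<^sub>M {..<n} D"
  proof (rule D.PiM_eqI)
    show "sets (density PN G) = sets (Pi\<^sub>M {..<n} D)" by (simp add: PN_sets D_sets cong: sets_PiM_cong)
    fix A assume "\<And>i. i \<in> {..<n} \<Longrightarrow> A i \<in> sets (D i)"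
    then have A [measurable]: "A i \<in> sets N0" if "i < n" for i using that by (simp add: D_sets)
    have PiA [measurable]: "Pi\<^sub>E {..<n} A \<in> sets N" by (intro sets_PiM_I_finite) (auto simp: A)
    have "emeasure (density PN G) (Pi\<^sub>E {..<n} A) = (\<integral>\<^sup>+\<omega>. indicator (Pi\<^sub>E {..<n} A) (X \<omega>) * G (X \<omega>) \<partial>P)"
      using PiA by (subst emeasure_density) (auto simp: PN_def nn_integral_distr mult.commute)
    also have "\<dots> = (\<integral>\<^sup>+\<omega>. (\<Prod>i<n. indicator (A i) (fst (\<omega> i)) * \<psi> i (fst (\<omega> i))) \<partial>P)"
    proof (intro nn_integral_cong)
      fix \<omega> assume \<omega>: "\<omega> \<in> space P"
      have "X \<omega> i = fst (\<omega> i)" if "i < n" for i using that by (simp add: X_def design_def)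
      then show "indicator (Pi\<^sub>E {..<n} A) (X \<omega>) * G (X \<omega>) = (\<Prod>i<n. indicator (A i) (fst (\<omega> i)) * \<psi> i (fst (\<omega> i)))"
        by (simp add: prod_indicator[OF measurable_space[OF X \<omega>]] G_def prod.distrib)
    qed
    also have "\<dots> = (\<Prod>i<n. \<integral>\<^sup>+z. indicator (A i) (fst z) * \<psi> i (fst z) \<partial>\<rho>)"
      unfolding sample_space_def using A by (intro R.product_nn_integral_prod) auto
    also have "\<dots> = (\<Prod>i<n. emeasure (D i) (A i))"
      using A by (intro prod.cong refl) (simp add: D_emeasure)
    finally show "emeasure (density PN G) (Pi\<^sub>E {..<n} A) = (\<Prod>i<n. emeasure (D i) (A i))" .
  qed simp
  ultimately have "density PN F = density PN G" by simp
  moreover have "prob_space PN" unfolding PN_def by (rule P.prob_space_distr) simp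
  ultimately have "AE x in PN. F x = G x"
    by (subst (asm) sigma_finite_measure.density_unique_iff) (auto simp: prob_space_imp_sigma_finite)
  then have "AE \<omega> in P. F (X \<omega>) = G (X \<omega>)" unfolding PN_def by (intro AE_distrD[OF X])
  then show ?thesis by (simp add: F_def G_def X_def)
qed

end

section \<open>Conditional independence of the responses\<close>

text \<open>Countability keeps the exceptional designs in a null set; including \<open>UNIV\<close>
  allows a coordinate to be left unconstrained.\<close>

lemma real_borel_rational_generator:
  "sets (borel :: real measure) = sigma_sets UNIV (insert UNIV (range (\<lambda>q::rat. {..real_of_rat q})))"
proof (rule antisym)
  let ?G = "insert UNIV (range (\<lambda>q::rat. {..real_of_rat q}))"
  have at: "{..a} \<in> sigma_sets UNIV ?G" for a :: real
  proof -
    have "{..a} = (\<Inter>q\<in>{q::rat. a < real_of_rat q}. {..real_of_rat q})"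
    proof (intro equalityI subsetI)
      fix x assume x: "x \<in> (\<Inter>q\<in>{q::rat. a < real_of_rat q}. {..real_of_rat q})"
      show "x \<in> {..a}"
      proof (rule ccontr)
        assume "x \<notin> {..a}"
        then obtain q where "a < real_of_rat q" "real_of_rat q < x" using of_rat_dense[of a x] by auto
        then show False using x by auto
      qed
    qed auto
    moreover have "(\<Inter>q\<in>{q::rat. a < real_of_rat q}. {..real_of_rat q}) \<in> sigma_sets UNIV ?G"
    proof -
      interpret sigma_algebra UNIV "sigma_sets UNIV ?G" by (rule sigma_algebra_sigma_sets) auto
      have "{q::rat. a < real_of_rat q} \<noteq> {}" using of_rat_dense[of a "a + 1"] by auto
      then show ?thesis
        by (intro countable_INT'') auto
    qed
    ultimately show ?thesis by simp
  qed
  have "sets (borel :: real measure) = sigma_sets UNIV (range (\<lambda>a::real. {..a}))"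
    unfolding borel_eq_atMost by simp
  also have "\<dots> \<subseteq> sigma_sets UNIV ?G"
    using at by (intro sigma_sets_mono) auto
  finally show "sets borel \<subseteq> sigma_sets UNIV ?G" .
  show "sigma_sets UNIV ?G \<subseteq> sets borel"
    by (intro sets.sigma_sets_subset') auto
qed

context iid_design
begin

lemma conditional_single:
  fixes \<phi> :: "'x \<times> real \<Rightarrow> ennreal" and \<psi> :: "'x \<Rightarrow> ennreal"
  assumes \<phi>: "\<phi> \<in> borel_measurable \<rho>"
    and \<psi>: "\<psi> \<in> borel_measurable N0"
    and fin: "(\<integral>\<^sup>+z. \<phi> z \<partial>\<rho>) \<noteq> \<infinity>"
    and eq: "\<And>A. A \<in> sets N0 \<Longrightarrow> (\<integral>\<^sup>+z. indicator A (fst z) * \<phi> z \<partial>\<rho>) = (\<integral>\<^sup>+z. indicator A (fst z) * \<psi> (fst z) \<partial>\<rho>)"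
  shows "AE \<omega> in P. \<forall>i<n. (\<integral>\<^sup>+y. \<phi> (design n \<omega> i, y i) \<partial>\<kappa> (design n \<omega>)) = \<psi> (design n \<omega> i)"
proof -
  interpret R: prob_space \<rho> by (rule prob_\<rho>)
  have "AE \<omega> in P. (\<integral>\<^sup>+y. \<phi> (design n \<omega> i, y i) \<partial>\<kappa> (design n \<omega>)) = \<psi> (design n \<omega> i)" if "i < n" for i
  proof -
    have "AE \<omega> in P. (\<integral>\<^sup>+y. (\<Prod>j<n. (if j = i then \<phi> else (\<lambda>_. 1)) (design n \<omega> j, y j)) \<partial>\<kappa> (design n \<omega>))
        = (\<Prod>j<n. (if j = i then \<psi> else (\<lambda>_. 1)) (design n \<omega> j))"
      using assms by (intro conditional_product) (auto simp: R.emeasure_space_1)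
    moreover have "(\<Prod>j<n. (if j = i then \<phi> else (\<lambda>_. 1)) (a j)) = \<phi> (a i)" for a :: "nat \<Rightarrow> 'x \<times> real"
      using that by (subst prod.cong[OF refl, of _ _ "\<lambda>j. if j = i then \<phi> (a j) else 1"]) auto
    moreover have "(\<Prod>j<n. (if j = i then \<psi> else (\<lambda>_. 1)) (a j)) = \<psi> (a i)" for a :: "nat \<Rightarrow> 'x"
      using that by (subst prod.cong[OF refl, of _ _ "\<lambda>j. if j = i then \<psi> (a j) else 1"]) auto
    ultimately show ?thesis by simp
  qed
  then have "AE \<omega> in P. \<forall>i\<in>{..<n}. (\<integral>\<^sup>+y. \<phi> (design n \<omega> i, y i) \<partial>\<kappa> (design n \<omega>)) = \<psi> (design n \<omega> i)"
    by (intro AE_ball_countable') auto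
  then show ?thesis by eventually_elim auto
qed

text \<open>A Radon-Nikodym derivative on the covariate space. It represents the conditional
  expectation as a function of the covariate, which can be evaluated at each design point.\<close>

lemma conditional_density_exists:
  fixes \<phi> :: "'x \<times> real \<Rightarrow> ennreal"
  assumes \<phi> [measurable]: "\<phi> \<in> borel_measurable \<rho>" and fin: "(\<integral>\<^sup>+z. \<phi> z \<partial>\<rho>) \<noteq> \<infinity>"
  shows "\<exists>\<psi>\<in>borel_measurable N0. \<forall>A\<in>sets N0.
    (\<integral>\<^sup>+z. indicator A (fst z) * \<phi> z \<partial>\<rho>) = (\<integral>\<^sup>+z. indicator A (fst z) * \<psi> (fst z) \<partial>\<rho>)"
proof -
  interpret R: prob_space \<rho> by (rule prob_\<rho>)
  define M where "M = distr \<rho> N0 fst"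
  define M' where "M' = distr (density \<rho> \<phi>) N0 fst"
  interpret M: prob_space M unfolding M_def by (rule R.prob_space_distr) simp
  have fst' [measurable]: "fst \<in> density \<rho> \<phi> \<rightarrow>\<^sub>M N0" by simp
  have M'_eq: "emeasure M' A = (\<integral>\<^sup>+z. indicator A (fst z) * \<phi> z \<partial>\<rho>)" if A [measurable]: "A \<in> sets N0" for A
  proof -
    have B: "fst -` A \<inter> space \<rho> \<in> sets \<rho>" by measurable
    have "emeasure M' A = emeasure (density \<rho> \<phi>) (fst -` A \<inter> space \<rho>)"
      unfolding M'_def by (subst emeasure_distr) auto
    also have "\<dots> = (\<integral>\<^sup>+z. \<phi> z * indicator (fst -` A \<inter> space \<rho>) z \<partial>\<rho>)"
      using B by (intro emeasure_density) auto
    also have "\<dots> = (\<integral>\<^sup>+z. indicator A (fst z) * \<phi> z \<partial>\<rho>)"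
      by (intro nn_integral_cong) (auto simp: indicator_def)
    finally show ?thesis .
  qed
  have "absolutely_continuous M M'"
    unfolding absolutely_continuous_def
  proof
    fix A assume "A \<in> null_sets M"
    then have A [measurable]: "A \<in> sets N0" and 0: "emeasure M A = 0" by (auto simp: M_def null_sets_def)
    have B: "fst -` A \<inter> space \<rho> \<in> null_sets \<rho>"
      using 0 A by (auto simp: null_sets_def M_def emeasure_distr)
    have "AE z in \<rho>. indicator A (fst z) * \<phi> z = 0"
      using AE_not_in[OF B] AE_space by eventually_elim (auto simp: indicator_def)
    then have "emeasure M' A = 0" unfolding M'_eq[OF A] by (subst nn_integral_0_iff_AE) auto
    then show "A \<in> null_sets M'" by (auto simp: null_sets_def M'_def)
  qed
  then obtain \<psi> where \<psi>: "\<psi> \<in> borel_measurable M" "density M \<psi> = M'"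
    using M.Radon_Nikodym[of M'] by (auto simp: M_def M'_def)
  then have \<psi>N [measurable]: "\<psi> \<in> borel_measurable N0" by (simp add: M_def)
  have "(\<integral>\<^sup>+z. indicator A (fst z) * \<phi> z \<partial>\<rho>) = (\<integral>\<^sup>+z. indicator A (fst z) * \<psi> (fst z) \<partial>\<rho>)"
    if A [measurable]: "A \<in> sets N0" for A
  proof -
    have "(\<integral>\<^sup>+z. indicator A (fst z) * \<phi> z \<partial>\<rho>) = emeasure (density M \<psi>) A" using M'_eq[OF A] \<psi> by simp
    also have "\<dots> = (\<integral>\<^sup>+x. \<psi> x * indicator A x \<partial>M)" using \<psi> A by (intro emeasure_density) (auto simp: M_def)
    also have "\<dots> = (\<integral>\<^sup>+z. indicator A (fst z) * \<psi> (fst z) \<partial>\<rho>)"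
      unfolding M_def by (subst nn_integral_distr) (auto simp: mult.commute)
    finally show ?thesis .
  qed
  then show ?thesis using \<psi>N by blast
qed

lemma responses_conditionally_independent:
  "AE \<omega> in P. prob_space.indep_vars (\<kappa> (design n \<omega>)) (\<lambda>_. borel) (\<lambda>i y. y i) {..<n}"
proof -
  interpret R: prob_space \<rho> by (rule prob_\<rho>)
  define G where "G = insert UNIV (range (\<lambda>q::rat. {..real_of_rat q}))"
  have G_borel: "S \<in> sets borel" if "S \<in> G" for S using that by (auto simp: G_def)
  define \<phi> where "\<phi> S z = (indicator S (snd z) :: ennreal)" for S and z :: "'x \<times> real"
  have \<phi>_meas: "\<phi> S \<in> borel_measurable \<rho>" if "S \<in> G" for S
    unfolding \<phi>_def using G_borel[OF that] by measurable
  have \<phi>_fin: "(\<integral>\<^sup>+z. \<phi> S z \<partial>\<rho>) \<noteq> \<infinity>" for S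
  proof -
    have "(\<integral>\<^sup>+z. \<phi> S z \<partial>\<rho>) \<le> (\<integral>\<^sup>+z. 1 \<partial>\<rho>)" by (intro nn_integral_mono) (auto simp: \<phi>_def indicator_def)
    then show ?thesis using R.emeasure_space_1 by (auto simp: top_unique)
  qed
  \<comment> \<open>For \<open>UNIV\<close> the density is chosen to be 1 everywhere, not just
    almost everywhere, so that marginals can be read off the product formula.\<close>
  have ex: "\<exists>\<psi>. \<psi> \<in> borel_measurable N0 \<and> (S = UNIV \<longrightarrow> \<psi> = (\<lambda>_. 1)) \<and> (\<forall>A\<in>sets N0.
      (\<integral>\<^sup>+z. indicator A (fst z) * \<phi> S z \<partial>\<rho>) = (\<integral>\<^sup>+z. indicator A (fst z) * \<psi> (fst z) \<partial>\<rho>))"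
    if "S \<in> G" for S
  proof (cases "S = UNIV")
    case True
    then show ?thesis by (intro exI[of _ "\<lambda>_. 1"]) (auto simp: \<phi>_def)
  next
    case False
    then show ?thesis using conditional_density_exists[OF \<phi>_meas[OF that] \<phi>_fin] by auto
  qed
  have "\<exists>\<psi>. \<forall>S\<in>G. \<psi> S \<in> borel_measurable N0 \<and> (S = UNIV \<longrightarrow> \<psi> S = (\<lambda>_. 1)) \<and> (\<forall>A\<in>sets N0.
      (\<integral>\<^sup>+z. indicator A (fst z) * \<phi> S z \<partial>\<rho>) = (\<integral>\<^sup>+z. indicator A (fst z) * \<psi> S (fst z) \<partial>\<rho>))"
    by (rule bchoice, rule ballI, rule ex)
  then obtain \<psi> where all: "\<forall>S\<in>G. \<psi> S \<in> borel_measurable N0 \<and> (S = UNIV \<longrightarrow> \<psi> S = (\<lambda>_. 1)) \<and> (\<forall>A\<in>sets N0.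
      (\<integral>\<^sup>+z. indicator A (fst z) * \<phi> S z \<partial>\<rho>) = (\<integral>\<^sup>+z. indicator A (fst z) * \<psi> S (fst z) \<partial>\<rho>))" ..
  have \<psi>: "\<psi> S \<in> borel_measurable N0" if "S \<in> G" for S using all that by blast
  have \<psi>_UNIV: "\<psi> S = (\<lambda>_. 1)" if "S \<in> G" "S = UNIV" for S using all that by blast
  have \<psi>_eq: "(\<integral>\<^sup>+z. indicator A (fst z) * \<phi> S z \<partial>\<rho>) = (\<integral>\<^sup>+z. indicator A (fst z) * \<psi> S (fst z) \<partial>\<rho>)"
    if "S \<in> G" "A \<in> sets N0" for S A using all that by blast
  have U: "UNIV \<in> G" by (simp add: G_def)
  \<comment> \<open>Each box from the generator has its own null set of designs; there are countably
    many boxes.\<close>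
  have "countable (PiE {..<n} (\<lambda>_. G))" by (intro countable_PiE) (auto simp: G_def)
  moreover have "AE \<omega> in P. (\<integral>\<^sup>+y. (\<Prod>i<n. indicator (S i) (y i)) \<partial>\<kappa> (design n \<omega>)) = (\<Prod>i<n. \<psi> (S i) (design n \<omega> i))"
    if S: "S \<in> PiE {..<n} (\<lambda>_. G)" for S
  proof -
    define S' where "S' i = (if i < n then S i else UNIV)" for i
    have S'G: "S' i \<in> G" for i using S U by (auto simp: S'_def PiE_iff)
    have "AE \<omega> in P. (\<integral>\<^sup>+y. (\<Prod>i<n. \<phi> (S' i) (design n \<omega> i, y i)) \<partial>\<kappa> (design n \<omega>)) = (\<Prod>i<n. \<psi> (S' i) (design n \<omega> i))"
      by (intro conditional_product \<phi>_meas \<psi> \<phi>_fin \<psi>_eq S'G)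
    then show ?thesis by (simp add: S'_def \<phi>_def)
  qed
  ultimately have "AE \<omega> in P. \<forall>S\<in>PiE {..<n} (\<lambda>_. G).
      (\<integral>\<^sup>+y. (\<Prod>i<n. indicator (S i) (y i)) \<partial>\<kappa> (design n \<omega>)) = (\<Prod>i<n. \<psi> (S i) (design n \<omega> i))"
    by (intro AE_ball_countable') auto
  then show ?thesis
    using AE_space
  proof eventually_elim
    case (elim \<omega>)
    define Q where "Q = \<kappa> (design n \<omega>)"
    define x where "x = design n \<omega>"
    interpret Q: prob_space Q unfolding Q_def using \<kappa>_prob_space[OF elim(2)] .
    have Q_sets [measurable_cong]: "sets Q = sets L" unfolding Q_def using \<kappa>_sets[OF elim(2)] .
    have Q_space: "space Q = space L" using sets_eq_imp_space_eq[OF Q_sets] .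
    have coord: "(\<lambda>y. y i) \<in> borel_measurable Q" if "i \<in> {..<n}" for i
      using that by (simp add: measurable_cong_sets[OF Q_sets refl])
    have joint: "emeasure Q {y \<in> space Q. \<forall>i<n. y i \<in> S i} = (\<Prod>i<n. \<psi> (S i) (x i))"
      if S: "\<And>i. i < n \<Longrightarrow> S i \<in> G" for S
    proof -
      have [measurable]: "S i \<in> sets borel" if "i \<in> {..<n}" for i using S G_borel that by auto
      have "emeasure Q {y \<in> space Q. \<forall>i<n. y i \<in> S i} = (\<integral>\<^sup>+y. indicator {y \<in> space Q. \<forall>i<n. y i \<in> S i} y \<partial>Q)"
      proof (rule nn_integral_indicator[symmetric])
        have "{y \<in> space Q. \<forall>i<n. y i \<in> S i} = {y \<in> space Q. \<forall>i\<in>{..<n}. y i \<in> S i}" by auto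
        also have "\<dots> \<in> sets Q" by (intro sets.sets_Collect_finite_All measurable_sets_Collect[OF coord]) auto
        finally show "{y \<in> space Q. \<forall>i<n. y i \<in> S i} \<in> sets Q" .
      qed
      also have "\<dots> = (\<integral>\<^sup>+y. (\<Prod>i<n. indicator (restrict S {..<n} i) (y i)) \<partial>Q)"
      proof (intro nn_integral_cong)
        fix y assume "y \<in> space Q"
        show "indicator {y \<in> space Q. \<forall>i<n. y i \<in> S i} y = (\<Prod>i<n. indicator (restrict S {..<n} i) (y i) :: ennreal)"
        proof (cases "\<forall>i<n. y i \<in> S i")
          case True
          then show ?thesis using \<open>y \<in> space Q\<close> by (auto intro!: prod.neutral[symmetric])
        next
          case False
          then obtain i where "i < n" "y i \<notin> S i" by auto
          then have "(\<Prod>i<n. indicator (restrict S {..<n} i) (y i) :: ennreal) = 0"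
            by (intro prod_zero) (auto intro!: bexI[of _ i])
          then show ?thesis using False by simp
        qed
      qed
      also have "\<dots> = (\<Prod>i<n. \<psi> (restrict S {..<n} i) (x i))"
        using elim(1)[rule_format, of "restrict S {..<n}"] S by (auto simp: Q_def x_def)
      also have "\<dots> = (\<Prod>i<n. \<psi> (S i) (x i))" by (intro prod.cong) auto
      finally show ?thesis .
    qed
    \<comment> \<open>The marginal of coordinate \<open>i\<close> is the joint formula with all
      other coordinates unconstrained.\<close>
    have single: "emeasure Q {y \<in> space Q. y i \<in> S} = \<psi> S (x i)" if "i < n" "S \<in> G" for i S
    proof -
      have "{y \<in> space Q. y i \<in> S} = {y \<in> space Q. \<forall>l<n. y l \<in> (if l = i then S else UNIV)}" using that by auto
      then have "emeasure Q {y \<in> space Q. y i \<in> S} = (\<Prod>l<n. \<psi> (if l = i then S else UNIV) (x l))"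
        using joint[of "\<lambda>l. if l = i then S else UNIV"] that U by simp
      also have "\<dots> = (\<Prod>l<n. if l = i then \<psi> S (x l) else 1)"
        using \<psi>_UNIV[OF U refl] by (intro prod.cong) auto
      finally show ?thesis using that by simp
    qed
    have "Q.indep_vars (\<lambda>_. borel) (\<lambda>i y. y i) {..<n}"
    proof (subst Q.indep_vars_finite[where E="\<lambda>_. G"])
      show "{..<n} \<noteq> {}" using n_pos by (simp add: lessThan_empty_iff)
      show "sets (borel :: real measure) = sigma_sets (space borel) G" for i :: nat
        unfolding G_def using real_borel_rational_generator by simp
      show "Int_stable G" for i :: nat
      proof (rule Int_stableI)
        fix a b assume "a \<in> G" "b \<in> G"
        moreover have "{..real_of_rat p} \<inter> {..real_of_rat q} = {..real_of_rat (min p q)}" for p q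
          by (auto simp: min_def of_rat_less_eq intro: order_trans)
        ultimately show "a \<inter> b \<in> G" by (auto simp: G_def)
      qed
      show "\<forall>A\<in>{..<n} \<rightarrow> G. Q.prob (\<Inter>j\<in>{..<n}. (\<lambda>y. y j) -` A j \<inter> space Q) = (\<Prod>j<n. Q.prob ((\<lambda>y. y j) -` A j \<inter> space Q))"
      proof
        fix A assume "A \<in> {..<n} \<rightarrow> G"
        then have A: "A i \<in> G" if "i < n" for i using that by auto
        have "ennreal (Q.prob (\<Inter>j\<in>{..<n}. (\<lambda>y. y j) -` A j \<inter> space Q)) = emeasure Q {y \<in> space Q. \<forall>i<n. y i \<in> A i}"
          using n_pos by (auto simp: Q.emeasure_eq_measure lessThan_empty_iff intro!: arg_cong[where f=Q.prob])
        also have "\<dots> = (\<Prod>i<n. emeasure Q {y \<in> space Q. y i \<in> A i})"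
          using joint[OF A] single A by simp
        also have "\<dots> = (\<Prod>i<n. ennreal (Q.prob ((\<lambda>y. y i) -` A i \<inter> space Q)))"
          by (intro prod.cong refl) (auto simp: Q.emeasure_eq_measure intro!: arg_cong[where f=Q.prob])
        also have "\<dots> = ennreal (\<Prod>i<n. Q.prob ((\<lambda>y. y i) -` A i \<inter> space Q))"
          by (intro prod_ennreal) auto
        finally show "Q.prob (\<Inter>j\<in>{..<n}. (\<lambda>y. y j) -` A j \<inter> space Q) = (\<Prod>j<n. Q.prob ((\<lambda>y. y j) -` A j \<inter> space Q))"
          by (subst (asm) ennreal_inj) (auto intro: prod_nonneg)
      qed
    qed (use coord U in auto)
    then show ?case by (simp add: Q_def)
  qed
qed

end

section \<open>Conditional moments of the noise\<close>

text \<open>The quotient k^k / k! is a single term of the series of e^k, and e \<le> 3.\<close>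

lemma power_self_le_fact: "real k ^ k \<le> 3 ^ k * fact k"
proof -
  have "real k ^ k /\<^sub>R fact k \<le> exp (real k)"
    using sum_le_suminf[of "\<lambda>j. real k ^ j /\<^sub>R fact j" "{k}"] sums_unique[OF exp_converges[of "real k"]]
      sums_summable[OF exp_converges[of "real k"]] by simp
  also have "exp (real k) = exp 1 ^ k" by (simp add: exp_of_nat_mult[symmetric])
  also have "\<dots> \<le> 3 ^ k" using exp_le by (intro power_mono) auto
  finally show ?thesis by (simp add: field_simps)
qed

lemma enn2real_inject: "x \<noteq> \<infinity> \<Longrightarrow> y \<noteq> \<infinity> \<Longrightarrow> enn2real x = enn2real y \<Longrightarrow> x = y"
  by (cases x; cases y) auto

context iid_design
begin

definition "cond = real_cond_exp \<rho> (vimage_algebra (space \<rho>) fst N0)"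

lemma cond_integral:
  assumes Z: "integrable \<rho> Z" and A: "A \<in> sets N0"
  shows "(\<integral>z. indicator A (fst z) * Z z \<partial>\<rho>) = (\<integral>z. indicator A (fst z) * cond Z z \<partial>\<rho>)"
    and "integrable \<rho> (\<lambda>z. indicator A (fst z) * cond Z z)"
proof -
  interpret R: prob_space \<rho> by (rule prob_\<rho>)
  define F where "F = vimage_algebra (space \<rho>) fst N0"
  interpret F: finite_measure_subalgebra \<rho> F
  proof
    have Xf: "fst \<in> space \<rho> \<rightarrow> space N0" using measurable_space[OF fst_measurable] by auto
    show "subalgebra \<rho> F"
      unfolding subalgebra_def F_def sets_vimage_algebra2[OF Xf]
      using measurable_sets[OF fst_measurable] by auto
  qed
  have A': "fst -` A \<inter> space \<rho> \<in> sets F" unfolding F_def using A by (rule in_vimage_algebra)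
  have A'': "fst -` A \<inter> space \<rho> \<in> sets \<rho>" using A by (intro measurable_sets[OF fst_measurable])
  have ind: "(\<integral>z. indicator A (fst z) * W z \<partial>\<rho>) = (\<integral>z\<in>fst -` A \<inter> space \<rho>. W z \<partial>\<rho>)" for W :: "'x \<times> real \<Rightarrow> real"
    unfolding set_lebesgue_integral_def by (intro Bochner_Integration.integral_cong) (auto simp: indicator_def)
  show "(\<integral>z. indicator A (fst z) * Z z \<partial>\<rho>) = (\<integral>z. indicator A (fst z) * cond Z z \<partial>\<rho>)"
    unfolding ind cond_def F_def[symmetric] by (rule F.real_cond_exp_intA[OF Z A'])
  have "integrable \<rho> (cond Z)" unfolding cond_def F_def[symmetric] by (rule F.real_cond_exp_int(1)[OF Z])
  then have "integrable \<rho> (\<lambda>z. indicator (fst -` A \<inter> space \<rho>) z *\<^sub>R cond Z z)"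
    using A'' by (intro integrable_mult_indicator)
  moreover have "integrable \<rho> (\<lambda>z. indicator (fst -` A \<inter> space \<rho>) z *\<^sub>R cond Z z)
      \<longleftrightarrow> integrable \<rho> (\<lambda>z. indicator A (fst z) * cond Z z)"
    by (intro Bochner_Integration.integrable_cong refl) (auto simp: indicator_def)
  ultimately show "integrable \<rho> (\<lambda>z. indicator A (fst z) * cond Z z)" by blast
qed

lemma integrable_indicator_times:
  fixes Z :: "'x \<times> real \<Rightarrow> real"
  assumes Z: "integrable \<rho> Z" and A: "A \<in> sets N0"
  shows "integrable \<rho> (\<lambda>z. indicator A (fst z) * Z z)"
proof -
  have "fst -` A \<inter> space \<rho> \<in> sets \<rho>" using A by (intro measurable_sets[OF fst_measurable])
  then have "integrable \<rho> (\<lambda>z. indicator (fst -` A \<inter> space \<rho>) z *\<^sub>R Z z)"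
    using Z by (intro integrable_mult_indicator)
  moreover have "integrable \<rho> (\<lambda>z. indicator (fst -` A \<inter> space \<rho>) z *\<^sub>R Z z)
      \<longleftrightarrow> integrable \<rho> (\<lambda>z. indicator A (fst z) * Z z)"
    by (intro Bochner_Integration.integrable_cong refl) (auto simp: indicator_def)
  ultimately show ?thesis by blast
qed

lemma cond_nonneg_le:
  assumes Z: "integrable \<rho> Z" and nn: "\<And>z. 0 \<le> Z z" and A: "A \<in> sets N0" and c: "0 \<le> c"
    and le: "AE z in \<rho>. cond Z z \<le> c"
  shows "(\<integral>\<^sup>+z. indicator A (fst z) * ennreal (Z z) \<partial>\<rho>) \<le> ennreal c * (\<integral>\<^sup>+z. indicator A (fst z) \<partial>\<rho>)"
proof -
  interpret R: prob_space \<rho> by (rule prob_\<rho>)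
  have [measurable]: "A \<in> sets N0" by (rule A)
  have int1: "integrable \<rho> (\<lambda>z. indicator A (fst z) * c)"
    using A by (intro integrable_indicator_times) auto
  have "(\<integral>\<^sup>+z. indicator A (fst z) * ennreal (Z z) \<partial>\<rho>) = (\<integral>\<^sup>+z. ennreal (indicator A (fst z) * Z z) \<partial>\<rho>)"
    by (intro nn_integral_cong) (auto simp: indicator_def)
  also have "\<dots> = ennreal (\<integral>z. indicator A (fst z) * Z z \<partial>\<rho>)"
    using nn by (intro nn_integral_eq_integral integrable_indicator_times Z A) auto
  also have "\<dots> = ennreal (\<integral>z. indicator A (fst z) * cond Z z \<partial>\<rho>)" using cond_integral[OF Z A] by simp
  also have "\<dots> \<le> ennreal (\<integral>z. indicator A (fst z) * c \<partial>\<rho>)"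
    using le by (intro ennreal_leI integral_mono_AE cond_integral(2)[OF Z A] int1) (auto simp: indicator_def)
  also have "\<dots> = (\<integral>\<^sup>+z. ennreal (indicator A (fst z) * c) \<partial>\<rho>)"
    using c by (intro nn_integral_eq_integral[symmetric] int1) auto
  also have "\<dots> = (\<integral>\<^sup>+z. ennreal c * indicator A (fst z) \<partial>\<rho>)"
    by (intro nn_integral_cong) (auto simp: indicator_def)
  also have "\<dots> = ennreal c * (\<integral>\<^sup>+z. indicator A (fst z) \<partial>\<rho>)" by (intro nn_integral_cmult) simp
  finally show ?thesis .
qed

lemma density_le_AE:
  assumes \<psi> [measurable]: "\<psi> \<in> borel_measurable N0"
    and le: "\<And>A. A \<in> sets N0 \<Longrightarrow> (\<integral>\<^sup>+z. indicator A (fst z) * \<psi> (fst z) \<partial>\<rho>) \<le> ennreal c * (\<integral>\<^sup>+z. indicator A (fst z) \<partial>\<rho>)"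
  shows "AE z in \<rho>. \<psi> (fst z) \<le> ennreal c"
proof -
  interpret R: prob_space \<rho> by (rule prob_\<rho>)
  \<comment> \<open>Tested on the set where the bound fails, the hypothesis forces the integral of
    the nonnegative excess to be 0.\<close>
  define A where "A = {x \<in> space N0. ennreal c < \<psi> x}"
  have A [measurable]: "A \<in> sets N0" unfolding A_def by measurable
  have fin: "(\<integral>\<^sup>+z. ennreal c * indicator A (fst z) \<partial>\<rho>) \<noteq> \<infinity>"
  proof -
    have "(\<integral>\<^sup>+z. ennreal c * indicator A (fst z) \<partial>\<rho>) \<le> (\<integral>\<^sup>+z. ennreal c \<partial>\<rho>)"
      by (intro nn_integral_mono) (auto simp: indicator_def)
    also have "\<dots> = ennreal c" by (simp add: R.emeasure_space_1)
    finally show ?thesis by (auto simp: top_unique)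
  qed
  have "(\<integral>\<^sup>+z. indicator A (fst z) * \<psi> (fst z) - ennreal c * indicator A (fst z) \<partial>\<rho>)
      = (\<integral>\<^sup>+z. indicator A (fst z) * \<psi> (fst z) \<partial>\<rho>) - (\<integral>\<^sup>+z. ennreal c * indicator A (fst z) \<partial>\<rho>)"
    using fin by (intro nn_integral_diff) (auto simp: indicator_def A_def)
  also have "\<dots> = 0"
  proof -
    have e: "(\<integral>\<^sup>+z. ennreal c * indicator A (fst z) \<partial>\<rho>) = ennreal c * (\<integral>\<^sup>+z. indicator A (fst z) \<partial>\<rho>)"
      by (intro nn_integral_cmult) simp
    have "(\<integral>\<^sup>+z. indicator A (fst z) * \<psi> (fst z) \<partial>\<rho>) < \<infinity>"
      using le[OF A] fin unfolding e by (simp add: le_less_trans less_top)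
    then show ?thesis using le[OF A] unfolding e by (simp add: diff_eq_0_iff_ennreal)
  qed
  finally have "AE z in \<rho>. indicator A (fst z) * \<psi> (fst z) - ennreal c * indicator A (fst z) = 0"
    by (subst (asm) nn_integral_0_iff_AE) auto
  then show ?thesis
    using AE_space
  proof eventually_elim
    case (elim z)
    have "fst z \<in> space N0" using measurable_space[OF fst_measurable elim(2)] .
    then show ?case using elim(1)
      by (cases "fst z \<in> A") (auto simp: A_def diff_eq_0_iff_ennreal not_less)
  qed
qed

lemma design_AE:
  assumes "AE z in \<rho>. R z"
  shows "AE \<omega> in P. \<forall>i<n. R (\<omega> i)"
proof -
  have "AE \<omega> in P. R (\<omega> i)" if "i \<in> {..<n}" for i
    unfolding sample_space_def using assms that prob_\<rho> by (intro AE_PiM_component) auto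
  then have "AE \<omega> in P. \<forall>i\<in>{..<n}. R (\<omega> i)" by (intro AE_ball_countable') auto
  then show ?thesis by eventually_elim auto
qed

text \<open>The exponential is expanded and the moment condition used at q = 2k. The k-th term is at
  most (1/12)^k 2^k k^k/k! \<le> 2^(-k), because k^k/k! \<le> 3^k; this fixes 12 = 2 * 2 * 3, and
  the geometric series gives 2. Integrating over events \<open>A\<close> of the covariate makes it a
  conditional statement.\<close>

lemma sub_Gaussian_square_exponential:
  fixes \<epsilon> :: "'x \<times> real \<Rightarrow> real"
  assumes \<epsilon> [measurable]: "\<epsilon> \<in> borel_measurable \<rho>" and \<sigma>: "0 < \<sigma>" and a: "1 \<le> a"
    and int: "\<And>q. 1 \<le> q \<Longrightarrow> integrable \<rho> (\<lambda>z. \<bar>\<epsilon> z\<bar> powr q)"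
    and le: "\<And>q. 1 \<le> q \<Longrightarrow> AE z in \<rho>. q powr (-1/2) * cond (\<lambda>z. \<bar>\<epsilon> z\<bar> powr q) z powr (1/q) \<le> a * \<sigma>"
    and A [measurable]: "A \<in> sets N0"
  shows "(\<integral>\<^sup>+z. indicator A (fst z) * ennreal (exp (1 / (12 * a\<^sup>2 * \<sigma>\<^sup>2) * (\<epsilon> z)\<^sup>2)) \<partial>\<rho>)
      \<le> ennreal 2 * (\<integral>\<^sup>+z. indicator A (fst z) \<partial>\<rho>)"
proof -
  interpret R: prob_space \<rho> by (rule prob_\<rho>)
  define \<beta> where "\<beta> = 1 / (12 * a\<^sup>2 * \<sigma>\<^sup>2)"
  define p where "p = (\<integral>\<^sup>+z. indicator A (fst z) \<partial>\<rho>)"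
  have as: "0 < a * \<sigma>" using a \<sigma> by simp
  have \<beta>: "0 < \<beta>" using a \<sigma> by (simp add: \<beta>_def)
  have moment: "(\<integral>\<^sup>+z. indicator A (fst z) * ennreal ((\<epsilon> z) ^ (2 * k)) \<partial>\<rho>) \<le> ennreal ((a * \<sigma>) ^ (2 * k) * (2 * real k) ^ k) * p" for k
  proof (cases "k = 0")
    case True
    then show ?thesis by (simp add: p_def)
  next
    case False
    define q where "q = 2 * real k"
    have q: "1 \<le> q" using False by (simp add: q_def)
    have pw: "\<bar>x\<bar> powr q = x ^ (2 * k)" for x :: real
    proof (cases "x = 0")
      case False
      then show ?thesis using powr_realpow[of "\<bar>x\<bar>" "2 * k"] by (simp add: q_def power_even_abs)
    qed (use \<open>k \<noteq> 0\<close> in auto)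
    have "AE z in \<rho>. cond (\<lambda>z. \<bar>\<epsilon> z\<bar> powr q) z \<le> (a * \<sigma>) ^ (2 * k) * (2 * real k) ^ k"
      using le[OF q]
    proof eventually_elim
      case (elim z)
      define c where "c = cond (\<lambda>z. \<bar>\<epsilon> z\<bar> powr q) z"
      \<comment> \<open>Taking the root back requires a positive base of \<open>powr\<close>; for c
        \<le> 0 the bound is trivial.\<close>
      show ?case
      proof (cases "0 < c")
        case False
        have "0 \<le> (a * \<sigma>) ^ (2 * k) * (2 * real k) ^ k" by (rule mult_nonneg_nonneg[OF zero_le_power[OF less_imp_le[OF as]] zero_le_power]) simp
        then show ?thesis unfolding c_def[symmetric] using False by linarith
      next
        case True
        have "q powr (-1/2) * c powr (1/q) \<le> a * \<sigma>" using elim by (simp add: c_def)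
        then have "q powr (1/2) * (q powr (-1/2) * c powr (1/q)) \<le> q powr (1/2) * (a * \<sigma>)"
          by (intro mult_left_mono) auto
        moreover have "q powr (1/2) * (q powr (-1/2) * c powr (1/q)) = c powr (1/q)"
        proof -
          have "q powr (1/2) * q powr (-1/2) = 1" using q by (simp flip: powr_add)
          then show ?thesis by (simp only: mult.assoc[symmetric] mult_1)
        qed
        ultimately have "c powr (1/q) \<le> q powr (1/2) * (a * \<sigma>)" by (simp only:)
        then have "(c powr (1/q)) powr q \<le> (q powr (1/2) * (a * \<sigma>)) powr q"
          using q by (intro powr_mono2) auto
        moreover have "(c powr (1/q)) powr q = c" using True q by (simp add: powr_powr)
        moreover have "(q powr (1/2) * (a * \<sigma>)) powr q = (2 * real k) ^ k * (a * \<sigma>) ^ (2 * k)"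
        proof -
          have "(q powr (1/2)) powr q = q powr (real k)" by (simp add: powr_powr q_def)
          also have "\<dots> = q ^ k" using q by (intro powr_realpow) simp
          also have "\<dots> = (2 * real k) ^ k" by (simp only: q_def)
          finally have "(q powr (1/2)) powr q = (2 * real k) ^ k" .
          moreover have "(a * \<sigma>) powr q = (a * \<sigma>) ^ (2 * k)" using as pw[of "a * \<sigma>"] by simp
          ultimately show ?thesis using as by (simp add: powr_mult)
        qed
        ultimately show ?thesis unfolding c_def[symmetric] by (simp add: mult.commute)
      qed
    qed
    then show ?thesis
      using cond_nonneg_le[OF int[OF q] _ A, of "(a * \<sigma>) ^ (2 * k) * (2 * real k) ^ k"] as
      by (simp add: pw p_def)
  qed
  have "(\<integral>\<^sup>+z. indicator A (fst z) * ennreal (exp (\<beta> * (\<epsilon> z)\<^sup>2)) \<partial>\<rho>)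
      = (\<integral>\<^sup>+z. (\<Sum>k. ennreal (\<beta> ^ k / fact k) * (indicator A (fst z) * ennreal ((\<epsilon> z) ^ (2 * k)))) \<partial>\<rho>)"
  proof (intro nn_integral_cong)
    fix z
    have "(\<Sum>k. ennreal ((\<beta> * (\<epsilon> z)\<^sup>2) ^ k /\<^sub>R fact k)) = ennreal (exp (\<beta> * (\<epsilon> z)\<^sup>2))"
      using \<beta> by (intro suminf_ennreal_eq exp_converges) auto
    moreover have "ennreal ((\<beta> * (\<epsilon> z)\<^sup>2) ^ k /\<^sub>R fact k) = ennreal (\<beta> ^ k / fact k) * ennreal ((\<epsilon> z) ^ (2 * k))" for k
    proof -
      have "(\<beta> * (\<epsilon> z)\<^sup>2) ^ k = \<beta> ^ k * (\<epsilon> z) ^ (2 * k)" by (simp add: power_mult_distrib flip: power_mult)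
      then have "(\<beta> * (\<epsilon> z)\<^sup>2) ^ k /\<^sub>R fact k = \<beta> ^ k / fact k * (\<epsilon> z) ^ (2 * k)" by (simp add: divide_inverse)
      then show ?thesis using \<beta> by (simp only:) (intro ennreal_mult, auto)
    qed
    ultimately have "ennreal (exp (\<beta> * (\<epsilon> z)\<^sup>2)) = (\<Sum>k. ennreal (\<beta> ^ k / fact k) * ennreal ((\<epsilon> z) ^ (2 * k)))" by simp
    then show "indicator A (fst z) * ennreal (exp (\<beta> * (\<epsilon> z)\<^sup>2))
        = (\<Sum>k. ennreal (\<beta> ^ k / fact k) * (indicator A (fst z) * ennreal ((\<epsilon> z) ^ (2 * k))))"
      by (cases "fst z \<in> A") auto
  qed
  also have "\<dots> = (\<Sum>k. \<integral>\<^sup>+z. ennreal (\<beta> ^ k / fact k) * (indicator A (fst z) * ennreal ((\<epsilon> z) ^ (2 * k))) \<partial>\<rho>)"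
    by (intro nn_integral_suminf) measurable
  also have "\<dots> = (\<Sum>k. ennreal (\<beta> ^ k / fact k) * (\<integral>\<^sup>+z. indicator A (fst z) * ennreal ((\<epsilon> z) ^ (2 * k)) \<partial>\<rho>))"
    by (intro suminf_cong nn_integral_cmult) measurable
  also have "\<dots> \<le> (\<Sum>k. ennreal ((1 / 2) ^ k) * p)"
  proof (intro suminf_le allI)
    fix k
    have "ennreal (\<beta> ^ k / fact k) * (\<integral>\<^sup>+z. indicator A (fst z) * ennreal ((\<epsilon> z) ^ (2 * k)) \<partial>\<rho>)
        \<le> ennreal (\<beta> ^ k / fact k) * (ennreal ((a * \<sigma>) ^ (2 * k) * (2 * real k) ^ k) * p)"
      by (intro mult_left_mono moment) auto
    also have "\<dots> = ennreal (\<beta> ^ k / fact k * ((a * \<sigma>) ^ (2 * k) * (2 * real k) ^ k)) * p"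
    proof -
      have "0 \<le> (a * \<sigma>) ^ (2 * k) * (2 * real k) ^ k"
        by (rule mult_nonneg_nonneg[OF zero_le_power[OF less_imp_le[OF as]] zero_le_power]) simp
      then have "ennreal (\<beta> ^ k / fact k * ((a * \<sigma>) ^ (2 * k) * (2 * real k) ^ k))
          = ennreal (\<beta> ^ k / fact k) * ennreal ((a * \<sigma>) ^ (2 * k) * (2 * real k) ^ k)"
        using \<beta> by (intro ennreal_mult) auto
      then show ?thesis by (simp only: mult.assoc)
    qed
    also have "\<dots> \<le> ennreal ((1 / 2) ^ k) * p"
    proof (intro mult_right_mono ennreal_leI)
      have "\<beta> ^ k * (a * \<sigma>) ^ (2 * k) = (\<beta> * (a * \<sigma>)\<^sup>2) ^ k" by (simp add: power_mult_distrib power_mult)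
      also have "\<beta> * (a * \<sigma>)\<^sup>2 = 1 / 12" using a \<sigma> by (simp add: \<beta>_def power_mult_distrib)
      finally have "\<beta> ^ k / fact k * ((a * \<sigma>) ^ (2 * k) * (2 * real k) ^ k) = (1 / 12) ^ k * 2 ^ k * (real k ^ k / fact k)"
        by (simp add: power_mult_distrib)
      also have "\<dots> \<le> (1 / 12) ^ k * 2 ^ k * 3 ^ k"
        using power_self_le_fact[of k] by (intro mult_left_mono) (auto simp: divide_le_eq)
      also have "\<dots> = (1 / 2) ^ k" by (simp flip: power_mult_distrib)
      finally show "\<beta> ^ k / fact k * ((a * \<sigma>) ^ (2 * k) * (2 * real k) ^ k) \<le> (1 / 2) ^ k" .
    qed auto
    finally show "ennreal (\<beta> ^ k / fact k) * (\<integral>\<^sup>+z. indicator A (fst z) * ennreal ((\<epsilon> z) ^ (2 * k)) \<partial>\<rho>) \<le> ennreal ((1 / 2) ^ k) * p" .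
  qed auto
  also have "\<dots> = (\<Sum>k. ennreal ((1 / 2) ^ k)) * p" by (rule ennreal_suminf_multc)
  also have "(\<Sum>k. ennreal ((1 / 2) ^ k)) = ennreal 2"
    using geometric_sums[of "1 / 2 :: real"] by (intro suminf_ennreal_eq) auto
  finally show ?thesis by (simp add: \<beta>_def p_def)
qed

text \<open>Conditional laws are handled through nonnegative integrals, and \<open>ennreal\<close>
  cuts negative values off at 0. Mean zero therefore appears as equality of the integrals of the
  positive and the negative part.\<close>

lemma conditional_noise_moments:
  assumes f [measurable]: "f \<in> borel_measurable N0" and \<sigma>: "0 < \<sigma>" and a: "1 \<le> a"
    and sq: "integrable \<rho> (\<lambda>z. (noise f z)\<^sup>2)"
    and mean0: "AE z in \<rho>. cond (noise f) z = 0"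
    and var: "AE z in \<rho>. cond (\<lambda>z. (noise f z)\<^sup>2) z = \<sigma>\<^sup>2"
    and int: "\<And>q. 1 \<le> q \<Longrightarrow> integrable \<rho> (\<lambda>z. \<bar>noise f z\<bar> powr q)"
    and le: "\<And>q. 1 \<le> q \<Longrightarrow> AE z in \<rho>. q powr (-1/2) * cond (\<lambda>z. \<bar>noise f z\<bar> powr q) z powr (1/q) \<le> a * \<sigma>"
  shows "AE \<omega> in P. \<forall>i<n.
      (\<integral>\<^sup>+y. ennreal (y i - f (design n \<omega> i)) \<partial>\<kappa> (design n \<omega>)) = (\<integral>\<^sup>+y. ennreal (- (y i - f (design n \<omega> i))) \<partial>\<kappa> (design n \<omega>))
    \<and> (\<integral>\<^sup>+y. ennreal ((y i - f (design n \<omega> i))\<^sup>2) \<partial>\<kappa> (design n \<omega>)) = ennreal (\<sigma>\<^sup>2)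
    \<and> (\<integral>\<^sup>+y. ennreal (exp (1 / (12 * a\<^sup>2 * \<sigma>\<^sup>2) * (y i - f (design n \<omega> i))\<^sup>2)) \<partial>\<kappa> (design n \<omega>)) \<le> 2"
proof -
  interpret R: prob_space \<rho> by (rule prob_\<rho>)
  have noise_m [measurable]: "noise f \<in> borel_measurable \<rho>" unfolding noise_def[abs_def] by measurable
  have noise_int: "integrable \<rho> (noise f)"
    using int[of 1] by (intro Bochner_Integration.integrable_bound[OF int[of 1]]) auto
  have zero: "(\<integral>z. indicator A (fst z) * noise f z \<partial>\<rho>) = 0" if A: "A \<in> sets N0" for A
  proof -
    have "(\<integral>z. indicator A (fst z) * cond (noise f) z \<partial>\<rho>) = (\<integral>z. 0 \<partial>\<rho>)"
      using cond_integral(2)[OF noise_int A] mean0 by (intro integral_cong_AE) (auto dest: borel_measurable_integrable)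
    then show ?thesis using cond_integral(1)[OF noise_int A] by simp
  qed
  have fin: "(\<integral>\<^sup>+z. ennreal (indicator A (fst z) * Z z) \<partial>\<rho>) \<noteq> \<infinity>" if "integrable \<rho> Z" "A \<in> sets N0" for A Z
    using integrable_indicator_times[OF that] by (auto simp: real_integrable_def)
  have ind_eq: "(\<integral>\<^sup>+z. ennreal (indicator A (fst z) * Z z) \<partial>\<rho>) = (\<integral>\<^sup>+z. indicator A (fst z) * ennreal (Z z) \<partial>\<rho>)"
    for A and Z :: "'x \<times> real \<Rightarrow> real"
    by (intro nn_integral_cong) (auto simp: indicator_def)
  have balance: "(\<integral>\<^sup>+z. indicator A (fst z) * ennreal (noise f z) \<partial>\<rho>) = (\<integral>\<^sup>+z. indicator A (fst z) * ennreal (- noise f z) \<partial>\<rho>)"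
    if A: "A \<in> sets N0" for A
  proof -
    have "enn2real (\<integral>\<^sup>+z. ennreal (indicator A (fst z) * noise f z) \<partial>\<rho>)
        = enn2real (\<integral>\<^sup>+z. ennreal (indicator A (fst z) * (- noise f z)) \<partial>\<rho>)"
      using zero[OF A] real_lebesgue_integral_def[OF integrable_indicator_times[OF noise_int A]] by simp
    moreover have "(\<integral>\<^sup>+z. ennreal (indicator A (fst z) * noise f z) \<partial>\<rho>) \<noteq> \<infinity>"
      "(\<integral>\<^sup>+z. ennreal (indicator A (fst z) * (- noise f z)) \<partial>\<rho>) \<noteq> \<infinity>"
      using fin[OF noise_int A] fin[of "\<lambda>z. - noise f z" A] noise_int A by auto
    ultimately have "(\<integral>\<^sup>+z. ennreal (indicator A (fst z) * noise f z) \<partial>\<rho>)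
        = (\<integral>\<^sup>+z. ennreal (indicator A (fst z) * (- noise f z)) \<partial>\<rho>)"
      by (rule enn2real_inject[rotated 2])
    then show ?thesis unfolding ind_eq .
  qed
  have space_ind: "(\<integral>\<^sup>+z. indicator (space N0) (fst z) * h z \<partial>\<rho>) = (\<integral>\<^sup>+z. h z \<partial>\<rho>)" for h
    using measurable_space[OF fst_measurable] by (intro nn_integral_cong) auto
  have fin_pos: "(\<integral>\<^sup>+z. ennreal (noise f z) \<partial>\<rho>) \<noteq> \<infinity>"
    using noise_int by (auto simp: real_integrable_def)
  obtain \<psi> where \<psi>: "\<psi> \<in> borel_measurable N0"
    "\<And>A. A \<in> sets N0 \<Longrightarrow> (\<integral>\<^sup>+z. indicator A (fst z) * ennreal (noise f z) \<partial>\<rho>) = (\<integral>\<^sup>+z. indicator A (fst z) * \<psi> (fst z) \<partial>\<rho>)"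
    using conditional_density_exists[of "\<lambda>z. ennreal (noise f z)"] fin_pos by auto
  have 1: "AE \<omega> in P. \<forall>i<n. (\<integral>\<^sup>+y. ennreal (noise f (design n \<omega> i, y i)) \<partial>\<kappa> (design n \<omega>)) = \<psi> (design n \<omega> i)"
    using fin_pos \<psi> by (intro conditional_single) auto
  \<comment> \<open>By \<open>balance\<close>, the density of the positive part also represents the
    negative part, so both conditional integrals have the same value.\<close>
  have 2: "AE \<omega> in P. \<forall>i<n. (\<integral>\<^sup>+y. ennreal (- noise f (design n \<omega> i, y i)) \<partial>\<kappa> (design n \<omega>)) = \<psi> (design n \<omega> i)"
    using noise_int \<psi> balance by (intro conditional_single[of "\<lambda>z. ennreal (- noise f z)"]) (auto simp: real_integrable_def)
  have var_A: "(\<integral>\<^sup>+z. indicator A (fst z) * ennreal ((noise f z)\<^sup>2) \<partial>\<rho>) = (\<integral>\<^sup>+z. indicator A (fst z) * ennreal (\<sigma>\<^sup>2) \<partial>\<rho>)"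
    if A [measurable]: "A \<in> sets N0" for A
  proof -
    have i1: "integrable \<rho> (\<lambda>z. indicator A (fst z) * \<sigma>\<^sup>2)"
      using A by (intro integrable_indicator_times) auto
    have "(\<integral>\<^sup>+z. indicator A (fst z) * ennreal ((noise f z)\<^sup>2) \<partial>\<rho>) = ennreal (\<integral>z. indicator A (fst z) * (noise f z)\<^sup>2 \<partial>\<rho>)"
      unfolding ind_eq[symmetric] by (intro nn_integral_eq_integral integrable_indicator_times sq A) auto
    also have "(\<integral>z. indicator A (fst z) * (noise f z)\<^sup>2 \<partial>\<rho>) = (\<integral>z. indicator A (fst z) * cond (\<lambda>z. (noise f z)\<^sup>2) z \<partial>\<rho>)"
      by (rule cond_integral(1)[OF sq A])
    also have "\<dots> = (\<integral>z. indicator A (fst z) * \<sigma>\<^sup>2 \<partial>\<rho>)"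
      using cond_integral(2)[OF sq A] var by (intro integral_cong_AE) (auto dest: borel_measurable_integrable)
    also have "ennreal \<dots> = (\<integral>\<^sup>+z. indicator A (fst z) * ennreal (\<sigma>\<^sup>2) \<partial>\<rho>)"
      unfolding ind_eq[symmetric] by (intro nn_integral_eq_integral[symmetric] i1) auto
    finally show ?thesis .
  qed
  have 3: "AE \<omega> in P. \<forall>i<n. (\<integral>\<^sup>+y. ennreal ((noise f (design n \<omega> i, y i))\<^sup>2) \<partial>\<kappa> (design n \<omega>)) = ennreal (\<sigma>\<^sup>2)"
  proof (rule conditional_single[of "\<lambda>z. ennreal ((noise f z)\<^sup>2)" "\<lambda>_. ennreal (\<sigma>\<^sup>2)"])
    show "(\<integral>\<^sup>+z. ennreal ((noise f z)\<^sup>2) \<partial>\<rho>) \<noteq> \<infinity>" using sq by (auto simp: real_integrable_def)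
  qed (use var_A in auto)
  define \<phi> where "\<phi> z = ennreal (exp (1 / (12 * a\<^sup>2 * \<sigma>\<^sup>2) * (noise f z)\<^sup>2))" for z
  have \<phi>_m: "\<phi> \<in> borel_measurable \<rho>" unfolding \<phi>_def by measurable
  have \<phi>_le: "(\<integral>\<^sup>+z. indicator A (fst z) * \<phi> z \<partial>\<rho>) \<le> ennreal 2 * (\<integral>\<^sup>+z. indicator A (fst z) \<partial>\<rho>)"
    if "A \<in> sets N0" for A
    unfolding \<phi>_def by (rule sub_Gaussian_square_exponential[OF noise_m \<sigma> a int le that])
  have \<phi>_fin: "(\<integral>\<^sup>+z. \<phi> z \<partial>\<rho>) \<noteq> \<infinity>"
  proof -
    have "(\<integral>\<^sup>+z. \<phi> z \<partial>\<rho>) \<le> ennreal 2 * (\<integral>\<^sup>+z. indicator (space N0) (fst z) \<partial>\<rho>)"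
      using \<phi>_le[of "space N0"] unfolding space_ind by simp
    also have "\<dots> \<le> ennreal 2 * (\<integral>\<^sup>+z. 1 \<partial>\<rho>)"
      by (intro mult_left_mono nn_integral_mono) (auto simp: indicator_def)
    also have "\<dots> = ennreal 2" by (simp add: R.emeasure_space_1)
    finally show ?thesis by (auto simp: top_unique)
  qed
  \<comment> \<open>The conditional expectation of the exponential square has no explicit form. It
    suffices that it is at most 2 for almost every covariate, hence at every point of almost every
    design.\<close>
  obtain \<eta> where \<eta>: "\<eta> \<in> borel_measurable N0"
    "\<And>A. A \<in> sets N0 \<Longrightarrow> (\<integral>\<^sup>+z. indicator A (fst z) * \<phi> z \<partial>\<rho>) = (\<integral>\<^sup>+z. indicator A (fst z) * \<eta> (fst z) \<partial>\<rho>)"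
    using conditional_density_exists[OF \<phi>_m \<phi>_fin] by auto
  have 4: "AE \<omega> in P. \<forall>i<n. (\<integral>\<^sup>+y. \<phi> (design n \<omega> i, y i) \<partial>\<kappa> (design n \<omega>)) = \<eta> (design n \<omega> i)"
    using \<phi>_m \<phi>_fin \<eta> by (intro conditional_single) auto
  have "AE z in \<rho>. \<eta> (fst z) \<le> ennreal 2"
    using \<phi>_le \<eta> by (intro density_le_AE) auto
  then have "AE \<omega> in P. \<forall>i<n. \<eta> (fst (\<omega> i)) \<le> ennreal 2" by (rule design_AE)
  with 1 2 3 4 show ?thesis
  proof eventually_elim
    case (elim \<omega>)
    show ?case
    proof (intro allI impI)
      fix i assume i: "i < n"
      have d: "design n \<omega> i = fst (\<omega> i)" using i by (simp add: design_def)
      show "(\<integral>\<^sup>+y. ennreal (y i - f (design n \<omega> i)) \<partial>\<kappa> (design n \<omega>)) = (\<integral>\<^sup>+y. ennreal (- (y i - f (design n \<omega> i))) \<partial>\<kappa> (design n \<omega>))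
        \<and> (\<integral>\<^sup>+y. ennreal ((y i - f (design n \<omega> i))\<^sup>2) \<partial>\<kappa> (design n \<omega>)) = ennreal (\<sigma>\<^sup>2)
        \<and> (\<integral>\<^sup>+y. ennreal (exp (1 / (12 * a\<^sup>2 * \<sigma>\<^sup>2) * (y i - f (design n \<omega> i))\<^sup>2)) \<partial>\<kappa> (design n \<omega>)) \<le> 2"
        using elim(1)[rule_format, OF i] elim(2)[rule_format, OF i] elim(3)[rule_format, OF i]
          elim(4)[rule_format, OF i] elim(5)[rule_format, OF i]
        by (simp add: noise_def \<phi>_def d)
    qed
  qed
qed

end

section \<open>The oracle inequality\<close>

text \<open>The deviation parameter of the theorem is called \<open>s\<close>, since
  \<open>u\<close> denotes the basis. The slack \<open>D\<close> adds the linear deviation 12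
  s/\<beta> to the quadratic one 51 (sqrt(n s) + s)/\<beta>; hence 63 = 51 + 12.\<close>

locale filter_noise =
  noise_model_basis n \<nu> \<sigma> \<beta> u + spectral_filter n F \<sigma> \<gamma> T c1 c2 D
  for n \<nu> \<sigma> \<beta> u F \<gamma> T c1 c2 D +
  fixes s :: real
  assumes s: "1 < s" and n_pos: "1 \<le> n" and \<sigma>: "0 < \<sigma>"
    and D_eq: "D = (51 * sqrt (real n * s) + 63 * s) / \<beta>"
begin

definition "e z j = (\<Sum>i<n. u j i * z i)"

text \<open>Half of the part of the residual that is linear in the noise, written with coefficients
  on the independent coordinates \<open>z i\<close>, as the tail bound requires.\<close>

definition "cross t z = (\<Sum>i<n. (\<Sum>j<n. (1 - \<gamma> t j)\<^sup>2 * F j * u j i) * z i)"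

lemma cross_eq: "cross t z = (\<Sum>j<n. (1 - \<gamma> t j)\<^sup>2 * F j * e z j)"
  unfolding cross_def e_def sum_distrib_right sum_distrib_left
  by (subst sum.swap) (simp add: mult.assoc)

text \<open>Parseval together with (1 - \<gamma>)^4 \<le> (1 - \<gamma>)^2. This is why deviations
  of the linear part can be absorbed into the bias.\<close>

lemma cross_coefficients:
  "(\<Sum>i<n. (\<Sum>j<n. (1 - \<gamma> t j)\<^sup>2 * F j * u j i)\<^sup>2) \<le> bias t"
proof -
  define a where "a j = (1 - \<gamma> t j)\<^sup>2 * F j" for j
  have "(\<Sum>i<n. (\<Sum>j<n. a j * u j i)\<^sup>2) = (\<Sum>j<n. (a j)\<^sup>2)"
    by (rule orthonormal_sum_squares[OF on])
  also have "\<dots> \<le> bias t"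
    unfolding bias_def
  proof (intro sum_mono)
    fix j assume "j \<in> {..<n}"
    then have j: "j < n" by simp
    define c where "c = (1 - \<gamma> t j)\<^sup>2"
    have c: "0 \<le> c" "c \<le> 1" using \<gamma>_bounds[OF j, of t] by (auto simp: c_def abs_square_le_1)
    have "c * c \<le> c * 1" using c by (intro mult_left_mono) auto
    then have "c\<^sup>2 * (F j)\<^sup>2 \<le> c * (F j)\<^sup>2" by (intro mult_right_mono) (auto simp: power2_eq_square)
    then show "(a j)\<^sup>2 \<le> (1 - \<gamma> t j)\<^sup>2 * (F j)\<^sup>2" by (simp add: a_def c_def power_mult_distrib)
  qed
  finally show ?thesis by (simp add: a_def)
qed

lemma resid_eq: "resid (e z) t = bias t + 2 * cross t z + qform (\<lambda>j. (1 - \<gamma> t j)\<^sup>2) z"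
proof -
  have "resid (e z) t = (\<Sum>j<n. (1 - \<gamma> t j)\<^sup>2 * (F j)\<^sup>2 + 2 * ((1 - \<gamma> t j)\<^sup>2 * F j * e z j) + (1 - \<gamma> t j)\<^sup>2 * (e z j)\<^sup>2)"
    unfolding resid_def by (intro sum.cong refl) (simp add: power2_eq_square algebra_simps)
  then show ?thesis
    unfolding cross_eq bias_def qform_def e_def[symmetric] by (simp add: sum.distrib sum_distrib_left)
qed

lemma noise_level: "\<sigma>\<^sup>2 * (\<Sum>j<n. (1 - \<gamma> t j)\<^sup>2) = real n * \<sigma>\<^sup>2 - gap t"
  unfolding gap_alt by (simp add: sum_subtractf algebra_simps)

lemma shrink_bounds: "j < n \<Longrightarrow> 0 \<le> (1 - \<gamma> t j)\<^sup>2" "j < n \<Longrightarrow> (1 - \<gamma> t j)\<^sup>2 \<le> 1"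
  using \<gamma>_bounds[of j t] by (auto simp: abs_square_le_1)

text \<open>The times \<open>t1\<close> and \<open>t2\<close> depend on the bias and the gap only,
  not on the noise. So \<open>S\<close> is a fixed event, valid for all \<open>t\<close> at
  once.\<close>

lemma good_event:
  "\<exists>S\<in>sets PN. measure PN S \<le> 5 * exp (- s) \<and> (\<forall>z\<in>space PN - S. \<forall>t\<le>T.
     loss (e z) (stop (e z)) \<le> 2 * (bias t + 4 * c1 * var t + 4 * c2 * \<sigma>\<^sup>2 + 4 * D)
      + 2 * ((1 + 17 / (\<beta> * \<sigma>\<^sup>2)) * (3 / 2 * bias t + 3 / 2 * var t + D) + 34 * s / \<beta>))"
proof -
  interpret P: prob_space PN by (rule prob_space_noise)
  obtain t1 where t1: "t1 \<le> T" "gap t1 \<le> 3 / 2 * bias t1 + D" "t1 = T \<or> gap t1 = 3 / 2 * bias t1 + D"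
    using upper_time_exists by blast
  obtain t2 where t2: "t2 \<le> T" "t2 = 0 \<or> gap t2 + 2 * D \<le> bias t2 / 2" "t2 = T \<or> bias t2 / 2 \<le> gap t2 + 2 * D"
    using lower_time_exists by blast
  define w where "w t i = (\<Sum>j<n. (1 - \<gamma> t j)\<^sup>2 * F j * u j i)" for t i
  define a where "a t j = (1 - \<gamma> t j)\<^sup>2" for t j
  \<comment> \<open>\<open>S1\<close> and \<open>S2\<close> make the residual at \<open>t1\<close>
    too large through its linear and quadratic part, \<open>S4\<close> and \<open>S5\<close> make it
    too small at \<open>t2\<close>, and \<open>S3\<close> is an excess of the stochastic error at
    \<open>t1\<close>.\<close>
  define S1 where "S1 = {z \<in> space PN. bias t1 / 2 + 12 * s / \<beta> < 2 * (\<Sum>i<n. w t1 i * z i)}"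
  define S2 where "S2 = {z \<in> space PN. 51 * (sqrt (real n * s) + s) / \<beta> < 1 * (qform (a t1) z - \<sigma>\<^sup>2 * (\<Sum>j<n. a t1 j))}"
  define S3 where "S3 = {z \<in> space PN. \<sigma>\<^sup>2 * (\<Sum>j<n. (\<gamma> t1 j)\<^sup>2) + (17 * (\<Sum>j<n. (\<gamma> t1 j)\<^sup>2) + 34 * s) / \<beta> < qform (\<lambda>j. (\<gamma> t1 j)\<^sup>2) z}"
  define S4 where "S4 = {z \<in> space PN. bias t2 / 2 + 12 * s / \<beta> < 2 * (\<Sum>i<n. - w t2 i * z i)}"
  define S5 where "S5 = {z \<in> space PN. 51 * (sqrt (real n * s) + s) / \<beta> < - 1 * (qform (a t2) z - \<sigma>\<^sup>2 * (\<Sum>j<n. a t2 j))}"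
  note [measurable] = qform_measurable
  have lin_m [measurable]: "(\<lambda>z. \<Sum>i<n. c i * z i) \<in> borel_measurable PN" for c
    by (intro borel_measurable_sum borel_measurable_times borel_measurable_const component_measurable) auto
  have sets: "S1 \<in> sets PN" "S2 \<in> sets PN" "S3 \<in> sets PN" "S4 \<in> sets PN" "S5 \<in> sets PN"
    unfolding S1_def S2_def S3_def S4_def S5_def by measurable
  have m1: "measure PN S1 \<le> exp (- s)"
    unfolding S1_def by (rule linear_tail) (use cross_coefficients in \<open>simp add: w_def\<close>)
  have m2: "measure PN S2 \<le> exp (- s)"
    unfolding S2_def a_def using shrink_bounds s n_pos by (intro qform_deviation) auto
  have m3: "measure PN S3 \<le> exp (- s)"
    unfolding S3_def using \<gamma>_bounds by (intro qform_upper_tail) (auto simp: power_le_one)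
  have m4: "measure PN S4 \<le> exp (- s)"
    unfolding S4_def by (rule linear_tail) (use cross_coefficients in \<open>simp add: w_def\<close>)
  have m5: "measure PN S5 \<le> exp (- s)"
    unfolding S5_def a_def using shrink_bounds s n_pos by (intro qform_deviation) auto
  define S where "S = S1 \<union> S2 \<union> S3 \<union> S4 \<union> S5"
  have "measure PN S \<le> measure PN S1 + measure PN S2 + measure PN S3 + measure PN S4 + measure PN S5"
    unfolding S_def
    using measure_Un_le[OF sets(1,2)] measure_Un_le[OF sets.Un[OF sets(1,2)] sets(3)]
      measure_Un_le[OF sets.Un[OF sets.Un[OF sets(1,2)] sets(3)] sets(4)]
      measure_Un_le[OF sets.Un[OF sets.Un[OF sets.Un[OF sets(1,2)] sets(3)] sets(4)] sets(5)]
    by linarith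
  then have mS: "measure PN S \<le> 5 * exp (- s)" using m1 m2 m3 m4 m5 by linarith
  have D: "D = 12 * s / \<beta> + 51 * (sqrt (real n * s) + s) / \<beta>"
    unfolding D_eq by (simp add: add_divide_distrib algebra_simps)
  have "loss (e z) (stop (e z)) \<le> 2 * (bias t + 4 * c1 * var t + 4 * c2 * \<sigma>\<^sup>2 + 4 * D)
      + 2 * ((1 + 17 / (\<beta> * \<sigma>\<^sup>2)) * (3 / 2 * bias t + 3 / 2 * var t + D) + 34 * s / \<beta>)"
    if z: "z \<in> space PN - S" and t: "t \<le> T" for z t
  proof (rule loss_at_stop[OF t1 t2 _ _ _ _ t])
    have "2 * cross t1 z \<le> bias t1 / 2 + 12 * s / \<beta>"
      using z by (auto simp: S_def S1_def cross_def w_def not_less)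
    moreover have "qform (a t1) z - \<sigma>\<^sup>2 * (\<Sum>j<n. a t1 j) \<le> 51 * (sqrt (real n * s) + s) / \<beta>"
      using z by (auto simp: S_def S2_def not_less)
    ultimately show "resid (e z) t1 \<le> real n * \<sigma>\<^sup>2 - gap t1 + 3 / 2 * bias t1 + D"
      using resid_eq[of z t1] noise_level[of t1] unfolding D a_def[symmetric] by linarith
    have st: "stoch (e z) t1 = qform (\<lambda>j. (\<gamma> t1 j)\<^sup>2) z" by (simp add: stoch_def qform_def e_def)
    have "qform (\<lambda>j. (\<gamma> t1 j)\<^sup>2) z \<le> \<sigma>\<^sup>2 * (\<Sum>j<n. (\<gamma> t1 j)\<^sup>2) + (17 * (\<Sum>j<n. (\<gamma> t1 j)\<^sup>2) + 34 * s) / \<beta>"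
      using z by (auto simp: S_def S3_def not_less)
    also have "\<dots> = (1 + 17 / (\<beta> * \<sigma>\<^sup>2)) * var t1 + 34 * s / \<beta>"
      using \<sigma> \<beta> by (simp add: var_def add_divide_distrib distrib_right)
    finally show "stoch (e z) t1 \<le> (1 + 17 / (\<beta> * \<sigma>\<^sup>2)) * var t1 + 34 * s / \<beta>" unfolding st .
    show "0 \<le> 1 + 17 / (\<beta> * \<sigma>\<^sup>2)" using \<beta> by simp
    have "- (2 * cross t2 z) \<le> bias t2 / 2 + 12 * s / \<beta>"
      using z by (auto simp: S_def S4_def cross_def w_def not_less sum_negf)
    moreover have "- (qform (a t2) z - \<sigma>\<^sup>2 * (\<Sum>j<n. a t2 j)) \<le> 51 * (sqrt (real n * s) + s) / \<beta>"
      using z by (auto simp: S_def S5_def not_less)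
    ultimately show "real n * \<sigma>\<^sup>2 - gap t2 + bias t2 / 2 - D \<le> resid (e z) t2"
      using resid_eq[of z t2] noise_level[of t2] unfolding D a_def[symmetric] by linarith
  qed
  then show ?thesis using mS sets by (intro bexI[of _ S]) (auto simp: S_def)
qed

lemma expected_loss: "(\<integral>z. loss (e z) t \<partial>PN) = bias t + var t"
proof -
  interpret P: prob_space PN by (rule prob_space_noise)
  have expand: "loss (e z) t = (\<Sum>j<n. (1 - \<gamma> t j)\<^sup>2 * (F j)\<^sup>2 - 2 * (1 - \<gamma> t j) * F j * \<gamma> t j * e z j + (\<gamma> t j)\<^sup>2 * (e z j)\<^sup>2)" for z
    unfolding loss_def by (intro sum.cong refl) (simp add: power2_eq_square algebra_simps)
  have i1: "integrable PN (\<lambda>z. e z j)" and m1: "(\<integral>z. e z j \<partial>PN) = 0" for j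
    unfolding e_def by (rule linear_form_expectation)+
  have i2: "integrable PN (\<lambda>z. (e z j)\<^sup>2)" for j
    unfolding e_def by (rule linear_form_variance)
  have m2: "(\<integral>z. (e z j)\<^sup>2 \<partial>PN) = \<sigma>\<^sup>2" if "j < n" for j
    unfolding e_def linear_form_variance(2) using on that by (simp add: power2_eq_square)
  have "(\<integral>z. loss (e z) t \<partial>PN) = (\<Sum>j<n. \<integral>z. (1 - \<gamma> t j)\<^sup>2 * (F j)\<^sup>2 - 2 * (1 - \<gamma> t j) * F j * \<gamma> t j * e z j + (\<gamma> t j)\<^sup>2 * (e z j)\<^sup>2 \<partial>PN)"
    unfolding expand using i1 i2 by (intro Bochner_Integration.integral_sum) auto
  also have "\<dots> = (\<Sum>j<n. (1 - \<gamma> t j)\<^sup>2 * (F j)\<^sup>2 + (\<gamma> t j)\<^sup>2 * \<sigma>\<^sup>2)"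
    using i1 i2 m1 m2 by (intro sum.cong refl) (simp add: P.prob_space)
  finally show ?thesis by (simp add: bias_def var_def sum.distrib sum_distrib_left mult.commute)
qed

end

section \<open>The filter at a single eigenvalue and the trace bound\<close>

lemma filter_at_real: "0 \<le> r \<Longrightarrow> l * filter_fun g (ennreal r) l = (if l = 0 then 0 else l * g l r)"
  by (simp add: filter_fun_def)

context
  fixes M B :: real and g :: "real \<Rightarrow> real \<Rightarrow> real" and l :: real
  assumes reg: "regularizer M B g" and l: "0 \<le> l" "l \<le> M\<^sup>2"
begin

lemma regularizer_facts:
  assumes "l \<noteq> 0"
  shows "mono_on {0..} (\<lambda>t. l * g l t)" "continuous_on {0..} (\<lambda>t. l * g l t)" "g l 0 = 0"
    "((\<lambda>t. l * g l t) \<longlongrightarrow> 1) at_top"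
    "0 \<le> t \<Longrightarrow> 0 \<le> l * g l t" "0 \<le> t \<Longrightarrow> l * g l t \<le> 1" "0 \<le> t \<Longrightarrow> g l t \<le> B * t"
proof -
  have in_range: "l \<in> {0<..M\<^sup>2}" using l assms by auto
  note r = reg[unfolded regularizer_def]
  have "mono_on {0..} (\<lambda>t. l * g l t) \<and> continuous_on {0..} (\<lambda>t. l * g l t) \<and> g l 0 = 0 \<and> ((\<lambda>t. l * g l t) \<longlongrightarrow> 1) at_top"
    using conjunct1[OF conjunct2[OF r]] in_range by (rule bspec)
  then show "mono_on {0..} (\<lambda>t. l * g l t)" "continuous_on {0..} (\<lambda>t. l * g l t)" "g l 0 = 0"
    "((\<lambda>t. l * g l t) \<longlongrightarrow> 1) at_top" by blast+
  have "\<forall>t\<ge>0. 0 \<le> l * g l t \<and> l * g l t \<le> 1 \<and> g l t \<le> B * t"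
    using conjunct2[OF conjunct2[OF conjunct2[OF r]]] in_range by (rule bspec)
  then show "0 \<le> t \<Longrightarrow> 0 \<le> l * g l t" "0 \<le> t \<Longrightarrow> l * g l t \<le> 1" "0 \<le> t \<Longrightarrow> g l t \<le> B * t" by blast+
qed

lemma filter_zero: "l * filter_fun g 0 l = 0"
  using filter_at_real[of 0 l g] regularizer_facts(3) by simp

lemma filter_bounds: "0 \<le> l * filter_fun g t l" "l * filter_fun g t l \<le> 1"
proof -
  have "0 \<le> l * filter_fun g t l \<and> l * filter_fun g t l \<le> 1"
  proof (cases t)
    case (real r)
    then show ?thesis using regularizer_facts(5,6)[of r] filter_at_real[of r l g] by auto
  next
    case top
    then show ?thesis by (simp add: filter_fun_def)
  qed
  then show "0 \<le> l * filter_fun g t l" "l * filter_fun g t l \<le> 1" by auto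
qed

lemma filter_mono: "t \<le> t' \<Longrightarrow> l * filter_fun g t l \<le> l * filter_fun g t' l"
proof (cases "l = 0")
  case False
  assume le: "t \<le> t'"
  show ?thesis
  proof (cases t')
    case (real r')
    then obtain r where r: "t = ennreal r" "0 \<le> r" using le by (cases t) (auto simp: top_unique)
    then have "r \<le> r'" using le real by simp
    then show ?thesis using monotone_onD[OF regularizer_facts(1)[OF False], of r r'] r real False
      by (simp add: filter_at_real)
  next
    case top
    \<comment> \<open>At time infinity and l \<noteq> 0 the product is 1, the largest possible
      value.\<close>
    then show ?thesis using filter_bounds(2)[of t] False by (simp add: filter_fun_def)
  qed
qed simp

lemma filter_continuous: "continuous_on {0..} (\<lambda>r. l * filter_fun g (ennreal r) l)"
proof (cases "l = 0")
  case False
  then show ?thesis using regularizer_facts(2)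
    by (subst continuous_on_cong[OF refl, of _ _ "\<lambda>r. l * g l r"]) (auto simp: filter_at_real)
qed simp

lemma filter_limit: "((\<lambda>r. l * filter_fun g (ennreal r) l) \<longlongrightarrow> l * filter_fun g \<infinity> l) at_top"
proof (cases "l = 0")
  case False
  have "eventually (\<lambda>r. l * g l r = l * filter_fun g (ennreal r) l) at_top"
    using eventually_ge_at_top[of 0] by eventually_elim (use False in \<open>simp add: filter_at_real\<close>)
  then have "((\<lambda>r. l * filter_fun g (ennreal r) l) \<longlongrightarrow> 1) at_top"
    using regularizer_facts(4)[OF False] by (rule Lim_transform_eventually[rotated])
  then show ?thesis using False by (simp add: filter_fun_def)
qed simp

lemma filter_le_linear:
  assumes "0 \<le> r"
  shows "l * filter_fun g (ennreal r) l \<le> B * r * l"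
  using regularizer_facts(7)[of r] assms l by (auto simp: filter_at_real mult.commute intro!: mult_left_mono)

end

text \<open>Split at the first index \<open>m\<close> with \<lambda> r < 1. Before \<open>m\<close>
  each \<gamma> is at most 1 and at least \<open>b\<close>, so their sum is at most m \<le> (sum of
  \<gamma>^2)/b^2. From \<open>m\<close> on, \<gamma> \<le> B r \<lambda>, and the eigenvalue bound
  with \<lambda>_m r < 1 gives at most B E max(m, 1). The additive B E accounts for m = 0.\<close>

lemma filter_trace_bound:
  assumes reg: "regularizer M B g" and lam: "\<And>j. j < n \<Longrightarrow> 0 \<le> lam j" "\<And>j. j < n \<Longrightarrow> lam j \<le> M\<^sup>2"
    and low: "\<forall>\<mu>\<in>{0<..M\<^sup>2}. \<forall>t\<ge>0. b * min 1 (\<mu> * t) \<le> \<mu> * g \<mu> t"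
    and pos: "0 < b" "0 < B" "0 < E"
    and bound: "\<And>m. m < n \<Longrightarrow> m = 0 \<or> 1 \<le> ennreal (lam (m - 1)) * T \<Longrightarrow> (\<Sum>i=m..<n. lam i) \<le> E * real (max m 1) * lam m"
    and t: "t \<le> T"
  defines "\<gamma> \<equiv> \<lambda>j. lam j * filter_fun g t (lam j)"
  shows "(\<Sum>j<n. \<gamma> j) \<le> (1 + (1 + B * E) / b\<^sup>2) * (\<Sum>j<n. (\<gamma> j)\<^sup>2) + B * E"
proof -
  have \<gamma>_bounds: "0 \<le> \<gamma> j" "\<gamma> j \<le> 1" if "j < n" for j
    unfolding \<gamma>_def using filter_bounds[OF reg lam[OF that]] by auto
  have sq_nonneg: "0 \<le> (\<Sum>j<n. (\<gamma> j)\<^sup>2)" by (intro sum_nonneg) auto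
  have BE: "0 \<le> B * E" "0 \<le> (1 + B * E) / b\<^sup>2" using pos by auto
  show ?thesis
  proof (cases t)
    case top
    \<comment> \<open>At time infinity every \<gamma> is 0 or 1.\<close>
    have "\<gamma> j = (\<gamma> j)\<^sup>2" for j using top by (simp add: \<gamma>_def filter_fun_def)
    then have "(\<Sum>j<n. \<gamma> j) = (\<Sum>j<n. (\<gamma> j)\<^sup>2)" by simp
    then show ?thesis using mult_nonneg_nonneg[OF BE(2) sq_nonneg] BE(1) by (simp only: distrib_right mult_1)
  next
    case (real r)
    define m where "m = (LEAST m. n \<le> m \<or> lam m * r < 1)"
    have m: "n \<le> m \<or> lam m * r < 1" unfolding m_def by (rule LeastI[of _ n]) simp
    have below: "j < n \<and> 1 \<le> lam j * r" if "j < m" for j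
      using not_less_Least[of j "\<lambda>m. n \<le> m \<or> lam m * r < 1"] that by (auto simp: m_def)
    have mn: "m \<le> n" unfolding m_def by (rule Least_le) simp
    have split: "(\<Sum>j<n. h j) = (\<Sum>j<m. h j) + (\<Sum>j=m..<n. h j)" for h :: "nat \<Rightarrow> real"
      using mn by (subst sum.union_disjoint[symmetric]) (auto intro!: sum.cong)
    have head: "(\<Sum>j<m. \<gamma> j) \<le> real m"
      using sum_mono[of "{..<m}" \<gamma> "\<lambda>_. 1"] \<gamma>_bounds below by auto
    have tail: "(\<Sum>j=m..<n. \<gamma> j) \<le> B * E * real m + B * E"
    proof (cases "m = n")
      case True
      then show ?thesis using BE by simp
    next
      case False
      then have "m < n" using mn by simp
      have mr: "lam m * r < 1" using m \<open>m < n\<close> by simp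
      \<comment> \<open>With numbering from 0, \<open>lam (m - 1)\<close> is the m-th largest
        eigenvalue. Minimality of \<open>m\<close> makes it at least 1/r, and t \<le> T passes this
        on to \<open>T\<close>.\<close>
      have "m = 0 \<or> 1 \<le> ennreal (lam (m - 1)) * T"
      proof (cases "m = 0")
        case False
        then have "1 \<le> lam (m - 1) * r" "m - 1 < n" using below[of "m - 1"] by auto
        then have "1 \<le> ennreal (lam (m - 1) * r)" by simp
        also have "\<dots> = ennreal (lam (m - 1)) * t"
          using lam \<open>m - 1 < n\<close> real by (simp add: ennreal_mult)
        also have "\<dots> \<le> ennreal (lam (m - 1)) * T" using t by (intro mult_left_mono) auto
        finally show ?thesis by simp
      qed simp
      then have bd: "(\<Sum>i=m..<n. lam i) \<le> E * real (max m 1) * lam m" by (rule bound[OF \<open>m < n\<close>])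
      have "(\<Sum>j=m..<n. \<gamma> j) \<le> (\<Sum>j=m..<n. B * r * lam j)"
        unfolding \<gamma>_def using real lam by (intro sum_mono) (auto intro!: filter_le_linear[OF reg])
      also have "\<dots> = B * r * (\<Sum>j=m..<n. lam j)" by (rule sum_distrib_left[symmetric])
      also have "\<dots> \<le> B * r * (E * real (max m 1) * lam m)"
        using bd pos real by (intro mult_left_mono) auto
      also have "\<dots> = B * E * real (max m 1) * (lam m * r)" by simp
      also have "\<dots> \<le> B * E * real (max m 1) * 1"
        using mr pos by (intro mult_left_mono) auto
      also have "\<dots> \<le> B * E * (real m + 1)"
        using BE(1) by (simp only: mult_1_right) (intro mult_left_mono, auto)
      finally show ?thesis by (simp add: distrib_left)
    qed
    have "b\<^sup>2 * real m \<le> (\<Sum>j<m. (\<gamma> j)\<^sup>2)"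
    proof -
      have "b\<^sup>2 \<le> (\<gamma> j)\<^sup>2" if "j < m" for j
      proof -
        have j: "j < n" "1 \<le> lam j * r" using below[OF that] by auto
        then have "lam j \<noteq> 0" by auto
        then have "lam j \<in> {0<..M\<^sup>2}" using lam[OF j(1)] by auto
        then have "b * min 1 (lam j * r) \<le> lam j * g (lam j) r" using low real by auto
        then have "b \<le> \<gamma> j" using j \<open>lam j \<noteq> 0\<close> real by (simp add: \<gamma>_def filter_at_real)
        then show ?thesis using pos by (intro power_mono) auto
      qed
      then have "(\<Sum>j<m. b\<^sup>2) \<le> (\<Sum>j<m. (\<gamma> j)\<^sup>2)" by (intro sum_mono) auto
      then show ?thesis by (simp add: mult.commute)
    qed
    also have "\<dots> \<le> (\<Sum>j<n. (\<gamma> j)\<^sup>2)" unfolding split[of "\<lambda>j. (\<gamma> j)\<^sup>2"] by (simp add: sum_nonneg)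
    finally have "real m \<le> (\<Sum>j<n. (\<gamma> j)\<^sup>2) / b\<^sup>2" using pos by (simp add: pos_le_divide_eq mult.commute)
    then have "(1 + B * E) * real m \<le> (1 + B * E) * ((\<Sum>j<n. (\<gamma> j)\<^sup>2) / b\<^sup>2)"
      using BE(1) by (intro mult_left_mono) auto
    moreover have "(\<Sum>j<n. \<gamma> j) \<le> (1 + B * E) * real m + B * E"
      unfolding split[of \<gamma>] using head tail by (simp add: distrib_right)
    moreover have "(1 + (1 + B * E) / b\<^sup>2) * (\<Sum>j<n. (\<gamma> j)\<^sup>2)
        = (\<Sum>j<n. (\<gamma> j)\<^sup>2) + (1 + B * E) * ((\<Sum>j<n. (\<gamma> j)\<^sup>2) / b\<^sup>2)" by (simp add: distrib_right)
    ultimately show ?thesis using sq_nonneg by linarith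
  qed
qed

section \<open>Constants and the inequality at a fixed design\<close>

text \<open>Here \<open>k\<close> is 1/(\<beta> \<sigma>^2), \<open>c1\<close> and B E come from the
  trace bound, and \<open>c3\<close> is the factor on the variance in the upper tail. From D \<le>
  63 k r and c4 \<le> 34 k r, with r = \<sigma>^2 (sqrt(n s) + s), arise 572 = 8 * 63 + 2 * 34 and
  126 = 2 * 63.\<close>

definition oracle_constant :: "real \<Rightarrow> real \<Rightarrow> real \<Rightarrow> real \<Rightarrow> real" where
  "oracle_constant A b B E =
    (let k = 12 * A\<^sup>2; c1 = 1 + (1 + B * E) / b\<^sup>2; c3 = 1 + 17 * k
     in 2 + 6 * c3 + 8 * c1 + 8 * (B * E) + 572 * k + 126 * k * c3)"

lemma oracle_constant_pos:
  assumes "1 \<le> A" "0 < b" "0 < B" "0 < E"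
  shows "0 < oracle_constant A b B E"
proof -
  show ?thesis
    unfolding oracle_constant_def Let_def using assms
    by (intro add_pos_nonneg add_nonneg_nonneg mult_nonneg_nonneg divide_nonneg_nonneg) auto
qed

lemma collect_constants:
  fixes bias var r :: real
  assumes nn: "0 \<le> bias" "0 \<le> var" "0 \<le> c1" "0 \<le> c2" "1 \<le> c3" "0 \<le> k" "0 \<le> r"
    and le: "\<sigma>2 \<le> r" "D \<le> 63 * k * r" "c4 \<le> 34 * k * r"
  shows "2 * (bias + 4 * c1 * var + 4 * c2 * \<sigma>2 + 4 * D) + 2 * (c3 * (3 / 2 * bias + 3 / 2 * var + D) + c4)
    \<le> (2 + 6 * c3 + 8 * c1 + 8 * c2 + 572 * k + 126 * k * c3) * (bias + var + r)"
proof -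
  have 1: "c2 * \<sigma>2 \<le> c2 * r" using nn le by (intro mult_left_mono) auto
  have "c3 * D \<le> c3 * (63 * k * r)" using nn le by (intro mult_left_mono) auto
  then have 2: "c3 * D \<le> 63 * (k * c3 * r)" by (simp add: mult_ac)
  define C where "C = 2 + 6 * c3 + 8 * c1 + 8 * c2 + 572 * k + 126 * k * c3"
  have kc: "0 \<le> k * c3" using nn by simp
  have "(2 + 3 * c3) * bias \<le> C * bias" "(8 * c1 + 3 * c3) * var \<le> C * var"
    "(8 * c2 + 572 * k + 126 * (k * c3)) * r \<le> C * r"
    using nn kc by (auto simp: C_def intro!: mult_right_mono)
  moreover have "(2 + 3 * c3) * bias = 2 * bias + 3 * (c3 * bias)"
    "(8 * c1 + 3 * c3) * var = 8 * (c1 * var) + 3 * (c3 * var)"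
    "(8 * c2 + 572 * k + 126 * (k * c3)) * r = 8 * (c2 * r) + 572 * (k * r) + 126 * (k * c3 * r)"
    by (simp_all add: algebra_simps)
  moreover have "2 * (bias + 4 * c1 * var + 4 * c2 * \<sigma>2 + 4 * D) + 2 * (c3 * (3 / 2 * bias + 3 / 2 * var + D) + c4)
      = 2 * bias + 8 * (c1 * var) + 8 * (c2 * \<sigma>2) + 8 * D + 3 * (c3 * bias) + 3 * (c3 * var) + 2 * (c3 * D) + 2 * c4"
    by (simp add: algebra_simps)
  moreover have "C * (bias + var + r) = C * bias + C * var + C * r" by (simp add: distrib_left)
  moreover have "D \<le> 63 * (k * r)" "c4 \<le> 34 * (k * r)" using le by (simp_all add: mult.assoc)
  ultimately show ?thesis using 1 2 unfolding C_def[symmetric] by linarith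
qed

text \<open>At a fixed design, \<open>Q\<close> is the law of the responses. Subtracting f(x_i) maps
  it to a product of noise laws, where the abstract analysis applies; all its quantities are n times
  those of the statement.\<close>

lemma oracle_inequality_given_design:
  fixes Q :: "(nat \<Rightarrow> real) measure" and f :: "'x \<Rightarrow> real"
  assumes S: "sampled_rkhs X k H ip n x M v lam"
    and desc: "\<forall>i j. i \<le> j \<longrightarrow> j < n \<longrightarrow> lam j \<le> lam i"
    and ke: "\<forall>j<n. kernel_eigenvalue k n x (Suc j) = lam j"
    and pos: "1 \<le> A" "0 < b" "0 < B" "0 < E" "0 < \<sigma>"
    and reg: "regularizer M B g"
    and low: "\<forall>\<mu>\<in>{0<..M\<^sup>2}. \<forall>t\<ge>0. b * min 1 (\<mu> * t) \<le> \<mu> * g \<mu> t"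
    and eb: "eigenvalue_bound k n E T x"
    and Q: "prob_space Q" "sets Q = sets (Pi\<^sub>M {..<n} (\<lambda>_. borel))"
    and indep: "prob_space.indep_vars Q (\<lambda>_. borel) (\<lambda>i y. y i) {..<n}"
    and mean: "\<And>i. i < n \<Longrightarrow> (\<integral>\<^sup>+y. ennreal (y i - f (x i)) \<partial>Q) = (\<integral>\<^sup>+y. ennreal (- (y i - f (x i))) \<partial>Q)"
    and var: "\<And>i. i < n \<Longrightarrow> (\<integral>\<^sup>+y. ennreal ((y i - f (x i))\<^sup>2) \<partial>Q) = ennreal (\<sigma>\<^sup>2)"
    and subG: "\<And>i. i < n \<Longrightarrow> (\<integral>\<^sup>+y. ennreal (exp (1 / (12 * A\<^sup>2 * \<sigma>\<^sup>2) * (y i - f (x i))\<^sup>2)) \<partial>Q) \<le> 2"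
    and s: "1 < s"
  shows "\<P>(y in Q. sq_loss H ip g n f x y (tau_DP H ip g n \<sigma> T x y) >
      oracle_constant A b B E * ((INF t\<in>{0..T}. \<integral>y'. sq_loss H ip g n f x y' t \<partial>Q)
        + \<sigma>\<^sup>2 * sqrt s / sqrt (real n) + \<sigma>\<^sup>2 * s / real n)) \<le> 5 * exp (- s)"
proof -
  interpret S: sampled_rkhs X k H ip n x M v lam by (rule S)
  interpret Q: prob_space Q by (rule Q(1))
  have n: "1 \<le> n" by (rule S.n_pos)
  define \<beta> where "\<beta> = 1 / (12 * A\<^sup>2 * \<sigma>\<^sup>2)"
  \<comment> \<open>The noise model asks for a probability measure at every index; beyond
    \<open>n\<close> a point mass fills in.\<close>
  define \<nu> where "\<nu> i = (if i < n then distr Q borel (\<lambda>y. y i - f (x i)) else return borel 0)" for i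
  define \<Phi> where "\<Phi> y = (\<lambda>i\<in>{..<n}. y i - f (x i))" for y :: "nat \<Rightarrow> real"
  define L where "L = Pi\<^sub>M {..<n} (\<lambda>_. borel :: real measure)"
  define Pn where "Pn = Pi\<^sub>M {..<n} \<nu>"
  have QL [measurable_cong]: "sets Q = sets L" using Q(2) by (simp add: L_def)
  have coord [measurable]: "(\<lambda>y. y i) \<in> borel_measurable Q" if "i < n" for i
    using that by (simp add: measurable_cong_sets[OF QL refl] L_def)
  have \<beta>: "0 < \<beta>" using pos by (simp add: \<beta>_def)
  have shift: "(\<lambda>y. y i - f (x i)) \<in> borel_measurable Q" if "i < n" for i
    using coord[OF that] by measurable
  have law: "distr Q L \<Phi> = Pn"
  proof -
    have "Q.indep_vars (\<lambda>_. borel) (\<lambda>i y. y i - f (x i)) {..<n}"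
      using Q.indep_vars_compose2[OF indep, of "\<lambda>i t. t - f (x i)" "\<lambda>_. borel"] by simp
    then have "distr Q L \<Phi> = Pi\<^sub>M {..<n} (\<lambda>i. distr Q borel (\<lambda>y. y i - f (x i)))"
      unfolding L_def \<Phi>_def using n shift
      by (subst (asm) Q.indep_vars_iff_distr_eq_PiM') (auto simp: lessThan_empty_iff)
    also have "\<dots> = Pn" unfolding Pn_def by (rule PiM_cong) (auto simp: \<nu>_def)
    finally show ?thesis .
  qed
  have \<Phi> [measurable]: "\<Phi> \<in> Q \<rightarrow>\<^sub>M L"
    unfolding L_def \<Phi>_def using shift by (intro measurable_restrict) auto
  have "noise_model n \<nu> \<sigma> \<beta>"
  proof (rule noise_model.intro)
    show "prob_space (\<nu> i)" for i
      unfolding \<nu>_def using shift by (auto intro: Q.prob_space_distr prob_space_return)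
    show "sets (\<nu> i) = sets borel" for i by (simp add: \<nu>_def)
    show "0 < \<beta>" by (rule \<beta>)
    fix i assume i: "i < n"
    note [measurable] = shift[OF i]
    have \<nu>: "\<nu> i = distr Q borel (\<lambda>y. y i - f (x i))" using i by (simp add: \<nu>_def)
    \<comment> \<open>Equal integrals of the positive and negative part give 0 in the integrable
      case; otherwise the integral is 0 by convention.\<close>
    have "(\<integral>y. y i - f (x i) \<partial>Q) = 0"
    proof (cases "integrable Q (\<lambda>y. y i - f (x i))")
      case True
      show ?thesis unfolding real_lebesgue_integral_def[OF True] mean[OF i] by simp
    qed (rule not_integrable_integral_eq)
    then show "(\<integral>x. x \<partial>\<nu> i) = 0" unfolding \<nu> by (subst integral_distr) auto
    have "(\<integral>y. (y i - f (x i))\<^sup>2 \<partial>Q) = enn2real (\<integral>\<^sup>+y. ennreal ((y i - f (x i))\<^sup>2) \<partial>Q)"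
      by (intro integral_eq_nn_integral) auto
    then show "(\<integral>x. x\<^sup>2 \<partial>\<nu> i) = \<sigma>\<^sup>2" unfolding \<nu> var[OF i] by (subst integral_distr) auto
    show "(\<integral>\<^sup>+x. ennreal (exp (\<beta> * x\<^sup>2)) \<partial>\<nu> i) \<le> 2"
      unfolding \<nu> using subG[OF i] by (subst nn_integral_distr) (auto simp: \<beta>_def)
  qed
  then interpret noise_model n \<nu> \<sigma> \<beta> .
  interpret noise_model_basis n \<nu> \<sigma> \<beta> v
    by standard (rule S.on, rule S.complete)
  define F where "F j = (\<Sum>l<n. f (x l) * v j l)" for j
  define \<gamma> where "\<gamma> t j = lam j * filter_fun g t (lam j)" for t j
  define c1 where "c1 = 1 + (1 + B * E) / b\<^sup>2"
  define c2 where "c2 = B * E"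
  define D where "D = (51 * sqrt (real n * s) + 63 * s) / \<beta>"
  have filter: "\<gamma> 0 j = 0" "0 \<le> \<gamma> t j" "\<gamma> t j \<le> 1" "t' \<le> t \<Longrightarrow> \<gamma> t' j \<le> \<gamma> t j"
      "continuous_on {0..} (\<lambda>r. \<gamma> (ennreal r) j)" "((\<lambda>r. \<gamma> (ennreal r) j) \<longlongrightarrow> \<gamma> \<infinity> j) at_top"
    if "j < n" for j t t'
    unfolding \<gamma>_def
    using filter_zero[OF reg S.lam_nonneg[OF that] S.lam_le[OF that]]
      filter_bounds[OF reg S.lam_nonneg[OF that] S.lam_le[OF that], of t]
      filter_mono[OF reg S.lam_nonneg[OF that] S.lam_le[OF that], of t' t]
      filter_continuous[OF reg S.lam_nonneg[OF that] S.lam_le[OF that]]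
      filter_limit[OF reg S.lam_nonneg[OF that] S.lam_le[OF that]]
    by blast+
  interpret filter_noise n \<nu> \<sigma> \<beta> v F \<gamma> T c1 c2 D s
  proof
    fix t assume t: "t \<le> T"
    show "(\<Sum>j<n. \<gamma> t j) \<le> c1 * (\<Sum>j<n. (\<gamma> t j)\<^sup>2) + c2"
      unfolding \<gamma>_def c1_def c2_def
    proof (rule filter_trace_bound[OF reg _ _ low _ _ _ _ t])
      fix m assume m: "m < n" "m = 0 \<or> 1 \<le> ennreal (lam (m - 1)) * T"
      have "m = 0 \<or> 1 \<le> ennreal (kernel_eigenvalue k n x m) * T"
        using m ke by (cases m) auto
      then have "(\<Sum>i\<in>{m+1..n}. kernel_eigenvalue k n x i) \<le> E * real (max m 1) * kernel_eigenvalue k n x (m + 1)"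
        using eb m(1) by (auto simp: eigenvalue_bound_def)
      moreover have "(\<Sum>i\<in>{m+1..n}. kernel_eigenvalue k n x i) = (\<Sum>i=m..<n. lam i)"
      proof -
        have "(\<Sum>i\<in>{Suc m..<Suc n}. kernel_eigenvalue k n x i) = (\<Sum>i=m..<n. kernel_eigenvalue k n x (Suc i))"
          by (rule sum.shift_bounds_Suc_ivl)
        also have "\<dots> = (\<Sum>i=m..<n. lam i)" using ke by (intro sum.cong) auto
        finally show ?thesis by (simp add: atLeastLessThanSuc_atLeastAtMost)
      qed
      moreover have "kernel_eigenvalue k n x (m + 1) = lam m" using ke m(1) by simp
      ultimately show "(\<Sum>i=m..<n. lam i) \<le> E * real (max m 1) * lam m" by simp
    qed (use S.lam_nonneg S.lam_le pos in auto)
  next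
    show "0 < D" using s n \<beta> unfolding D_def by (intro divide_pos_pos add_nonneg_pos) auto
    show "0 \<le> c1" "0 \<le> c2" using pos by (auto simp: c1_def c2_def)
  qed (fact filter s n \<open>0 < \<sigma>\<close> D_def)+
  \<comment> \<open>The coefficients of the responses split into signal and noise, so loss and
    residual become functions of the shifted vector \<open>\<Phi> y\<close>.\<close>
  have coef: "(\<Sum>l<n. y l * v j l) = F j + e (\<Phi> y) j" for y j
  proof -
    have "F j + e (\<Phi> y) j = (\<Sum>l<n. f (x l) * v j l + v j l * (y l - f (x l)))"
      unfolding F_def e_def sum.distrib by (simp add: \<Phi>_def)
    also have "\<dots> = (\<Sum>l<n. y l * v j l)" by (simp add: algebra_simps)
    finally show ?thesis ..
  qed
  have loss: "sq_loss H ip g n f x y t = loss (e (\<Phi> y)) t / real n" for y t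
  proof -
    have "F j - \<gamma> t j * (F j + e (\<Phi> y) j) = (1 - \<gamma> t j) * F j - \<gamma> t j * e (\<Phi> y) j" for j
      by (simp add: algebra_simps)
    then show ?thesis
      unfolding S.sq_loss_eq loss_def F_def[symmetric] unfolding coef \<gamma>_def[symmetric] by (simp only:)
  qed
  have stop: "tau_DP H ip g n \<sigma> T x y = stop (e (\<Phi> y))" for y
  proof -
    have "(emp_norm n (\<lambda>i. y i - fitted H ip g n x y t i))\<^sup>2 = resid (e (\<Phi> y)) t / real n" for t
    proof -
      have "a - c * a = (1 - c) * a" for a c :: real by (simp add: algebra_simps)
      then show ?thesis unfolding S.residual_eq resid_def coef \<gamma>_def[symmetric] by (simp only:)
    qed
    then show ?thesis using n unfolding tau_DP_def stop_def by (simp add: pos_divide_le_eq mult.commute)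
  qed
  have e_meas: "(\<lambda>z. e z j) \<in> borel_measurable L" for j
    unfolding e_def L_def
    by (intro borel_measurable_sum borel_measurable_times borel_measurable_const measurable_component_singleton) auto
  have risk: "(\<integral>y. sq_loss H ip g n f x y t \<partial>Q) = (bias t + var t) / real n" for t
  proof -
    have "(\<integral>y. loss (e (\<Phi> y)) t \<partial>Q) = (\<integral>z. loss (e z) t \<partial>distr Q L \<Phi>)"
    proof (rule integral_distr[symmetric, OF \<Phi>])
      show "(\<lambda>z. loss (e z) t) \<in> borel_measurable L"
        unfolding loss_def
        by (intro borel_measurable_sum borel_measurable_power borel_measurable_diff borel_measurable_times borel_measurable_const e_meas)
    qed
    also have "\<dots> = bias t + var t" unfolding law Pn_def by (rule expected_loss)
    finally show ?thesis unfolding loss by simp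
  qed
  define C where "C = oracle_constant A b B E"
  have C: "0 < C" unfolding C_def using pos by (intro oracle_constant_pos) auto
  define r where "r = \<sigma>\<^sup>2 * (sqrt (real n * s) + s)"
  define k where "k = 12 * A\<^sup>2"
  have inv\<beta>: "1 / \<beta> = k * \<sigma>\<^sup>2" by (simp add: \<beta>_def k_def)
  have bound: "2 * (bias t + 4 * c1 * var t + 4 * c2 * \<sigma>\<^sup>2 + 4 * D)
      + 2 * ((1 + 17 / (\<beta> * \<sigma>\<^sup>2)) * (3 / 2 * bias t + 3 / 2 * var t + D) + 34 * s / \<beta>)
      \<le> C * (bias t + var t + r)" for t
  proof -
    have c3: "1 + 17 / (\<beta> * \<sigma>\<^sup>2) = 1 + 17 * k" using pos by (simp add: \<beta>_def k_def)
    have sq: "0 \<le> sqrt (real n * s)" using s by simp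
    have "0 \<le> r" using s sq by (simp add: r_def)
    have "1 \<le> sqrt (real n * s) + s" using s sq by linarith
    then have "\<sigma>\<^sup>2 * 1 \<le> r" unfolding r_def by (intro mult_left_mono) auto
    have "D = (k * \<sigma>\<^sup>2) * (51 * sqrt (real n * s) + 63 * s)" unfolding D_def inv\<beta>[symmetric] by simp
    also have "\<dots> \<le> (k * \<sigma>\<^sup>2) * (63 * (sqrt (real n * s) + s))"
      using s sq by (intro mult_left_mono) (auto simp: k_def)
    finally have Dr: "D \<le> 63 * k * r" by (simp add: r_def mult_ac)
    have "34 * s / \<beta> = 34 * (k * \<sigma>\<^sup>2) * s" unfolding inv\<beta>[symmetric] by simp
    also have "\<dots> \<le> 34 * (k * \<sigma>\<^sup>2) * (sqrt (real n * s) + s)"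
      using s sq by (intro mult_left_mono) (auto simp: k_def)
    finally have c4: "34 * s / \<beta> \<le> 34 * k * r" by (simp add: r_def mult_ac)
    have Ceq: "C = 2 + 6 * (1 + 17 * k) + 8 * c1 + 8 * c2 + 572 * k + 126 * k * (1 + 17 * k)"
      by (simp add: C_def oracle_constant_def Let_def k_def c1_def c2_def)
    show ?thesis
      unfolding c3 Ceq using \<open>0 \<le> r\<close> \<open>\<sigma>\<^sup>2 * 1 \<le> r\<close> Dr c4 bias_nonneg var_nonneg c_nonneg
      by (intro collect_constants) (auto simp: k_def)
  qed
  obtain Z where Z: "Z \<in> sets Pn" "measure Pn Z \<le> 5 * exp (- s)"
    and good: "\<And>z t. z \<in> space Pn - Z \<Longrightarrow> t \<le> T \<Longrightarrow> loss (e z) (stop (e z)) \<le> C * (bias t + var t + r)"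
    using good_event bound unfolding Pn_def[symmetric] by (meson order_trans)
  have rn: "r / real n = \<sigma>\<^sup>2 * sqrt s / sqrt (real n) + \<sigma>\<^sup>2 * s / real n"
  proof -
    have "sqrt (real n * s) / real n = (sqrt (real n) * sqrt s) / (sqrt (real n) * sqrt (real n))"
      by (simp add: real_sqrt_mult)
    also have "\<dots> = sqrt s / sqrt (real n)" using n by (intro mult_divide_mult_cancel_left) simp
    finally have eq: "sqrt (real n * s) / real n = sqrt s / sqrt (real n)" .
    have "r / real n = \<sigma>\<^sup>2 * (sqrt (real n * s) / real n) + \<sigma>\<^sup>2 * s / real n"
      by (simp add: r_def distrib_left add_divide_distrib)
    then show ?thesis unfolding eq by simp
  qed
  define bad where "bad = {y \<in> space Q. sq_loss H ip g n f x y (tau_DP H ip g n \<sigma> T x y) >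
      C * ((INF t\<in>{0..T}. \<integral>y'. sq_loss H ip g n f x y' t \<partial>Q)
        + \<sigma>\<^sup>2 * sqrt s / sqrt (real n) + \<sigma>\<^sup>2 * s / real n)}"
  have "bad \<subseteq> \<Phi> -` Z \<inter> space Q"
  proof
    fix y assume y: "y \<in> bad"
    then have yQ: "y \<in> space Q" by (simp add: bad_def)
    have zP: "\<Phi> y \<in> space Pn" using measurable_space[OF \<Phi> yQ] unfolding law[symmetric] by simp
    show "y \<in> \<Phi> -` Z \<inter> space Q"
    proof (rule ccontr)
      assume "y \<notin> \<Phi> -` Z \<inter> space Q"
      then have z: "\<Phi> y \<in> space Pn - Z" using yQ zP by auto
      define l where "l = sq_loss H ip g n f x y (tau_DP H ip g n \<sigma> T x y)"
      \<comment> \<open>Solved for the risk, the bound is a lower bound valid at every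
        \<open>t\<close>, and so passes to the infimum whether or not it is attained.\<close>
      have "l / C - r / real n \<le> (\<integral>y'. sq_loss H ip g n f x y' t \<partial>Q)" if "t \<in> {0..T}" for t
      proof -
        have "l \<le> C * (bias t + var t + r) / real n"
          unfolding l_def loss stop using good[OF z, of t] that by (intro divide_right_mono) auto
        then have "l \<le> ((bias t + var t) / real n + r / real n) * C"
          by (simp add: add_divide_distrib distrib_left distrib_right mult.commute)
        then have "l / C \<le> (bias t + var t) / real n + r / real n" using C by (simp add: pos_divide_le_eq)
        then show ?thesis unfolding risk by simp
      qed
      then have "l / C - r / real n \<le> (INF t\<in>{0..T}. \<integral>y'. sq_loss H ip g n f x y' t \<partial>Q)"
        by (intro cINF_greatest) auto
      then have "l / C \<le> (INF t\<in>{0..T}. \<integral>y'. sq_loss H ip g n f x y' t \<partial>Q) + \<sigma>\<^sup>2 * sqrt s / sqrt (real n) + \<sigma>\<^sup>2 * s / real n"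
        using rn by linarith
      then have "l \<le> C * ((INF t\<in>{0..T}. \<integral>y'. sq_loss H ip g n f x y' t \<partial>Q) + \<sigma>\<^sup>2 * sqrt s / sqrt (real n) + \<sigma>\<^sup>2 * s / real n)"
        using C by (simp add: pos_divide_le_eq mult.commute)
      then show False using y by (simp add: bad_def l_def)
    qed
  qed
  \<comment> \<open>Monotonicity of the measure asks for measurability of the larger set only, so
    \<open>bad\<close> may be compared without examining the loss at the random time.\<close>
  moreover have Z': "\<Phi> -` Z \<inter> space Q \<in> sets Q"
    using Z(1) unfolding law[symmetric] by (intro measurable_sets[OF \<Phi>]) simp
  ultimately have "measure Q bad \<le> measure Q (\<Phi> -` Z \<inter> space Q)"
    by (rule Q.finite_measure_mono)
  also have "\<dots> = measure Pn Z"
    using Z(1) unfolding law[symmetric] by (intro measure_distr[symmetric] \<Phi>) simp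
  finally show ?thesis using Z(2) by (simp add: bad_def C_def)
qed

theorem theorem1:
  fixes A b B E :: real
  assumes "1 \<le> A" and "0 < b" and "0 < B" and "0 < E"
  shows "\<exists>C>0.
    \<forall>(d::nat) (\<X> :: (nat \<Rightarrow> real) set) k H ip f \<sigma> \<rho> (n::nat) \<kappa> (M::real) g (T::ennreal).
      \<X> \<subseteq> euclid d \<longrightarrow>
      positive_kernel \<X> k \<longrightarrow>
      continuous_on (\<X> \<times> \<X>) (\<lambda>(x, y). k x y) \<longrightarrow>
      is_rkhs \<X> k H ip \<longrightarrow>
      regression_model \<X> f \<sigma> \<rho> \<longrightarrow>
      1 \<le> n \<longrightarrow>
      responses_given_design n \<X> \<rho> \<kappa> \<longrightarrow>
      0 < M \<longrightarrow>
      regularizer M B g \<longrightarrow>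
      sub_Gaussian_noise \<X> f \<sigma> \<rho> A \<longrightarrow>
      (AE z in \<rho>. ip_norm ip (kernel_section \<X> k (fst z)) \<le> M) \<longrightarrow>
      (\<forall>\<mu>\<in>{0<..M\<^sup>2}. \<forall>t\<ge>0. b * min 1 (\<mu> * t) \<le> \<mu> * g \<mu> t) \<longrightarrow>
      (AE \<omega> in sample_space n \<rho>.
        let x = design n \<omega> in
        eigenvalue_bound k n E T x \<longrightarrow>
        (\<forall>u>1.
          \<P>(y in \<kappa> x.
              sq_loss H ip g n f x y (tau_DP H ip g n \<sigma> T x y) >
              C * ((INF t\<in>{0..T}. \<integral>y'. sq_loss H ip g n f x y' t \<partial>\<kappa> x)
                   + \<sigma>\<^sup>2 * sqrt u / sqrt (real n) + \<sigma>\<^sup>2 * u / real n))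
            \<le> 5 * exp (- u)))"
proof (intro exI[of _ "oracle_constant A b B E"] conjI allI impI)
  show "0 < oracle_constant A b B E" by (intro oracle_constant_pos assms)
next
  fix d and \<X> :: "(nat \<Rightarrow> real) set" and k H ip f \<sigma> \<rho> and n :: nat and \<kappa> and M :: real and g and T :: ennreal
  assume pk: "positive_kernel \<X> k" and rkhs: "is_rkhs \<X> k H ip"
    and model: "regression_model \<X> f \<sigma> \<rho>" and n: "1 \<le> n"
    and rgd: "responses_given_design n \<X> \<rho> \<kappa>" and M: "0 < M" and reg: "regularizer M B g"
    and subG: "sub_Gaussian_noise \<X> f \<sigma> \<rho> A"
    and kb: "AE z in \<rho>. ip_norm ip (kernel_section \<X> k (fst z)) \<le> M"
    and low: "\<forall>\<mu>\<in>{0<..M\<^sup>2}. \<forall>t\<ge>0. b * min 1 (\<mu> * t) \<le> \<mu> * g \<mu> t"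
  define N0 where "N0 = restrict_space (borel :: (nat \<Rightarrow> real) measure) \<X>"
  have prob: "prob_space \<rho>" using model unfolding regression_model_def by (elim conjE)
  have sets: "sets \<rho> = sets (N0 \<Otimes>\<^sub>M borel)" using model unfolding regression_model_def N0_def by (elim conjE)
  have "iid_design N0 \<rho> n \<kappa>"
    by (rule iid_design.intro[OF prob sets n]) (use rgd in \<open>simp only: responses_given_design_def N0_def\<close>)
  then interpret iid_design N0 \<rho> n \<kappa> .
  have cond: "cond_exp_X \<X> \<rho> = cond"
    by (intro ext) (simp only: cond_exp_X_def cond_def N0_def[symmetric])
  have \<sigma>: "0 < \<sigma>" using model unfolding regression_model_def by (elim conjE)
  have moments: "AE \<omega> in P. \<forall>i<n.
      (\<integral>\<^sup>+y. ennreal (y i - f (design n \<omega> i)) \<partial>\<kappa> (design n \<omega>)) = (\<integral>\<^sup>+y. ennreal (- (y i - f (design n \<omega> i))) \<partial>\<kappa> (design n \<omega>))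
    \<and> (\<integral>\<^sup>+y. ennreal ((y i - f (design n \<omega> i))\<^sup>2) \<partial>\<kappa> (design n \<omega>)) = ennreal (\<sigma>\<^sup>2)
    \<and> (\<integral>\<^sup>+y. ennreal (exp (1 / (12 * A\<^sup>2 * \<sigma>\<^sup>2) * (y i - f (design n \<omega> i))\<^sup>2)) \<partial>\<kappa> (design n \<omega>)) \<le> 2"
  proof (rule conditional_noise_moments[OF _ \<sigma> \<open>1 \<le> A\<close>])
    show "f \<in> borel_measurable N0"
      using model unfolding regression_model_def cond N0_def by (elim conjE)
    show "integrable \<rho> (\<lambda>z. (noise f z)\<^sup>2)"
      using model unfolding regression_model_def cond N0_def by (elim conjE)
    show "AE z in \<rho>. cond (noise f) z = 0"
      using model unfolding regression_model_def cond N0_def by (elim conjE)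
    show "AE z in \<rho>. cond (\<lambda>z. (noise f z)\<^sup>2) z = \<sigma>\<^sup>2"
      using model unfolding regression_model_def cond N0_def by (elim conjE)
    fix q :: real assume "1 \<le> q"
    then show "integrable \<rho> (\<lambda>z. \<bar>noise f z\<bar> powr q)"
      "AE z in \<rho>. q powr (-1/2) * cond (\<lambda>z. \<bar>noise f z\<bar> powr q) z powr (1/q) \<le> A * \<sigma>"
      using subG[unfolded sub_Gaussian_noise_def cond, rule_format, of q] by blast+
  qed
  have "AE \<omega> in P. \<forall>i<n. ip_norm ip (kernel_section \<X> k (fst (\<omega> i))) \<le> M"
    by (rule design_AE[OF kb])
  \<comment> \<open>None of the combined almost sure facts mentions \<open>u\<close>, so a single
    null set of samples serves every u > 1.\<close>
  with moments responses_conditionally_independent AE_space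
  show "AE \<omega> in P.
        let x = design n \<omega> in
        eigenvalue_bound k n E T x \<longrightarrow>
        (\<forall>u>1.
          \<P>(y in \<kappa> x.
              sq_loss H ip g n f x y (tau_DP H ip g n \<sigma> T x y) >
              oracle_constant A b B E * ((INF t\<in>{0..T}. \<integral>y'. sq_loss H ip g n f x y' t \<partial>\<kappa> x)
                   + \<sigma>\<^sup>2 * sqrt u / sqrt (real n) + \<sigma>\<^sup>2 * u / real n))
            \<le> 5 * exp (- u))"
  proof eventually_elim
    case (elim \<omega>)
    define x where "x = design n \<omega>"
    have xN: "x \<in> space N" unfolding x_def using measurable_space[OF design_measurable elim(3)] .
    have x_in: "x i \<in> \<X>" if "i < n" for i
      using xN that by (auto simp: space_PiM N0_def space_restrict_space)
    have kb: "ip_norm ip (kernel_section \<X> k (x i)) \<le> M" if "i < n" for i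
      using elim(4) that by (simp add: x_def design_def)
    have sym: "k (x i) (x l) = k (x l) (x i)" if "i < n" "l < n" for i l
      using pk x_in that by (auto simp: positive_kernel_def)
    obtain v lam where v: "\<forall>j<n. \<forall>l<n. (\<Sum>i<n. v j i * v l i) = of_bool (j = l)"
      "\<forall>j<n. \<forall>i<n. (\<Sum>l<n. k (x i) (x l) / real n * v j l) = lam j * v j i"
      "\<forall>j<n. kernel_eigenvalue k n x (Suc j) = lam j"
      "\<forall>i j. i \<le> j \<longrightarrow> j < n \<longrightarrow> lam j \<le> lam i"
      using kernel_matrix_eigenbasis[of n k x] sym by blast
    have S: "sampled_rkhs \<X> k H ip n x M v lam"
      using rkhs n x_in kb M v orthonormal_complete[OF v(1)] by unfold_locales auto
    have "\<P>(y in \<kappa> x.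
              sq_loss H ip g n f x y (tau_DP H ip g n \<sigma> T x y) >
              oracle_constant A b B E * ((INF t\<in>{0..T}. \<integral>y'. sq_loss H ip g n f x y' t \<partial>\<kappa> x)
                   + \<sigma>\<^sup>2 * sqrt u / sqrt (real n) + \<sigma>\<^sup>2 * u / real n))
            \<le> 5 * exp (- u)" if "eigenvalue_bound k n E T x" "1 < u" for u
      using elim(1) elim(2) \<kappa>_prob_space[OF elim(3)] \<kappa>_sets[OF elim(3)] assms \<sigma> that
      unfolding x_def[symmetric]
      by (intro oracle_inequality_given_design[OF S v(4,3) _ _ _ _ _ reg low]) auto
    then show ?case by (simp add: Let_def x_def)
  qed
qed

end
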